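(* Suppose that $B$ is $E$-visible finite, and let $\Lambda=B[E]$. Then the following statements are equivalent. (1) There are only finitely many isomorphism classes of mixed bricks in $\mathrm{mod}\,\Lambda$. (2) There are only finitely many realized admissible pairs, and all of these realized pairs are critical. If these equivalent conditions hold, then $\Lambda$ is brick-finite if and only if $B$ is brick-finite.
   Context: $\Bbbk$ is an algebraically closed field; all algebras are finite-dimensional over $\Bbbk$ and all modules are finite-dimensional right modules. $B$ is a $\Bbbk$-algebra, $E$ is a $\Bbbk$-$B$-bimodule (i.e. a right $B$-module), and $\Lambda=B[E]=\begin{pmatrix} B & 0 \\ E & \Bbbk \end{pmatrix}$ is the one-point extension. Right $\Lambda$-modules are described by triples $(N,W,\eta)$ with $N$ a right $B$-module, $W$ a finite-dimensional $\Bbbk$-vector space and $\eta\colon W\to \mathrm{Hom}_B(E,N)$ a $\Bbbk$-linear map; a morphism $(N,W,\eta)\to(N',W',\eta')$ is a pair $(f,g)$ with $f\colon N\to N'$ $B$-linear, $g\colon W\to W'$ $\Bbbk$-linear and $f_*\circ\eta=\eta'\circ g$, where $f_*(\varphi)=f\circ\varphi$. A brick is a module whose endomorphism algebra is $\Bbbk\,\mathrm{id}$ (equivalently a division algebra); an algebra is brick-finite if it has only finitely many isomorphism classes of bricks. A mixed brick is a brick $(N,W,\eta)$ with $N\ne0$ and $W\neq0$. An indecomposable $B$-module $X$ is $E$-visible if $\mathrm{Hom}_B(E,X)\neq0$; $B$ is $E$-visible finite if there are only finitely many isomorphism classes of $E$-visible indecomposable $B$-modules. In that case let $X_1,\dots,X_t$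 be a complete list of representatives. For $\mathbf m=(m_1,\dots,m_t)\in\mathbb Z_{\ge0}^t$ put $N_{\mathbf m}=\bigoplus_{i=1}^tX_i^{m_i}$, $h(\mathbf m)=\dim_\Bbbk\mathrm{Hom}_B(E,N_{\mathbf m})$, $r(\mathbf m)=\dim_\Bbbk\mathrm{End}_B(N_{\mathbf m})$. A pair $(\mathbf m,\ell)$ with $0\ne\mathbf m\in\mathbb Z_{\ge0}^t$ and $1\le\ell\le h(\mathbf m)$ is admissible if $r(\mathbf m)-1\le\ell(h(\mathbf m)-\ell)$, and an admissible pair is critical if equality holds. It is realized if there is an $\ell$-dimensional subspace $L\subseteq\mathrm{Hom}_B(E,N_{\mathbf m})$ with $\{f\in\mathrm{End}_B(N_{\mathbf m})\mid f_*(L)\subseteq L\}=\Bbbk\,\mathrm{id}_{N_{\mathbf m}}$ (equivalently, if there is a mixed brick $(N,W,\eta)$ with $N\cong N_{\mathbf m}$ and $\dim_\Bbbk W=\ell$). *)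

theory Defs
  imports
    "HOL-Library.Function_Algebras"
    "HOL-Library.Product_Plus"
    "HOL-Computational_Algebra.Polynomial"
begin

text \<open>
  A space is a subset of an ambient abelian group type carrying a scalar multiplication of the
  whole type. Addition is that of the type. Only the behaviour on the carrier matters.
\<close>

record ('k, 'v) space =
  car :: "'v set"
  smul :: "'k \<Rightarrow> 'v \<Rightarrow> 'v"

record ('k, 'a) algebra = "('k, 'a) space" +
  mul :: "'a \<Rightarrow> 'a \<Rightarrow> 'a"
  unt :: 'a

record ('k, 'a, 'v) rmodule = "('k, 'v) space" +
  act :: "'v \<Rightarrow> 'a \<Rightarrow> 'v"

definition fd_space :: "('k::field, 'v::ab_group_add, 'z) space_scheme \<Rightarrow> bool" where
  "fd_space V \<longleftrightarrow> vector_space (smul V) \<and> (\<exists>S. finite S \<and> module.span (smul V) S = car V)"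

definition vdim :: "('k::field, 'v::ab_group_add, 'z) space_scheme \<Rightarrow> nat" where
  "vdim V = vector_space.dim (smul V) (car V)"

text \<open>The zero algebra is allowed.\<close>

definition fd_algebra :: "('k::field, 'a::ab_group_add) algebra \<Rightarrow> bool" where
  "fd_algebra A \<longleftrightarrow> fd_space A \<and> unt A \<in> car A \<and>
    (\<forall>a\<in>car A. mul A (unt A) a = a \<and> mul A a (unt A) = a) \<and>
    (\<forall>a\<in>car A. \<forall>b\<in>car A. mul A a b \<in> car A \<and>
      (\<forall>r. mul A (smul A r a) b = smul A r (mul A a b) \<and>
           mul A a (smul A r b) = smul A r (mul A a b)) \<and>
      (\<forall>c\<in>car A. mul A (mul A a b) c = mul A a (mul A b c) \<and>
         mul A (a + b) c = mul A a c + mul A b c \<and>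
         mul A a (b + c) = mul A a b + mul A a c))"

definition fd_module ::
  "('k::field, 'a::ab_group_add) algebra \<Rightarrow> ('k, 'a, 'v::ab_group_add) rmodule \<Rightarrow> bool" where
  "fd_module A M \<longleftrightarrow> fd_space M \<and>
    (\<forall>x\<in>car M. act M x (unt A) = x) \<and>
    (\<forall>x\<in>car M. \<forall>a\<in>car A. act M x a \<in> car M \<and>
      (\<forall>r. act M (smul M r x) a = smul M r (act M x a) \<and>
           act M x (smul A r a) = smul M r (act M x a)) \<and>
      (\<forall>y\<in>car M. act M (x + y) a = act M x a + act M y a) \<and>
      (\<forall>b\<in>car A. act M x (a + b) = act M x a + act M x b \<and>
         act M x (mul A a b) = act M (act M x a) b))"

text \<open>
  Maps are normalised to be \<open>0\<close> off the carrier of their source, so that a set of maps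
  is again a space under the pointwise operations.
\<close>

definition lin :: "('k, 'v::ab_group_add, 'y) space_scheme \<Rightarrow>
    ('k, 'w::ab_group_add, 'z) space_scheme \<Rightarrow> ('v \<Rightarrow> 'w) set" where
  "lin V W = {f. (\<forall>x\<in>car V. f x \<in> car W) \<and> (\<forall>x. x \<notin> car V \<longrightarrow> f x = 0) \<and>
     (\<forall>x\<in>car V. \<forall>y\<in>car V. f (x + y) = f x + f y) \<and>
     (\<forall>r. \<forall>x\<in>car V. f (smul V r x) = smul W r (f x))}"

definition hom :: "('k, 'a) algebra \<Rightarrow> ('k, 'a, 'v::ab_group_add) rmodule \<Rightarrow>
    ('k, 'a, 'w::ab_group_add) rmodule \<Rightarrow> ('v \<Rightarrow> 'w) set" where
  "hom A M N = {f \<in> lin M N. \<forall>x\<in>car M. \<forall>a\<in>car A. f (act M x a) = act N (f x) a}"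

definition hom_space :: "('k, 'a) algebra \<Rightarrow> ('k, 'a, 'v::ab_group_add) rmodule \<Rightarrow>
    ('k, 'a, 'w::ab_group_add) rmodule \<Rightarrow> ('k, 'v \<Rightarrow> 'w) space" where
  "hom_space A M N = \<lparr>car = hom A M N, smul = (\<lambda>r f x. smul N r (f x))\<rparr>"

definition homothety :: "('k, 'v::ab_group_add, 'z) space_scheme \<Rightarrow> 'k \<Rightarrow> 'v \<Rightarrow> 'v" where
  "homothety V r = (\<lambda>x. if x \<in> car V then smul V r x else 0)"

definition iso :: "('k, 'a) algebra \<Rightarrow> ('k, 'a, 'v::ab_group_add) rmodule \<Rightarrow>
    ('k, 'a, 'w::ab_group_add) rmodule \<Rightarrow> bool" where
  "iso A M N \<longleftrightarrow> (\<exists>f\<in>hom A M N. bij_betw f (car M) (car N))"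

definition nonzero :: "('k, 'v::zero, 'z) space_scheme \<Rightarrow> bool" where
  "nonzero V \<longleftrightarrow> car V \<noteq> {0}"

definition brick ::
  "('k::field, 'a::ab_group_add) algebra \<Rightarrow> ('k, 'a, 'v::ab_group_add) rmodule \<Rightarrow> bool" where
  "brick A M \<longleftrightarrow> fd_module A M \<and> nonzero M \<and> hom A M M = range (homothety M)"

definition submodule ::
  "('k::field, 'a) algebra \<Rightarrow> ('k, 'a, 'v::ab_group_add) rmodule \<Rightarrow> 'v set \<Rightarrow> bool" where
  "submodule A M U \<longleftrightarrow> U \<subseteq> car M \<and> module.subspace (smul M) U \<and>
     (\<forall>x\<in>U. \<forall>a\<in>car A. act M x a \<in> U)"

definition indecomposable ::
  "('k::field, 'a::ab_group_add) algebra \<Rightarrow> ('k, 'a, 'v::ab_group_add) rmodule \<Rightarrow> bool" where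
  "indecomposable A M \<longleftrightarrow> fd_module A M \<and> nonzero M \<and>
     (\<forall>U V. submodule A M U \<and> submodule A M V \<and> U \<inter> V = {0} \<and>
        {u + v | u v. u \<in> U \<and> v \<in> V} = car M \<longrightarrow> U = {0} \<or> V = {0})"

text \<open>
  Isomorphism classes are counted among modules whose ambient type is \<open>nat \<Rightarrow> 'k\<close>. This type
  contains a copy of every finite-dimensional vector space, so it meets every isomorphism class of
  finite-dimensional modules: this is \<open>ex_iso_coordinate_module\<close>.
\<close>

lemma vector_space_pointwise: "vector_space (\<lambda>r (v :: 'i \<Rightarrow> 'k::field) n. r * v n)"
  by unfold_locales (auto simp: fun_eq_iff algebra_simps)

lemma ex_iso_coordinate_module:
  fixes A :: "('k::field, 'a::ab_group_add) algebra"
    and M :: "('k, 'a, 'v::ab_group_add) rmodule"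
  assumes M: "fd_module A M"
  shows "\<exists>M' :: ('k, 'a, nat \<Rightarrow> 'k) rmodule. fd_module A M' \<and> iso A M M'"
proof -
  from M have fdM: "fd_space M" by (simp add: fd_module_def)
  then interpret V: vector_space "smul M" by (simp add: fd_space_def)
  interpret F: vector_space "\<lambda>r (v :: nat \<Rightarrow> 'k) n. r * v n" by (rule vector_space_pointwise)
  interpret P: vector_space_pair "smul M" "\<lambda>r (v :: nat \<Rightarrow> 'k) n. r * v n" ..
  from fdM obtain S where S: "finite S" "V.span S = car M" by (auto simp: fd_space_def)
  have sub: "V.subspace (car M)" using S V.subspace_span by metis
  obtain C where C: "C \<subseteq> S" "V.independent C" "S \<subseteq> V.span C"
    using V.maximal_independent_subset by blast
  have finC: "finite C" using C S finite_subset by blast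
  have spC: "V.span C = car M" using C S by (metis V.span_mono V.span_span subset_antisym)
  obtain e where e: "bij_betw e {..<card C} C"
    using finC ex_bij_betw_nat_finite atLeast0LessThan by metis
  define R where "R = V.representation C"
  define f where "f x = (if x \<in> car M then (\<lambda>n. if n < card C then R x (e n) else 0) else 0)" for x
  have fadd: "f (x + y) = f x + f y" if "x \<in> car M" "y \<in> car M" for x y
  proof -
    have "R (x + y) c = R x c + R y c" for c
      by (simp add: R_def V.representation_add[OF C(2)] that spC)
    then show ?thesis using that V.subspace_add[OF sub that] by (simp add: f_def fun_eq_iff)
  qed
  have fsc: "f (smul M r x) = (\<lambda>n. r * f x n)" if "x \<in> car M" for x r
  proof -
    have "R (smul M r x) c = r * R x c" for c
      by (simp add: R_def V.representation_scale[OF C(2)] that spC)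
    then show ?thesis using that V.subspace_scale[OF sub that] by (simp add: f_def fun_eq_iff)
  qed
  have inj: "inj_on f (car M)"
  proof (rule inj_onI)
    fix x y assume xy: "x \<in> car M" "y \<in> car M" "f x = f y"
    have "R x c = R y c" if "c \<in> C" for c
    proof -
      have "c \<in> e ` {..<card C}" using that e by (simp add: bij_betw_def)
      then obtain n where "n < card C" "e n = c" by blast
      then show ?thesis using fun_cong[OF xy(3), of n] xy(1,2) by (simp add: f_def)
    qed
    then have "(\<Sum>c\<in>C. smul M (R x c) c) = (\<Sum>c\<in>C. smul M (R y c) c)" by simp
    then show "x = y"
      using xy C finC spC V.sum_representation_eq[OF C(2), of _ C] by (simp add: R_def)
  qed
  define g where "g = inv_into (car M) f"
  have gf: "g (f x) = x" if "x \<in> car M" for x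
    using that inj by (simp add: g_def)
  define M' :: "('k, 'a, nat \<Rightarrow> 'k) rmodule" where
    "M' = \<lparr>car = f ` car M, smul = (\<lambda>r v n. r * v n), act = (\<lambda>v a. f (act M (g v) a))\<rparr>"
  have f0: "f 0 = 0" using fsc[of 0 0] V.subspace_0[OF sub] by (auto simp: fun_eq_iff)
  have fsum: "finite T \<Longrightarrow> T \<subseteq> car M \<Longrightarrow>
      f (\<Sum>s\<in>T. smul M (u s) s) = (\<Sum>s\<in>T. (\<lambda>n. u s * f s n))" for T u
  proof (induction T rule: finite_induct)
    case (insert t T)
    have "(\<Sum>s\<in>T. smul M (u s) s) \<in> car M"
      using insert.prems by (intro V.subspace_sum[OF sub] V.subspace_scale[OF sub]) auto
    moreover have "smul M (u t) t \<in> car M" using insert.prems V.subspace_scale[OF sub] by auto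
    ultimately show ?case using insert by (simp add: fadd fsc)
  qed (simp add: f0)
  have SM: "S \<subseteq> car M" using S V.span_superset by blast
  have spanM': "F.span (f ` S) = f ` car M"
  proof
    have fsub: "F.subspace (f ` car M)"
      unfolding F.subspace_def
    proof (intro conjI ballI allI)
      show "0 \<in> f ` car M" using V.subspace_0[OF sub] f0 by force
    next
      fix v w assume "v \<in> f ` car M" "w \<in> f ` car M"
      then obtain x y where xy: "x \<in> car M" "y \<in> car M" "v = f x" "w = f y" by blast
      have "f (x + y) \<in> f ` car M" using xy V.subspace_add[OF sub] by (intro imageI) blast
      then show "v + w \<in> f ` car M" by (simp add: xy fadd)
    next
      fix r v assume "v \<in> f ` car M"
      then obtain x where x: "x \<in> car M" "v = f x" by blast
      have "f (smul M r x) \<in> f ` car M" using x V.subspace_scale[OF sub] by (intro imageI) blast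
      then show "(\<lambda>n. r * v n) \<in> f ` car M" by (simp add: x fsc)
    qed
    show "F.span (f ` S) \<subseteq> f ` car M"
      by (rule F.span_minimal[OF image_mono[OF SM] fsub])
    show "f ` car M \<subseteq> F.span (f ` S)"
    proof
      fix y assume "y \<in> f ` car M"
      then obtain x where x: "x \<in> V.span S" "y = f x" using S by auto
      then obtain u where "x = (\<Sum>s\<in>S. smul M (u s) s)"
        using V.span_finite[OF S(1)] by auto
      then have "y = (\<Sum>s\<in>S. (\<lambda>n. u s * f s n))" using x fsum S SM by simp
      then show "y \<in> F.span (f ` S)"
        by (simp only:) (intro F.span_sum F.span_scale F.span_base imageI)
    qed
  qed
  have "fd_space M'"
    unfolding fd_space_def M'_def using vector_space_pointwise spanM' S by auto
  moreover have md: "\<And>x. x \<in> car M \<Longrightarrow> act M x (unt A) = x"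
    "\<And>x a. x \<in> car M \<Longrightarrow> a \<in> car A \<Longrightarrow> act M x a \<in> car M"
    "\<And>x a r. x \<in> car M \<Longrightarrow> a \<in> car A \<Longrightarrow> act M (smul M r x) a = smul M r (act M x a)"
    "\<And>x a r. x \<in> car M \<Longrightarrow> a \<in> car A \<Longrightarrow> act M x (smul A r a) = smul M r (act M x a)"
    "\<And>x y a. x \<in> car M \<Longrightarrow> y \<in> car M \<Longrightarrow> a \<in> car A \<Longrightarrow> act M (x + y) a = act M x a + act M y a"
    "\<And>x a b. x \<in> car M \<Longrightarrow> a \<in> car A \<Longrightarrow> b \<in> car A \<Longrightarrow> act M x (a + b) = act M x a + act M x b"
    "\<And>x a b. x \<in> car M \<Longrightarrow> a \<in> car A \<Longrightarrow> b \<in> car A \<Longrightarrow> act M x (mul A a b) = act M (act M x a) b"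
    using M unfolding fd_module_def by blast+
  moreover have M': "car M' = f ` car M" "smul M' = (\<lambda>r v n. r * v n)"
    "\<And>x a. x \<in> car M \<Longrightarrow> act M' (f x) a = f (act M x a)"
    by (simp_all add: M'_def gf)
  ultimately have "fd_module A M'"
    unfolding fd_module_def
    by (simp add: ball_simps fadd[symmetric] fsc[symmetric] V.subspace_add[OF sub]
        V.subspace_scale[OF sub])
  moreover have "f \<in> hom A M M'"
    unfolding hom_def lin_def mem_Collect_eq M'(1,2)
    using fadd fsc M'(3) by (auto simp: f_def)
  moreover have "bij_betw f (car M) (car M')"
    using inj by (simp add: M'_def bij_betw_def)
  ultimately show ?thesis unfolding iso_def by blast
qed

type_synonym ('k, 'a) cmodule = "('k, 'a, nat \<Rightarrow> 'k) rmodule"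

definition fin_many :: "('x \<Rightarrow> bool) \<Rightarrow> ('x \<Rightarrow> 'x \<Rightarrow> bool) \<Rightarrow> bool" where
  "fin_many P R \<longleftrightarrow> finite (Collect P // {(x, y). P x \<and> P y \<and> R x y})"

definition brick_finite :: "('k::field, 'a::ab_group_add) algebra \<Rightarrow> bool" where
  "brick_finite A \<longleftrightarrow> fin_many (\<lambda>M :: ('k, 'a) cmodule. brick A M) (iso A)"

text \<open>The triple \<open>(b, e, r)\<close> stands for the lower triangular matrix with diagonal \<open>b, r\<close> and
  off-diagonal entry \<open>e\<close>; right modules are rows on which these matrices act from the right.\<close>

definition one_point_ext :: "('k::field, 'b::ab_group_add) algebra \<Rightarrow>
    ('k, 'b, 'e::ab_group_add) rmodule \<Rightarrow> ('k, 'b \<times> 'e \<times> 'k) algebra" where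
  "one_point_ext B E = \<lparr>
     car = car B \<times> car E \<times> UNIV,
     smul = (\<lambda>c (b, e, r). (smul B c b, smul E c e, c * r)),
     mul = (\<lambda>(b, e, r) (b', e', r'). (mul B b b', act E e b' + smul E r e', r * r')),
     unt = (unt B, 0, 1)\<rparr>"

lemma fd_algebra_one_point_ext:
  assumes B: "fd_algebra B" and E: "fd_module B E"
  shows "fd_algebra (one_point_ext B E)"
proof -
  let ?s = "\<lambda>c (b, e, r). (smul B c b, smul E c e, c * r)"
  from B interpret V: vector_space "smul B" by (simp add: fd_algebra_def fd_space_def)
  from E interpret W: vector_space "smul E" by (simp add: fd_module_def fd_space_def)
  interpret P: vector_space ?s
    by unfold_locales (auto simp: algebra_simps V.scale_right_distrib V.scale_left_distrib
        W.scale_right_distrib W.scale_left_distrib)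
  obtain S where S: "finite S" "V.span S = car B"
    using B by (auto simp: fd_algebra_def fd_space_def)
  obtain T where T: "finite T" "W.span T = car E"
    using E by (auto simp: fd_module_def fd_space_def)
  have subB: "V.subspace (car B)" and subE: "W.subspace (car E)"
    using S T V.subspace_span W.subspace_span by metis+
  let ?U = "(\<lambda>b. (b, 0, 0)) ` S \<union> (\<lambda>e. (0, e, 0)) ` T \<union> {(0, 0, 1)}"
  have 1: "(b, 0, 0) \<in> P.span ?U" if "b \<in> V.span S" for b
    using that
  proof (induction rule: V.span_induct_alt)
    case base
    show ?case using P.span_zero by (simp add: zero_prod_def)
  next
    case (step c x y)
    have "?s c (x, 0, 0) + (y, 0, 0) \<in> P.span ?U"
      by (intro P.span_add P.span_scale P.span_base step.IH) (use step in auto)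
    then show ?case by simp
  qed
  have 2: "(0, e, 0) \<in> P.span ?U" if "e \<in> W.span T" for e
    using that
  proof (induction rule: W.span_induct_alt)
    case base
    show ?case using P.span_zero by (simp add: zero_prod_def)
  next
    case (step c x y)
    have "?s c (0, x, 0) + (0, y, 0) \<in> P.span ?U"
      by (intro P.span_add P.span_scale P.span_base step.IH) (use step in auto)
    then show ?case by simp
  qed
  have 3: "(0, 0, r) \<in> P.span ?U" for r
  proof -
    have "?s r (0, 0, 1) \<in> P.span ?U" by (intro P.span_scale P.span_base) auto
    then show ?thesis by simp
  qed
  have "P.span ?U = car B \<times> car E \<times> UNIV"
  proof
    have "P.subspace (car B \<times> car E \<times> UNIV)"
      using subB subE by (auto simp: P.subspace_def V.subspace_def W.subspace_def zero_prod_def)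
    moreover have "?U \<subseteq> car B \<times> car E \<times> UNIV"
      using S T V.span_superset[of S] W.span_superset[of T] V.subspace_0[OF subB]
        W.subspace_0[OF subE] by auto
    ultimately show "P.span ?U \<subseteq> car B \<times> car E \<times> UNIV" by (rule P.span_minimal[rotated])
    show "car B \<times> car E \<times> UNIV \<subseteq> P.span ?U"
    proof clarify
      fix b e r assume "b \<in> car B" "e \<in> car E"
      then have "(b, 0, 0) + (0, e, 0) + (0, 0, r) \<in> P.span ?U"
        using 1 2 3 S T by (intro P.span_add) auto
      then show "(b, e, r) \<in> P.span ?U" by simp
    qed
  qed
  moreover have "finite ?U" using S T by auto
  ultimately have fd: "fd_space (one_point_ext B E)"
    unfolding fd_space_def one_point_ext_def using P.vector_space_axioms
    by (auto intro!: exI[of _ ?U])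
  have z: "mul B a 0 = 0" "mul B 0 a = 0" if "a \<in> car B" for a
  proof -
    have "0 \<in> car B" using V.subspace_0[OF subB] .
    then have "mul B a (smul B 0 a) = smul B 0 (mul B a a)"
      "mul B (smul B 0 a) a = smul B 0 (mul B a a)"
      using B that unfolding fd_algebra_def by blast+
    then show "mul B a 0 = 0" "mul B 0 a = 0" by auto
  qed
  have z2: "act E 0 a = 0" if "a \<in> car B" for a
  proof -
    have "act E (smul E 0 0) a = smul E 0 (act E 0 a)"
      using E that W.subspace_0[OF subE] unfolding fd_module_def by blast
    then show ?thesis by simp
  qed
  have alg: "unt B \<in> car B"
    "\<And>a. a \<in> car B \<Longrightarrow> mul B (unt B) a = a" "\<And>a. a \<in> car B \<Longrightarrow> mul B a (unt B) = a"
    "\<And>a b. a \<in> car B \<Longrightarrow> b \<in> car B \<Longrightarrow> mul B a b \<in> car B"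
    "\<And>a b r. a \<in> car B \<Longrightarrow> b \<in> car B \<Longrightarrow> mul B (smul B r a) b = smul B r (mul B a b)"
    "\<And>a b r. a \<in> car B \<Longrightarrow> b \<in> car B \<Longrightarrow> mul B a (smul B r b) = smul B r (mul B a b)"
    "\<And>a b c. a \<in> car B \<Longrightarrow> b \<in> car B \<Longrightarrow> c \<in> car B \<Longrightarrow> mul B (mul B a b) c = mul B a (mul B b c)"
    "\<And>a b c. a \<in> car B \<Longrightarrow> b \<in> car B \<Longrightarrow> c \<in> car B \<Longrightarrow> mul B (a + b) c = mul B a c + mul B b c"
    "\<And>a b c. a \<in> car B \<Longrightarrow> b \<in> car B \<Longrightarrow> c \<in> car B \<Longrightarrow> mul B a (b + c) = mul B a b + mul B a c"
    using B by (simp_all add: fd_algebra_def)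
  have md: "\<And>x. x \<in> car E \<Longrightarrow> act E x (unt B) = x"
    "\<And>x a. x \<in> car E \<Longrightarrow> a \<in> car B \<Longrightarrow> act E x a \<in> car E"
    "\<And>x a r. x \<in> car E \<Longrightarrow> a \<in> car B \<Longrightarrow> act E (smul E r x) a = smul E r (act E x a)"
    "\<And>x a r. x \<in> car E \<Longrightarrow> a \<in> car B \<Longrightarrow> act E x (smul B r a) = smul E r (act E x a)"
    "\<And>x y a. x \<in> car E \<Longrightarrow> y \<in> car E \<Longrightarrow> a \<in> car B \<Longrightarrow> act E (x + y) a = act E x a + act E y a"
    "\<And>x a b. x \<in> car E \<Longrightarrow> a \<in> car B \<Longrightarrow> b \<in> car B \<Longrightarrow> act E x (a + b) = act E x a + act E x b"
    "\<And>x a b. x \<in> car E \<Longrightarrow> a \<in> car B \<Longrightarrow> b \<in> car B \<Longrightarrow> act E x (mul B a b) = act E (act E x a) b"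
    using E by (simp_all add: fd_module_def)
  note cl = V.subspace_add[OF subB] V.subspace_scale[OF subB] W.subspace_add[OF subE]
    W.subspace_scale[OF subE] W.subspace_0[OF subE] V.subspace_0[OF subB]
  let ?L = "one_point_ext B E"
  have L: "car ?L = car B \<times> car E \<times> UNIV" "smul ?L = ?s" "unt ?L = (unt B, 0, 1)"
    "mul ?L = (\<lambda>(b, e, r) (b', e', r'). (mul B b b', act E e b' + smul E r e', r * r'))"
    by (simp_all add: one_point_ext_def)
  note ds = V.scale_right_distrib V.scale_left_distrib W.scale_right_distrib W.scale_left_distrib
  have "mul ?L a b \<in> car ?L" if "a \<in> car ?L" "b \<in> car ?L" for a b
    using that by (auto simp: L alg md cl)
  moreover have "mul ?L (smul ?L r a) b = smul ?L r (mul ?L a b) \<and>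
      mul ?L a (smul ?L r b) = smul ?L r (mul ?L a b)"
    if "a \<in> car ?L" "b \<in> car ?L" for a b r
    using that by (auto simp: L alg md cl ds mult_ac)
  moreover have "mul ?L (mul ?L a b) c = mul ?L a (mul ?L b c)"
    if "a \<in> car ?L" "b \<in> car ?L" "c \<in> car ?L" for a b c
    using that by (auto simp: L alg md cl ds add_ac mult_ac)
  moreover have "mul ?L (a + b) c = mul ?L a c + mul ?L b c \<and>
      mul ?L a (b + c) = mul ?L a b + mul ?L a c"
    if "a \<in> car ?L" "b \<in> car ?L" "c \<in> car ?L" for a b c
    using that by (auto simp: L alg md cl ds add_ac distrib_left distrib_right)
  moreover have "unt ?L \<in> car ?L" "\<forall>a\<in>car ?L. mul ?L (unt ?L) a = a \<and> mul ?L a (unt ?L) = a"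
    by (auto simp: L alg md cl z z2)
  ultimately show ?thesis
    unfolding fd_algebra_def using fd by simp
qed

text \<open>\<open>tmod\<close>, \<open>tspc\<close>, \<open>tmap\<close> are the components \<open>N\<close>, \<open>W\<close>, \<open>\<eta>\<close>; as for modules, coordinate
  ambient types suffice.\<close>

record ('k, 'b, 'e) triple =
  tmod :: "('k, 'b) cmodule"
  tspc :: "('k, nat \<Rightarrow> 'k) space"
  tmap :: "(nat \<Rightarrow> 'k) \<Rightarrow> 'e \<Rightarrow> nat \<Rightarrow> 'k"

definition is_triple :: "('k::field, 'b::ab_group_add) algebra \<Rightarrow>
    ('k, 'b, 'e::ab_group_add) rmodule \<Rightarrow> ('k, 'b, 'e) triple \<Rightarrow> bool" where
  "is_triple B E T \<longleftrightarrow> fd_module B (tmod T) \<and> fd_space (tspc T) \<and>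
     tmap T \<in> lin (tspc T) (hom_space B E (tmod T))"

definition triple_hom :: "('k::field, 'b::ab_group_add) algebra \<Rightarrow>
    ('k, 'b, 'e::ab_group_add) triple \<Rightarrow> ('k, 'b, 'e) triple \<Rightarrow>
    (((nat \<Rightarrow> 'k) \<Rightarrow> nat \<Rightarrow> 'k) \<times> ((nat \<Rightarrow> 'k) \<Rightarrow> nat \<Rightarrow> 'k)) set" where
  "triple_hom B T T' = {(f, g). f \<in> hom B (tmod T) (tmod T') \<and> g \<in> lin (tspc T) (tspc T') \<and>
     (\<forall>w\<in>car (tspc T). f \<circ> tmap T w = tmap T' (g w))}"

definition triple_iso :: "('k::field, 'b::ab_group_add) algebra \<Rightarrow>
    ('k, 'b, 'e::ab_group_add) triple \<Rightarrow> ('k, 'b, 'e) triple \<Rightarrow> bool" where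
  "triple_iso B T T' \<longleftrightarrow> (\<exists>(f, g)\<in>triple_hom B T T'.
     bij_betw f (car (tmod T)) (car (tmod T')) \<and> bij_betw g (car (tspc T)) (car (tspc T')))"

definition triple_brick :: "('k::field, 'b::ab_group_add) algebra \<Rightarrow>
    ('k, 'b, 'e::ab_group_add) rmodule \<Rightarrow> ('k, 'b, 'e) triple \<Rightarrow> bool" where
  "triple_brick B E T \<longleftrightarrow> is_triple B E T \<and> (nonzero (tmod T) \<or> nonzero (tspc T)) \<and>
     triple_hom B T T = range (\<lambda>r. (homothety (tmod T) r, homothety (tspc T) r))"

definition mixed_brick :: "('k::field, 'b::ab_group_add) algebra \<Rightarrow>
    ('k, 'b, 'e::ab_group_add) rmodule \<Rightarrow> ('k, 'b, 'e) triple \<Rightarrow> bool" where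
  "mixed_brick B E T \<longleftrightarrow> triple_brick B E T \<and> nonzero (tmod T) \<and> nonzero (tspc T)"

definition visible_indec :: "('k::field, 'b::ab_group_add) algebra \<Rightarrow>
    ('k, 'b, 'e::ab_group_add) rmodule \<Rightarrow> ('k, 'b, 'v::ab_group_add) rmodule \<Rightarrow> bool" where
  "visible_indec B E X \<longleftrightarrow> indecomposable B X \<and> nonzero (hom_space B E X)"

definition visible_finite :: "('k::field, 'b::ab_group_add) algebra \<Rightarrow>
    ('k, 'b, 'e::ab_group_add) rmodule \<Rightarrow> bool" where
  "visible_finite B E \<longleftrightarrow> fin_many (\<lambda>X :: ('k, 'b) cmodule. visible_indec B E X) (iso B)"

definition visible_reps :: "('k::field, 'b::ab_group_add) algebra \<Rightarrow>
    ('k, 'b, 'e::ab_group_add) rmodule \<Rightarrow> ('k, 'b) cmodule list \<Rightarrow> bool" where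
  "visible_reps B E Xs \<longleftrightarrow> (\<forall>X\<in>set Xs. visible_indec B E X) \<and>
     (\<forall>i<length Xs. \<forall>j<length Xs. iso B (Xs ! i) (Xs ! j) \<longrightarrow> i = j) \<and>
     (\<forall>X :: ('k, 'b) cmodule. visible_indec B E X \<longrightarrow> (\<exists>i<length Xs. iso B X (Xs ! i)))"

text \<open>
  An element \<open>u\<close> of the external direct sum has the component \<open>u (i, j)\<close> in the \<open>j\<close>-th copy of
  \<open>Xs ! i\<close> (for \<open>i < length Xs\<close>, \<open>j < m ! i\<close>) and vanishes at all other indices. There the scalar
  multiplication is irrelevant; it is pointwise only to make the ambient type a vector space.
\<close>

definition nmod :: "('k::field, 'b) cmodule list \<Rightarrow> nat list \<Rightarrow>
    ('k, 'b, nat \<times> nat \<Rightarrow> nat \<Rightarrow> 'k) rmodule" where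
  "nmod Xs m = \<lparr>
     car = {u. \<forall>i j. if i < length Xs \<and> j < m ! i then u (i, j) \<in> car (Xs ! i) else u (i, j) = 0},
     smul = (\<lambda>r u (i, j). if i < length Xs then smul (Xs ! i) r (u (i, j))
                           else (\<lambda>n. r * u (i, j) n)),
     act = (\<lambda>u b (i, j). if i < length Xs \<and> j < m ! i then act (Xs ! i) (u (i, j)) b else 0)\<rparr>"

definition h_dim :: "('k::field, 'b::ab_group_add) algebra \<Rightarrow>
    ('k, 'b, 'e::ab_group_add) rmodule \<Rightarrow> ('k, 'b) cmodule list \<Rightarrow> nat list \<Rightarrow> nat" where
  "h_dim B E Xs m = vdim (hom_space B E (nmod Xs m))"

definition r_dim :: "('k::field, 'b::ab_group_add) algebra \<Rightarrow>
    ('k, 'b) cmodule list \<Rightarrow> nat list \<Rightarrow> nat" where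
  "r_dim B Xs m = vdim (hom_space B (nmod Xs m) (nmod Xs m))"

definition admissible :: "('k::field, 'b::ab_group_add) algebra \<Rightarrow>
    ('k, 'b, 'e::ab_group_add) rmodule \<Rightarrow> ('k, 'b) cmodule list \<Rightarrow> nat list \<times> nat \<Rightarrow> bool" where
  "admissible B E Xs = (\<lambda>(m, l). length m = length Xs \<and> (\<exists>i<length m. m ! i \<noteq> 0) \<and>
     1 \<le> l \<and> l \<le> h_dim B E Xs m \<and>
     int (r_dim B Xs m) - 1 \<le> int l * (int (h_dim B E Xs m) - int l))"

definition critical :: "('k::field, 'b::ab_group_add) algebra \<Rightarrow>
    ('k, 'b, 'e::ab_group_add) rmodule \<Rightarrow> ('k, 'b) cmodule list \<Rightarrow> nat list \<times> nat \<Rightarrow> bool" where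
  "critical B E Xs = (\<lambda>(m, l). admissible B E Xs (m, l) \<and>
     int (r_dim B Xs m) - 1 = int l * (int (h_dim B E Xs m) - int l))"

definition realized :: "('k::field, 'b::ab_group_add) algebra \<Rightarrow>
    ('k, 'b, 'e::ab_group_add) rmodule \<Rightarrow> ('k, 'b) cmodule list \<Rightarrow> nat list \<times> nat \<Rightarrow> bool" where
  "realized B E Xs = (\<lambda>(m, l). let N = nmod Xs m; H = hom_space B E N in
     \<exists>L. L \<subseteq> car H \<and> module.subspace (smul H) L \<and> vector_space.dim (smul H) L = l \<and>
       {f \<in> hom B N N. (\<lambda>\<phi>. f \<circ> \<phi>) ` L \<subseteq> L} = range (homothety N))"

end

theory Submission
  imports Defs
begin

text \<open>
  Fix a \<open>B\<close>-module \<open>N\<close> with \<open>h = dim Hom(E, N)\<close> and \<open>r = dim End N\<close>, and a space \<open>W\<close> of dimension \<open>l\<close>.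
  Triples on \<open>N\<close> and \<open>W\<close> are the points \<open>\<eta>\<close> of \<open>Q = lin W (Hom(E, N))\<close>, which has dimension \<open>l h\<close>;
  isomorphism classes are orbits of \<open>Aut N \<times> GL W\<close>, an open part of \<open>P = End N \<times> lin W W\<close>, which
  has dimension \<open>r + l\<^sup>2\<close>. The differential of the orbit map at a point \<open>\<eta>\<close> is
  \<open>D \<eta> \<eta> (f, g) = f \<eta> - \<eta> g\<close>, and its kernel is the endomorphism algebra of the triple. For a brick
  the kernel is the line of scalars, so \<open>r + l\<^sup>2 - 1 \<le> l h\<close>: bricks give admissible pairs.

  In the critical case \<open>r + l\<^sup>2 - 1 = l h\<close> the orbit of a brick is dense, so two bricks
  with the same \<open>N\<close> and \<open>l\<close> are isomorphic (\<open>critical_unique\<close>). In the non-critical case a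
  brick lies on a line that is transversal to the orbits of almost all of its points, so that
  infinitely many orbits of bricks meet the line (\<open>noncritical_infinite\<close>). Both arguments are usually phrased with dimensions of orbits in
  a Grassmannian. Here they are restricted to a line \<open>\<eta> + t \<zeta>\<close> in \<open>Q\<close>, where all conditions become
  singularity of a pencil of linear maps \<open>T\<^sub>0 + t T\<^sub>1\<close>. The one geometric input is
  \<open>singular_pencil_chain\<close>: a pencil that is singular for infinitely many \<open>t\<close> kills a polynomial
  vector with nonzero constant term. That the ground field is infinite
  supplies the points of the line.

  A mixed brick \<open>(N, W, \<eta>)\<close> has injective \<open>\<eta>\<close>, hence is determined by the subspace \<open>L = \<eta> W\<close>; and no
  nonzero endomorphism of \<open>N\<close> kills all maps from \<open>E\<close>, so all indecomposable summands of
  \<open>N\<close> are visible and \<open>N\<close> is some \<open>nmod Xs m\<close> (\<open>ex_nmod_iso\<close>). Thus mixed bricks are the same as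
  realized pairs \<open>(m, l)\<close> together with a subspace realizing them. If finitely many pairs
  are realized and all are critical, each contributes one mixed brick. Conversely, finitely many mixed
  bricks have bounded dimension, which bounds the multiplicities in \<open>m\<close>, and none of their pairs is
  non-critical.

  Finally, a module over the one-point extension is a triple (\<open>triple_of\<close>), and a brick triple is mixed,
  or a brick of \<open>B\<close>, or the one-dimensional space with \<open>N = 0\<close>. So the bricks of the extension
  are those of \<open>B\<close>, one more, and the mixed ones.
\<close>


section \<open>Linear algebra on carriers\<close>

lemma fd_vs: "fd_space V \<Longrightarrow> vector_space (smul V)"
  by (simp add: fd_space_def)

lemma fd_subspace:
  assumes "fd_space V"
  shows "module.subspace (smul V) (car V)"
proof -
  interpret V: vector_space "smul V" by (rule fd_vs[OF assms])
  obtain S where "V.span S = car V" using assms by (auto simp: fd_space_def)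
  then show ?thesis using V.subspace_span[of S] by simp
qed

lemma fd_car:
  assumes "fd_space V"
  shows "0 \<in> car V" "x \<in> car V \<Longrightarrow> y \<in> car V \<Longrightarrow> x + y \<in> car V" "x \<in> car V \<Longrightarrow> smul V r x \<in> car V"
    "x \<in> car V \<Longrightarrow> - x \<in> car V" "x \<in> car V \<Longrightarrow> y \<in> car V \<Longrightarrow> x - y \<in> car V"
    "(\<And>i. i \<in> I \<Longrightarrow> f i \<in> car V) \<Longrightarrow> (\<Sum>i\<in>I. f i) \<in> car V"
proof -
  interpret V: vector_space "smul V" by (rule fd_vs[OF assms])
  note s = fd_subspace[OF assms]
  show "0 \<in> car V" "x \<in> car V \<Longrightarrow> y \<in> car V \<Longrightarrow> x + y \<in> car V" "x \<in> car V \<Longrightarrow> smul V r x \<in> car V"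
    "x \<in> car V \<Longrightarrow> - x \<in> car V" "x \<in> car V \<Longrightarrow> y \<in> car V \<Longrightarrow> x - y \<in> car V"
    "(\<And>i. i \<in> I \<Longrightarrow> f i \<in> car V) \<Longrightarrow> (\<Sum>i\<in>I. f i) \<in> car V"
    by (simp_all add: V.subspace_0[OF s] V.subspace_add[OF s] V.subspace_scale[OF s]
      V.subspace_neg[OF s] V.subspace_diff[OF s] V.subspace_sum[OF s])
qed

lemma vs_smul:
  assumes "vector_space (smul V)"
  shows "smul V r (x + y) = smul V r x + smul V r y" "smul V (r + s) x = smul V r x + smul V s x"
    "smul V r (smul V s x) = smul V (r * s) x" "smul V 1 x = x" "smul V 0 x = 0" "smul V r 0 = 0"
    "smul V r (- x) = - smul V r x" "smul V (- r) x = - smul V r x"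
    "smul V r (x - y) = smul V r x - smul V r y" "smul V (r - s) x = smul V r x - smul V s x"
    "smul V r (\<Sum>i\<in>I. f i) = (\<Sum>i\<in>I. smul V r (f i))"
    "smul V (\<Sum>i\<in>I. g i) x = (\<Sum>i\<in>I. smul V (g i) x)"
    "smul V r x = 0 \<longleftrightarrow> r = 0 \<or> x = 0"
proof -
  interpret V: vector_space "smul V" by (rule assms)
  show "smul V r (x + y) = smul V r x + smul V r y" "smul V (r + s) x = smul V r x + smul V s x"
    "smul V r (smul V s x) = smul V (r * s) x" "smul V 1 x = x" "smul V 0 x = 0" "smul V r 0 = 0"
    "smul V r (- x) = - smul V r x" "smul V (- r) x = - smul V r x"
    "smul V r (x - y) = smul V r x - smul V r y" "smul V (r - s) x = smul V r x - smul V s x"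
    "smul V r (\<Sum>i\<in>I. f i) = (\<Sum>i\<in>I. smul V r (f i))"
    "smul V (\<Sum>i\<in>I. g i) x = (\<Sum>i\<in>I. smul V (g i) x)"
    "smul V r x = 0 \<longleftrightarrow> r = 0 \<or> x = 0"
    by (simp_all add: V.scale_right_distrib V.scale_left_distrib V.scale_right_diff_distrib
      V.scale_left_diff_distrib V.scale_sum_left V.scale_sum_right)
qed

lemmas fd_smul = vs_smul[OF fd_vs]

text \<open>Maps have to vanish off the carrier only where they are collected into a space of maps. For a
  single map given by a formula, linearity on the carrier is enough.\<close>

definition linear_on :: "('k::field, 'v::ab_group_add, 'y) space_scheme \<Rightarrow>
    ('k, 'w::ab_group_add, 'z) space_scheme \<Rightarrow> ('v \<Rightarrow> 'w) \<Rightarrow> bool" where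
  "linear_on V W f \<longleftrightarrow> (\<forall>x\<in>car V. f x \<in> car W) \<and>
     (\<forall>x\<in>car V. \<forall>y\<in>car V. f (x + y) = f x + f y) \<and>
     (\<forall>r. \<forall>x\<in>car V. f (smul V r x) = smul W r (f x))"

lemma lin_linear_on: "f \<in> lin V W \<Longrightarrow> linear_on V W f"
  by (simp add: lin_def linear_on_def)

lemma lin_iff: "f \<in> lin V W \<longleftrightarrow> linear_on V W f \<and> (\<forall>x. x \<notin> car V \<longrightarrow> f x = 0)"
  by (auto simp add: lin_def linear_on_def)

lemma linear_onD:
  assumes "linear_on V W f"
  shows "x \<in> car V \<Longrightarrow> f x \<in> car W" "x \<in> car V \<Longrightarrow> y \<in> car V \<Longrightarrow> f (x + y) = f x + f y"
    "x \<in> car V \<Longrightarrow> f (smul V r x) = smul W r (f x)"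
  using assms by (auto simp: linear_on_def)

lemma linear_on_0:
  assumes "linear_on V W f" "fd_space V"
  shows "f 0 = 0"
  using linear_onD(2)[OF assms(1) fd_car(1)[OF assms(2)] fd_car(1)[OF assms(2)]] by simp

lemma linear_on_diff:
  assumes "linear_on V W f" "fd_space V" "x \<in> car V" "y \<in> car V"
  shows "f (x - y) = f x - f y"
  using linear_onD(2)[OF assms(1) fd_car(5)[OF assms(2-4)] assms(4)] by simp

lemma linear_on_sum:
  assumes "linear_on V W f" "fd_space V" "\<And>i. i \<in> I \<Longrightarrow> g i \<in> car V"
  shows "f (\<Sum>i\<in>I. g i) = (\<Sum>i\<in>I. f (g i))"
  using assms(3)
  by (induction I rule: infinite_finite_induct)
    (simp_all add: linear_on_0[OF assms(1,2)] linear_onD(2)[OF assms(1)] fd_car(6)[OF assms(2)])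

lemma linear_on_comb:
  assumes "linear_on V W f" "fd_space V" "\<And>i. i \<in> I \<Longrightarrow> b i \<in> car V"
  shows "f (\<Sum>i\<in>I. smul V (c i) (b i)) = (\<Sum>i\<in>I. smul W (c i) (f (b i)))"
  using assms by (subst linear_on_sum[OF assms(1,2)]) (auto simp: fd_car linear_onD[OF assms(1)])

lemma inj_on_linear:
  assumes "linear_on V W f" "fd_space V" "\<And>x. x \<in> car V \<Longrightarrow> f x = 0 \<Longrightarrow> x = 0"
  shows "inj_on f (car V)"
proof (rule inj_onI)
  fix x y assume xy: "x \<in> car V" "y \<in> car V" "f x = f y"
  then have "f (x - y) = 0" using linear_on_diff[OF assms(1,2)] by simp
  then show "x = y" using assms(3)[OF fd_car(5)[OF assms(2) xy(1,2)]] by simp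
qed

text \<open>Bases are indexed families, so that bases of spaces of maps, products and direct sums are indexed
  by products and sums of index sets.\<close>

definition basis_fam :: "('k::field, 'v::ab_group_add, 'y) space_scheme \<Rightarrow> 'i set \<Rightarrow> ('i \<Rightarrow> 'v) \<Rightarrow> bool" where
  "basis_fam V I b \<longleftrightarrow> finite I \<and> (\<forall>i\<in>I. b i \<in> car V) \<and>
     (\<forall>x\<in>car V. \<exists>c. x = (\<Sum>i\<in>I. smul V (c i) (b i))) \<and>
     (\<forall>c. (\<Sum>i\<in>I. smul V (c i) (b i)) = 0 \<longrightarrow> (\<forall>i\<in>I. c i = 0))"

lemma basis_famD:
  assumes "basis_fam V I b"
  shows "finite I" "i \<in> I \<Longrightarrow> b i \<in> car V"
    "x \<in> car V \<Longrightarrow> \<exists>c. x = (\<Sum>i\<in>I. smul V (c i) (b i))"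
    "(\<Sum>i\<in>I. smul V (c i) (b i)) = 0 \<Longrightarrow> i \<in> I \<Longrightarrow> c i = 0"
  using assms by (auto simp: basis_fam_def)

lemma independent_image:
  assumes vs: "vector_space (smul V)" and fin: "finite I"
    and ind: "\<And>c i. (\<Sum>i\<in>I. smul V (c i) (b i)) = 0 \<Longrightarrow> i \<in> I \<Longrightarrow> c i = 0"
  shows "inj_on b I" "\<not> module.dependent (smul V) (b ` I)"
proof -
  interpret V: vector_space "smul V" by (rule vs)
  show inj: "inj_on b I"
  proof (rule inj_onI, rule ccontr)
    fix i j assume ij: "i \<in> I" "j \<in> I" "b i = b j" and ne: "i \<noteq> j"
    let ?c = "\<lambda>l. if l = i then 1 else if l = j then -1 else 0"
    have "(\<Sum>l\<in>I. smul V (?c l) (b l)) = (\<Sum>l\<in>I. (if l = i then b i else 0) - (if l = j then b i else 0))"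
      by (rule sum.cong) (use ne ij in auto)
    also have "\<dots> = 0" using fin ij by (simp add: sum_subtractf)
    finally show False using ind[of ?c i] ij by simp
  qed
  show "V.independent (b ` I)"
    unfolding V.dependent_finite[OF finite_imageI[OF fin]]
  proof clarify
    fix u i assume h: "i \<in> I" "u (b i) \<noteq> 0" "(\<Sum>v\<in>b ` I. smul V (u v) v) = 0"
    then have "(\<Sum>i\<in>I. smul V (u (b i)) (b i)) = 0" by (simp add: sum.reindex[OF inj])
    then show False using ind[of "u \<circ> b" i] h by auto
  qed
qed

lemma basis_fam_vdim:
  assumes vs: "vector_space (smul V)" and sub: "module.subspace (smul V) (car V)"
    and b: "basis_fam V I b"
  shows "fd_space V" "vdim V = card I"
proof -
  interpret V: vector_space "smul V" by (rule vs)
  note fin = basis_famD(1)[OF b]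
  have indep: "inj_on b I" "V.independent (b ` I)"
    by (rule independent_image[OF vs fin], erule (1) basis_famD(4)[OF b])+
  have span: "V.span (b ` I) = car V"
  proof
    show "V.span (b ` I) \<subseteq> car V" using basis_famD(2)[OF b] by (intro V.span_minimal[OF _ sub]) auto
    show "car V \<subseteq> V.span (b ` I)"
    proof
      fix x assume "x \<in> car V"
      then obtain c where "x = (\<Sum>i\<in>I. smul V (c i) (b i))" using basis_famD(3)[OF b] by blast
      then show "x \<in> V.span (b ` I)"
        by (simp only:) (intro V.span_sum V.span_scale V.span_base imageI)
    qed
  qed
  show "fd_space V" using span fin vs by (auto simp: fd_space_def)
  show "vdim V = card I"
    unfolding vdim_def using V.dim_eq_card[of "b ` I" "car V"] indep(2) span card_image[OF indep(1)]
    by (metis V.span_span)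
qed

lemma ex_basis_of_subspace:
  assumes V: "fd_space V" and U: "U \<subseteq> car V" "module.subspace (smul V) U"
  shows "\<exists>C. finite C \<and> module.span (smul V) C = U \<and> C \<subseteq> U \<and> \<not> module.dependent (smul V) C"
proof -
  interpret V: vector_space "smul V" by (rule fd_vs[OF V])
  obtain S where S: "finite S" "V.span S = car V" using V by (auto simp: fd_space_def)
  obtain C where C: "C \<subseteq> U" "V.independent C" "U \<subseteq> V.span C"
    using V.maximal_independent_subset by blast
  have "finite C" using V.independent_span_bound[OF S(1) C(2)] C(1) U(1) S(2) by auto
  then show ?thesis using C U V.span_minimal[OF C(1) U(2)] by blast
qed

lemma fd_sub:
  assumes "fd_space V" "U \<subseteq> car V" "module.subspace (smul V) U"
  shows "fd_space (V\<lparr>car := U\<rparr>)"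
  using ex_basis_of_subspace[OF assms] fd_vs[OF assms(1)] by (auto simp: fd_space_def)

lemma ex_basis_fam:
  assumes V: "fd_space V"
  shows "\<exists>b. basis_fam V {..<vdim V} b"
proof -
  interpret V: vector_space "smul V" by (rule fd_vs[OF V])
  obtain C where C: "finite C" "V.span C = car V" "V.independent C"
    using ex_basis_of_subspace[OF V order_refl fd_subspace[OF V]] by blast
  have card: "vdim V = card C"
    unfolding vdim_def using V.dim_eq_card[of C "car V"] C by (metis V.span_span)
  obtain e where e: "bij_betw e {..<card C} C"
    using C(1) ex_bij_betw_nat_finite atLeast0LessThan by metis
  have "basis_fam V {..<card C} e"
    unfolding basis_fam_def
  proof (intro conjI ballI allI impI)
    show "e i \<in> car V" if "i \<in> {..<card C}" for i
      using that e C(2) V.span_superset[of C] by (auto simp: bij_betw_def)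
    show "\<exists>c. x = (\<Sum>i<card C. smul V (c i) (e i))" if "x \<in> car V" for x
    proof -
      obtain u where "x = (\<Sum>v\<in>C. smul V (u v) v)"
        using \<open>x \<in> car V\<close> V.span_finite[OF C(1)] C(2) by auto
      then have "x = (\<Sum>i<card C. smul V ((u \<circ> e) i) (e i))"
        by (simp add: sum.reindex_bij_betw[OF e, of "\<lambda>v. smul V (u v) v"])
      then show ?thesis by blast
    qed
    fix c i assume h: "(\<Sum>i<card C. smul V (c i) (e i)) = 0" "i \<in> {..<card C}"
    define u where "u v = c (inv_into {..<card C} e v)" for v
    have ue: "u (e i) = c i" if "i < card C" for i
      using that e by (simp add: u_def bij_betw_def inv_into_f_f)
    have "(\<Sum>v\<in>C. smul V (u v) v) = (\<Sum>i<card C. smul V (u (e i)) (e i))"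
      by (simp add: sum.reindex_bij_betw[OF e, of "\<lambda>v. smul V (u v) v"])
    also have "\<dots> = 0" using h(1) ue by simp
    finally have "\<forall>v\<in>C. u v = 0" using C(1,3) V.dependent_finite[OF C(1)] by blast
    moreover have "e i \<in> C" using h(2) e by (auto simp: bij_betw_def)
    ultimately show "c i = 0" using ue[of i] h(2) by auto
  qed simp
  then show ?thesis by (auto simp: card)
qed

lemma dependent_family:
  assumes V: "fd_space V" and I: "finite I" "\<And>i. i \<in> I \<Longrightarrow> v i \<in> car V" and card: "card I > vdim V"
  shows "\<exists>c. (\<Sum>i\<in>I. smul V (c i) (v i)) = 0 \<and> (\<exists>i\<in>I. c i \<noteq> 0)"
proof (rule ccontr)
  assume neg: "\<not> ?thesis"
  interpret V: vector_space "smul V" by (rule fd_vs[OF V])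
  have "c i = 0" if "(\<Sum>i\<in>I. smul V (c i) (v i)) = 0" "i \<in> I" for c i using neg that by blast
  then have indep: "inj_on v I" "V.independent (v ` I)"
    using independent_image[of V I v] V.vector_space_axioms I(1) by blast+
  obtain D where D: "finite D" "V.span D = car V" "V.independent D"
    using ex_basis_of_subspace[OF V order_refl fd_subspace[OF V]] by blast
  have "vdim V = card D"
    unfolding vdim_def using V.dim_eq_card[of D "car V"] D by (metis V.span_span)
  moreover have "card (v ` I) \<le> card D"
    using V.independent_span_bound[OF D(1) indep(2)] I(2) D(2) by auto
  ultimately show False using card card_image[OF indep(1)] by simp
qed

lemma linear_kernel_nonzero:
  assumes V: "fd_space V" and W: "fd_space W" and f: "linear_on V W f" and d: "vdim V > vdim W"
  shows "\<exists>x\<in>car V. x \<noteq> 0 \<and> f x = 0"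
proof -
  obtain b where b: "basis_fam V {..<vdim V} b" using ex_basis_fam[OF V] by blast
  then have bc: "b i \<in> car V" if "i < vdim V" for i using that by (simp add: basis_fam_def)
  obtain c where c: "(\<Sum>i<vdim V. smul W (c i) (f (b i))) = 0" "\<exists>i<vdim V. c i \<noteq> 0"
    using dependent_family[OF W, of "{..<vdim V}" "\<lambda>i. f (b i)"] d bc linear_onD(1)[OF f]
    by fastforce
  let ?x = "\<Sum>i<vdim V. smul V (c i) (b i)"
  have "?x \<in> car V" using bc by (intro fd_car[OF V]) auto
  moreover have "f ?x = 0" using c(1) bc by (subst linear_on_comb[OF f V]) auto
  moreover have "?x \<noteq> 0" using b c(2) by (auto simp: basis_fam_def)
  ultimately show ?thesis by blast
qed

lemma vdim_le_of_inj:
  assumes "fd_space V" "fd_space W" "linear_on V W f" "\<And>x. x \<in> car V \<Longrightarrow> f x = 0 \<Longrightarrow> x = 0"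
  shows "vdim V \<le> vdim W"
  using linear_kernel_nonzero[OF assms(1-3)] assms(4) by (meson linorder_not_le)

lemma linear_inj_surj:
  assumes V: "fd_space V" and W: "fd_space W" and f: "linear_on V W f"
    and inj: "\<And>x. x \<in> car V \<Longrightarrow> f x = 0 \<Longrightarrow> x = 0" and d: "vdim W \<le> vdim V"
  shows "f ` car V = car W"
proof
  show "f ` car V \<subseteq> car W" using linear_onD(1)[OF f] by auto
  show "car W \<subseteq> f ` car V"
  proof
    fix y assume y: "y \<in> car W"
    obtain b where b: "basis_fam V {..<vdim V} b" using ex_basis_fam[OF V] by blast
    then have bc: "b i \<in> car V" if "i < vdim V" for i using that by (simp add: basis_fam_def)
    let ?n = "vdim V"
    let ?v = "\<lambda>i. if i < ?n then f (b i) else y"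
    obtain c where c: "(\<Sum>i<Suc ?n. smul W (c i) (?v i)) = 0" "\<exists>i<Suc ?n. c i \<noteq> 0"
      using dependent_family[OF W, of "{..<Suc ?n}" ?v] d bc linear_onD(1)[OF f] y by fastforce
    let ?x = "\<Sum>i<?n. smul V (c i) (b i)"
    have xc: "?x \<in> car V" using bc by (intro fd_car[OF V]) auto
    have fx: "f ?x = (\<Sum>i<?n. smul W (c i) (f (b i)))" using bc by (subst linear_on_comb[OF f V]) auto
    then have eq: "f ?x + smul W (c ?n) y = 0" using c(1) by simp
    have cn: "c ?n \<noteq> 0"
    proof
      assume 0: "c ?n = 0"
      then have "f ?x = 0" using eq by (simp add: fd_smul[OF W])
      then have "?x = 0" using inj xc by blast
      then have "\<forall>i<?n. c i = 0" using b by (auto simp: basis_fam_def)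
      then show False using c(2) 0 less_Suc_eq by auto
    qed
    have "f (smul V (- inverse (c ?n)) ?x) = smul W (- inverse (c ?n)) (f ?x)"
      by (rule linear_onD(3)[OF f xc])
    also have "f ?x = - smul W (c ?n) y" using eq by (simp add: eq_neg_iff_add_eq_0)
    also have "smul W (- inverse (c ?n)) (- smul W (c ?n) y) = y"
      using cn by (simp add: fd_smul[OF W])
    finally show "y \<in> f ` car V" by (rule image_eqI[OF sym fd_car(3)[OF V xc]])
  qed
qed

lemma vdim_bij:
  assumes V: "fd_space V" and W: "fd_space W" and f: "linear_on V W f" "bij_betw f (car V) (car W)"
  shows "vdim V = vdim W"
proof -
  obtain b where b: "basis_fam V {..<vdim V} b" using ex_basis_fam[OF V] by blast
  then have bc: "b i \<in> car V" if "i < vdim V" for i using that by (simp add: basis_fam_def)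
  have comb: "f (\<Sum>i<vdim V. smul V (c i) (b i)) = (\<Sum>i<vdim V. smul W (c i) (f (b i)))" for c
    using bc by (subst linear_on_comb[OF f(1) V]) auto
  have cc: "(\<Sum>i<vdim V. smul V (c i) (b i)) \<in> car V" for c using bc by (intro fd_car[OF V]) auto
  have "basis_fam W {..<vdim V} (\<lambda>i. f (b i))"
    unfolding basis_fam_def
  proof (intro conjI ballI allI impI)
    show "\<exists>c. y = (\<Sum>i<vdim V. smul W (c i) (f (b i)))" if y: "y \<in> car W" for y
    proof -
      obtain x where x: "x \<in> car V" "y = f x" using y f(2) by (auto simp: bij_betw_def)
      then obtain c where "x = (\<Sum>i<vdim V. smul V (c i) (b i))" using b by (auto simp: basis_fam_def)
      then show ?thesis using x comb by metis
    qed
    fix c i assume h: "(\<Sum>i<vdim V. smul W (c i) (f (b i))) = 0" "i \<in> {..<vdim V}"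
    then have "f (\<Sum>i<vdim V. smul V (c i) (b i)) = f 0"
      by (simp add: comb linear_on_0[OF f(1) V])
    then have "(\<Sum>i<vdim V. smul V (c i) (b i)) = 0"
      using f(2) cc fd_car(1)[OF V] by (auto simp: bij_betw_def inj_on_eq_iff)
    then show "c i = 0" using b h(2) by (auto simp: basis_fam_def)
  qed (use bc linear_onD(1)[OF f(1)] in auto)
  then show ?thesis using basis_fam_vdim(2)[OF fd_vs[OF W] fd_subspace[OF W]] by fastforce
qed

definition coordinates where
  "coordinates V I b \<kappa> \<longleftrightarrow> (\<forall>i. \<forall>x\<in>car V. \<forall>y\<in>car V. \<kappa> i (x + y) = \<kappa> i x + \<kappa> i y) \<and>
     (\<forall>i r. \<forall>x\<in>car V. \<kappa> i (smul V r x) = r * \<kappa> i x) \<and> (\<forall>i x. x \<notin> car V \<longrightarrow> \<kappa> i x = 0) \<and>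
     (\<forall>x\<in>car V. (\<Sum>i\<in>I. smul V (\<kappa> i x) (b i)) = x) \<and>
     (\<forall>c. \<forall>i\<in>I. \<kappa> i (\<Sum>i\<in>I. smul V (c i) (b i)) = c i)"

lemma coordinatesD:
  assumes "coordinates V I b \<kappa>"
  shows "x \<in> car V \<Longrightarrow> y \<in> car V \<Longrightarrow> \<kappa> i (x + y) = \<kappa> i x + \<kappa> i y"
    "x \<in> car V \<Longrightarrow> \<kappa> i (smul V r x) = r * \<kappa> i x" "x \<notin> car V \<Longrightarrow> \<kappa> i x = 0"
    "x \<in> car V \<Longrightarrow> (\<Sum>i\<in>I. smul V (\<kappa> i x) (b i)) = x"
    "i \<in> I \<Longrightarrow> \<kappa> i (\<Sum>i\<in>I. smul V (c i) (b i)) = c i"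
  using assms by (simp_all add: coordinates_def)

lemma ex_coordinates:
  assumes V: "fd_space V" and b: "basis_fam V I b"
  obtains \<kappa> where "coordinates V I b \<kappa>"
proof -
  define \<kappa> where "\<kappa> i x = (if x \<in> car V \<and> i \<in> I then (SOME c. x = (\<Sum>i\<in>I. smul V (c i) (b i))) i else 0)"
    for i x
  have rep: "(\<Sum>i\<in>I. smul V (\<kappa> i x) (b i)) = x" if "x \<in> car V" for x
  proof -
    have "(\<Sum>i\<in>I. smul V (\<kappa> i x) (b i))
        = (\<Sum>i\<in>I. smul V ((SOME c. x = (\<Sum>i\<in>I. smul V (c i) (b i))) i) (b i))"
      using that by (intro sum.cong) (simp_all only: \<kappa>_def simp_thms if_True)
    also have "\<dots> = x" by (rule someI_ex[OF basis_famD(3)[OF b that], symmetric])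
    finally show ?thesis .
  qed
  have uniq: "\<kappa> i (\<Sum>i\<in>I. smul V (c i) (b i)) = c i" if i: "i \<in> I" for c i
  proof -
    let ?x = "\<Sum>i\<in>I. smul V (c i) (b i)"
    have "?x \<in> car V" using basis_famD(2)[OF b] by (intro fd_car[OF V]) auto
    then have "(\<Sum>i\<in>I. smul V (\<kappa> i ?x) (b i)) = ?x" by (rule rep)
    then have "(\<Sum>i\<in>I. smul V (\<kappa> i ?x - c i) (b i)) = 0"
      by (simp only: fd_smul(10)[OF V] sum_subtractf) simp
    from basis_famD(4)[OF b this i] show ?thesis by simp
  qed
  have off: "\<kappa> i x = 0" if "x \<notin> car V \<or> i \<notin> I" for i x using that by (auto simp: \<kappa>_def)
  have add: "\<kappa> i (x + y) = \<kappa> i x + \<kappa> i y" if "x \<in> car V" "y \<in> car V" for i x y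
  proof (cases "i \<in> I")
    case True
    have "x + y = (\<Sum>i\<in>I. smul V (\<kappa> i x + \<kappa> i y) (b i))"
      by (simp only: fd_smul(2)[OF V] sum.distrib rep[OF that(1)] rep[OF that(2)])
    then show ?thesis using uniq[OF True, of "\<lambda>i. \<kappa> i x + \<kappa> i y"] by simp
  qed (simp add: off)
  have scale: "\<kappa> i (smul V r x) = r * \<kappa> i x" if "x \<in> car V" for i r x
  proof (cases "i \<in> I")
    case True
    have "(\<Sum>i\<in>I. smul V (r * \<kappa> i x) (b i)) = smul V r (\<Sum>i\<in>I. smul V (\<kappa> i x) (b i))"
      by (simp add: fd_smul[OF V])
    then show ?thesis using uniq[OF True, of "\<lambda>i. r * \<kappa> i x"] rep[OF that] by simp
  qed (simp add: off)
  have "coordinates V I b \<kappa>"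
    unfolding coordinates_def
    by (intro conjI allI ballI impI add scale rep uniq off disjI1)
  then show thesis by (rule that)
qed

lemma ex_functional_nonzero:
  assumes V: "fd_space V" and v: "v \<in> car V" "v \<noteq> 0"
  obtains \<kappa> where "\<And>x y. x \<in> car V \<Longrightarrow> y \<in> car V \<Longrightarrow> \<kappa> (x + y) = \<kappa> x + \<kappa> y"
    "\<And>r x. x \<in> car V \<Longrightarrow> \<kappa> (smul V r x) = r * \<kappa> x" "\<kappa> v \<noteq> (0::'k::field)"
proof -
  obtain b where b: "basis_fam V {..<vdim V} b" using ex_basis_fam[OF V] by blast
  obtain \<kappa> where "coordinates V {..<vdim V} b \<kappa>" by (rule ex_coordinates[OF V b])
  note \<kappa> = coordinatesD[OF this]
  have "\<exists>i. \<kappa> i v \<noteq> 0"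
  proof (rule ccontr)
    assume "\<not> ?thesis"
    then have "(\<Sum>i<vdim V. smul V (\<kappa> i v) (b i)) = 0" by (simp add: fd_smul[OF V])
    then show False using \<kappa>(4)[OF v(1)] v(2) by simp
  qed
  then obtain i where "\<kappa> i v \<noteq> 0" by blast
  with \<kappa>(1,2) show thesis by (rule that[of "\<kappa> i"])
qed

text \<open>Test endomorphisms: where all endomorphisms are scalars, one of rank one leaves no room for
  vectors outside the line of \<open>v\<close>.\<close>

lemma ex_rank_one_map:
  assumes V: "fd_space V" and v: "v \<in> car V" "v \<noteq> 0"
  obtains g \<kappa> where "g \<in> lin V V" "\<And>x. x \<in> car V \<Longrightarrow> g x = smul V (\<kappa> x) v" "\<kappa> v \<noteq> 0"
proof -
  obtain \<kappa> where \<kappa>: "\<And>x y. x \<in> car V \<Longrightarrow> y \<in> car V \<Longrightarrow> \<kappa> (x + y) = \<kappa> x + \<kappa> y"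
    "\<And>r x. x \<in> car V \<Longrightarrow> \<kappa> (smul V r x) = r * \<kappa> x" "\<kappa> v \<noteq> 0"
    by (rule ex_functional_nonzero[OF V v]) (rule that)
  define g where "g x = (if x \<in> car V then smul V (\<kappa> x) v else 0)" for x
  have "g \<in> lin V V" using v(1) by (auto simp: g_def lin_def fd_car[OF V] fd_smul[OF V] \<kappa>)
  then show thesis by (rule that[of g \<kappa>]) (simp_all add: g_def \<kappa>(3))
qed

text \<open>On the complement \<open>H\<close> of the line of \<open>v\<close>, a map whose kernel is that line becomes injective; this
  turns conditions on kernels into injectivity, which along a line survives at almost all points.\<close>

lemma ex_hyperplane_complement:
  assumes V: "fd_space V" and v: "v \<in> car V" "v \<noteq> 0"
  shows "\<exists>H. H \<subseteq> car V \<and> fd_space (V\<lparr>car := H\<rparr>) \<and> Suc (vdim (V\<lparr>car := H\<rparr>)) = vdim V \<and>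
    (\<forall>a. smul V a v \<in> H \<longrightarrow> a = 0) \<and> (\<forall>x\<in>car V. \<exists>a. x - smul V a v \<in> H)"
proof -
  interpret V: vector_space "smul V" by (rule fd_vs[OF V])
  \<comment> \<open>\<open>H\<close> is spanned by the other members of a basis through \<open>v\<close>.\<close>
  have "V.independent {v}" using v(2) by simp
  then obtain C where C: "{v} \<subseteq> C" "C \<subseteq> car V" "V.independent C" "car V \<subseteq> V.span C"
    using V.maximal_independent_subset_extend[of "{v}" "car V"] v(1) by blast
  obtain S where S: "finite S" "V.span S = car V" using V by (auto simp: fd_space_def)
  have fin: "finite C" using V.independent_span_bound[OF S(1) C(3)] C(2) S(2) by auto
  have span: "V.span C = car V" using V.span_minimal[OF C(2) fd_subspace[OF V]] C(4) by blast
  have C': "C = insert v (C - {v})" using C(1) by blast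
  have indep: "V.independent (C - {v})" using V.independent_mono[OF C(3)] by blast
  let ?H = "V.span (C - {v})"
  have dH: "vdim (V\<lparr>car := ?H\<rparr>) = card (C - {v})"
    using V.dim_eq_card_independent[OF indep] by (simp add: vdim_def)
  have dV: "vdim V = card C"
    unfolding vdim_def using V.dim_eq_card[OF _ C(3), of "car V"] span by (metis V.span_span)
  have vH: "v \<notin> ?H" using C(1,3) by (auto simp: V.dependent_def)
  show ?thesis
  proof (intro exI[of _ ?H] conjI allI impI ballI)
    show "?H \<subseteq> car V" using V.span_mono[of "C - {v}" C] span by blast
    show "fd_space (V\<lparr>car := ?H\<rparr>)" using fin V.vector_space_axioms by (auto simp: fd_space_def)
    show "Suc (vdim (V\<lparr>car := ?H\<rparr>)) = vdim V"
      unfolding dH dV using card_Suc_Diff1[OF fin, of v] C(1) by simp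
    show "\<exists>a. x - smul V a v \<in> ?H" if "x \<in> car V" for x
    proof -
      have "x \<in> V.span (insert v (C - {v}))" using that by (simp only: C'[symmetric] span)
      then show ?thesis by (simp only: V.span_breakdown_eq)
    qed
    show "a = 0" if "smul V a v \<in> ?H" for a
    proof (rule ccontr)
      assume "a \<noteq> 0"
      then have "v = smul V (inverse a) (smul V a v)" by (simp add: fd_smul[OF V])
      then show False using V.span_scale[OF that, of "inverse a"] vH by simp
    qed
  qed
qed

section \<open>Spaces of maps and products\<close>

definition lin_space :: "('k::field, 'v::ab_group_add, 'y) space_scheme \<Rightarrow>
    ('k, 'w::ab_group_add, 'z) space_scheme \<Rightarrow> ('k, 'v \<Rightarrow> 'w) space" where
  "lin_space V W = \<lparr>car = lin V W, smul = (\<lambda>r f x. smul W r (f x))\<rparr>"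

definition prod_space :: "('k::field, 'v::ab_group_add, 'y) space_scheme \<Rightarrow>
    ('k, 'w::ab_group_add, 'z) space_scheme \<Rightarrow> ('k, 'v \<times> 'w) space" where
  "prod_space V W = \<lparr>car = car V \<times> car W, smul = (\<lambda>r (x, y). (smul V r x, smul W r y))\<rparr>"

lemma sum_fun_apply: "(\<Sum>i\<in>I. f i) x = (\<Sum>i\<in>I. f i x)"
  for f :: "'i \<Rightarrow> 'v \<Rightarrow> 'w::ab_group_add"
  by (induction I rule: infinite_finite_induct) auto

lemma vector_space_fun: "vector_space (smul W) \<Longrightarrow> vector_space (\<lambda>r f x. smul W r (f x))"
  by unfold_locales (auto simp: fun_eq_iff vs_smul)

lemma vector_space_lin_space: "fd_space W \<Longrightarrow> vector_space (smul (lin_space V W))"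
  by (simp add: lin_space_def vector_space_fun fd_vs)

lemma subspace_lin:
  assumes W: "fd_space W"
  shows "module.subspace (smul (lin_space V W)) (lin V W)"
proof -
  interpret L: vector_space "smul (lin_space V W)" by (rule vector_space_lin_space[OF W])
  show ?thesis
    unfolding L.subspace_def
    by (auto simp: lin_space_def lin_def fd_car[OF W] fd_smul[OF W] algebra_simps)
qed

lemma fd_lin_space:
  fixes V :: "('k::field, 'v::ab_group_add, 'y) space_scheme"
    and W :: "('k, 'w::ab_group_add, 'z) space_scheme"
  assumes V: "fd_space V" and W: "fd_space W"
  shows "fd_space (lin_space V W)" "vdim (lin_space V W) = vdim V * vdim W"
proof -
  obtain b where b: "basis_fam V {..<vdim V} b" using ex_basis_fam[OF V] by blast
  obtain c where c: "basis_fam W {..<vdim W} c" using ex_basis_fam[OF W] by blast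
  let ?I = "{..<vdim V}" and ?J = "{..<vdim W}"
  obtain \<kappa> where "coordinates V ?I b \<kappa>" by (rule ex_coordinates[OF V b])
  note \<kappa> = coordinatesD[OF this]
  have \<kappa>b: "\<kappa> i (b j) = (if i = j then 1 else 0)" if "i \<in> ?I" "j \<in> ?I" for i j
  proof -
    have "b j = (\<Sum>i\<in>?I. smul V (if i = j then 1 else 0) (b i))"
      using that by (simp add: if_distrib[of "\<lambda>r. smul V r _"] fd_smul[OF V] cong: if_cong)
    then show ?thesis using \<kappa>(5)[OF that(1), of "\<lambda>i. if i = j then 1 else 0"] by simp
  qed
  define E where "E = (\<lambda>(i, j) x. smul W (\<kappa> i x) (c j))"
  have Ec: "E p \<in> lin V W" if "p \<in> ?I \<times> ?J" for p
    using that basis_famD(2)[OF c]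
    by (auto simp: E_def lin_def \<kappa>(1-3) fd_car[OF W] fd_smul[OF W])
  have ap: "(\<Sum>p\<in>?I \<times> ?J. smul (lin_space V W) (a p) (E p)) x
      = (\<Sum>i\<in>?I. smul W (\<kappa> i x) (\<Sum>j\<in>?J. smul W (a (i, j)) (c j)))" for a x
    by (simp add: sum_fun_apply lin_space_def E_def sum.cartesian_product
        fd_smul[OF W] mult.commute split_def)
  have "basis_fam (lin_space V W) (?I \<times> ?J) E"
    unfolding basis_fam_def
  proof (intro conjI ballI allI impI)
    show "\<exists>a. f = (\<Sum>p\<in>?I \<times> ?J. smul (lin_space V W) (a p) (E p))" if "f \<in> car (lin_space V W)" for f
    proof -
      have f: "f \<in> lin V W" using that by (simp add: lin_space_def)
      have "\<exists>a. f (b i) = (\<Sum>j\<in>?J. smul W (a j) (c j))" if "i \<in> ?I" for i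
        using f basis_famD(2)[OF b that] by (intro basis_famD(3)[OF c]) (simp add: lin_def)
      then obtain a where a: "\<And>i. i \<in> ?I \<Longrightarrow> f (b i) = (\<Sum>j\<in>?J. smul W (a i j) (c j))" by metis
      have "f x = (\<Sum>p\<in>?I \<times> ?J. smul (lin_space V W) ((\<lambda>(i, j). a i j) p) (E p)) x" for x
      proof (cases "x \<in> car V")
        case True
        have "f x = f (\<Sum>i\<in>?I. smul V (\<kappa> i x) (b i))" by (simp only: \<kappa>(4)[OF True])
        also have "\<dots> = (\<Sum>i\<in>?I. smul W (\<kappa> i x) (f (b i)))"
          using basis_famD(2)[OF b] by (intro linear_on_comb[OF lin_linear_on[OF f] V])
        also have "\<dots> = (\<Sum>i\<in>?I. smul W (\<kappa> i x) (\<Sum>j\<in>?J. smul W (a i j) (c j)))"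
          using a by (intro sum.cong) auto
        finally show ?thesis by (simp add: ap)
      next
        case False
        then show ?thesis using f by (simp add: ap \<kappa>(3) fd_smul[OF W] lin_def)
      qed
      then show ?thesis by (intro exI[of _ "\<lambda>(i, j). a i j"] ext)
    qed
    fix a p assume h: "(\<Sum>p\<in>?I \<times> ?J. smul (lin_space V W) (a p) (E p)) = 0" "p \<in> ?I \<times> ?J"
    then obtain i j where p: "p = (i, j)" "i \<in> ?I" "j \<in> ?J" by auto
    have "0 = (\<Sum>l\<in>?I. smul W (\<kappa> l (b i)) (\<Sum>j\<in>?J. smul W (a (l, j)) (c j)))"
      using ap[of a "b i"] h(1) by simp
    also have "\<dots> = (\<Sum>l\<in>?I. if l = i then (\<Sum>j\<in>?J. smul W (a (l, j)) (c j)) else 0)"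
      using p by (intro sum.cong) (auto simp: \<kappa>b fd_smul[OF W])
    also have "\<dots> = (\<Sum>j\<in>?J. smul W (a (i, j)) (c j))" using p by simp
    finally have "(\<Sum>j\<in>?J. smul W (a (i, j)) (c j)) = 0" by (rule sym)
    then show "a p = 0" using basis_famD(4)[OF c, of "\<lambda>j. a (i, j)" j] p by simp
  qed (use Ec in \<open>auto simp: lin_space_def\<close>)
  from basis_fam_vdim[OF vector_space_lin_space[OF W] _ this] subspace_lin[OF W, of V]
  show "fd_space (lin_space V W)" "vdim (lin_space V W) = vdim V * vdim W"
    by (auto simp: lin_space_def)
qed

lemma vector_space_prod_space:
  assumes V: "fd_space V" and W: "fd_space W"
  shows "vector_space (smul (prod_space V W))"
  by unfold_locales (auto simp: prod_space_def fd_smul[OF V] fd_smul[OF W])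

lemma fd_prod_space:
  assumes V: "fd_space V" and W: "fd_space W"
  shows "fd_space (prod_space V W)" "vdim (prod_space V W) = vdim V + vdim W"
proof -
  obtain b where b: "basis_fam V {..<vdim V} b" using ex_basis_fam[OF V] by blast
  obtain c where c: "basis_fam W {..<vdim W} c" using ex_basis_fam[OF W] by blast
  let ?I = "{..<vdim V}" and ?J = "{..<vdim W}" and ?P = "prod_space V W"
  define e where "e = case_sum (\<lambda>i. (b i, 0)) (\<lambda>j. (0, c j))"
  have fst_sum: "fst (\<Sum>i\<in>I. f i) = (\<Sum>i\<in>I. fst (f i))" "snd (\<Sum>i\<in>I. f i) = (\<Sum>i\<in>I. snd (f i))"
    for I :: "nat set" and f :: "nat \<Rightarrow> _ \<times> _"
    by (induction I rule: infinite_finite_induct) auto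
  have comb: "(\<Sum>p\<in>?I <+> ?J. smul ?P (a p) (e p))
      = ((\<Sum>i\<in>?I. smul V (a (Inl i)) (b i)), (\<Sum>j\<in>?J. smul W (a (Inr j)) (c j)))" for a
    by (simp add: sum.Plus prod_eq_iff fst_sum e_def prod_space_def fd_smul[OF V] fd_smul[OF W])
  have "basis_fam ?P (?I <+> ?J) e"
    unfolding basis_fam_def
  proof (intro conjI ballI allI impI)
    show "\<exists>a. x = (\<Sum>p\<in>?I <+> ?J. smul ?P (a p) (e p))" if "x \<in> car ?P" for x
    proof -
      obtain a a' where "fst x = (\<Sum>i\<in>?I. smul V (a i) (b i))" "snd x = (\<Sum>j\<in>?J. smul W (a' j) (c j))"
        using \<open>x \<in> car ?P\<close> basis_famD(3)[OF b, of "fst x"] basis_famD(3)[OF c, of "snd x"]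
        by (auto simp: prod_space_def)
      then show ?thesis by (intro exI[of _ "case_sum a a'"]) (simp add: comb prod_eq_iff)
    qed
    fix a p assume h: "(\<Sum>p\<in>?I <+> ?J. smul ?P (a p) (e p)) = 0" "p \<in> ?I <+> ?J"
    then show "a p = 0"
      using basis_famD(4)[OF b, of "\<lambda>i. a (Inl i)"] basis_famD(4)[OF c, of "\<lambda>j. a (Inr j)"]
      by (auto simp: comb zero_prod_def)
  qed (use basis_famD(2)[OF b] basis_famD(2)[OF c] in
      \<open>auto simp: e_def prod_space_def fd_car[OF V] fd_car[OF W]\<close>)
  note bf = this
  interpret P: vector_space "smul ?P" by (rule vector_space_prod_space[OF V W])
  have sub: "P.subspace (car ?P)"
    unfolding P.subspace_def
    by (auto simp: prod_space_def fd_car[OF V] fd_car[OF W] zero_prod_def)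
  show "fd_space ?P" "vdim ?P = vdim V + vdim W"
    using basis_fam_vdim[OF P.vector_space_axioms sub bf] by (simp_all add: card_Plus)
qed

section \<open>Pencils of linear maps\<close>

text \<open>
  A pencil \<open>T\<^sub>0 + t T\<^sub>1\<close> that is singular for infinitely many values of \<open>t\<close> is singular
  for a formal reason: it annihilates a polynomial vector \<open>x\<^sub>0 + t x\<^sub>1 + \<dots>\<close>, which is a chain as in
  Kronecker's theory of minimal indices. To see this, take more than \<open>vdim W\<close> values \<open>t\<^sub>j\<close> with
  kernel vectors \<open>v\<^sub>j\<close>, a relation \<open>\<Sum> c\<^sub>j T\<^sub>1 v\<^sub>j = 0\<close>, and interpolate: the pencil sends
  \<open>\<Sum> c\<^sub>j v\<^sub>j \<Prod>\<^sub>i\<^sub>\<noteq>\<^sub>j (t - t\<^sub>i)\<close> to \<open>\<Prod>\<^sub>i (t - t\<^sub>i)\<close> times this relation. Dividing by a power of \<open>t\<close>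
  makes the constant term nonzero.
\<close>

lemma singular_pencil_chain:
  fixes V :: "('k::field, 'v::ab_group_add, 'y) space_scheme"
    and W :: "('k, 'w::ab_group_add, 'z) space_scheme"
  assumes V: "fd_space V" and W: "fd_space W" and T0: "linear_on V W T0" and T1: "linear_on V W T1"
    and inf: "infinite {t. \<exists>v\<in>car V. v \<noteq> 0 \<and> T0 v + smul W t (T1 v) = 0}"
  obtains x d where "\<And>i. x i \<in> car V" "\<And>i. i > d \<Longrightarrow> x i = 0" "x 0 \<noteq> 0" "T0 (x 0) = 0"
    "\<And>i. T0 (x (Suc i)) + T1 (x i) = 0"
proof -
  obtain J where J: "finite J" "card J = Suc (vdim W)"
    "J \<subseteq> {t. \<exists>v\<in>car V. v \<noteq> 0 \<and> T0 v + smul W t (T1 v) = 0}"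
    using infinite_arbitrarily_large[OF inf] by blast
  then have "\<forall>t\<in>J. \<exists>v. v \<in> car V \<and> v \<noteq> 0 \<and> T0 v + smul W t (T1 v) = 0" by blast
  then obtain v where v: "\<And>t. t \<in> J \<Longrightarrow> v t \<in> car V" "\<And>t. t \<in> J \<Longrightarrow> v t \<noteq> 0"
    "\<And>t. t \<in> J \<Longrightarrow> T0 (v t) + smul W t (T1 (v t)) = 0" by metis
  obtain c s where c: "(\<Sum>t\<in>J. smul W (c t) (T1 (v t))) = 0" and s: "s \<in> J" "c s \<noteq> 0"
    using dependent_family[OF W J(1), of "\<lambda>t. T1 (v t)"] J(2) linear_onD(1)[OF T1] v(1) by force
  define p where "p = (\<Prod>r\<in>J. [:- r, 1:])"
  define q where "q t = smult (c t) (\<Prod>r\<in>J - {t}. [:- r, 1:])" for t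
  have pq: "[:- t, 1:] * q t = smult (c t) p" if "t \<in> J" for t
    using J(1) that by (simp add: p_def q_def prod.remove)
  have coeff_pq: "coeff (q t) i - t * coeff (q t) (Suc i) = c t * coeff p (Suc i)"
    "- (t * coeff (q t) 0) = c t * coeff p 0" if "t \<in> J" for t i
  proof -
    have "coeff ([:- t, 1:] * q t) k = c t * coeff p k" for k
      by (simp only: pq[OF that] coeff_smult)
    from this[of "Suc i"] this[of 0]
    show "coeff (q t) i - t * coeff (q t) (Suc i) = c t * coeff p (Suc i)"
      "- (t * coeff (q t) 0) = c t * coeff p 0" by simp_all
  qed
  define y where "y i = (\<Sum>t\<in>J. smul V (coeff (q t) i) (v t))" for i
  define d where "d = (\<Sum>t\<in>J. degree (q t))"
  have yc: "y i \<in> car V" for i using v(1) by (auto simp: y_def intro!: fd_car[OF V])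
  have y0: "y i = 0" if "i > d" for i
  proof -
    have "coeff (q t) i = 0" if "t \<in> J" for t
    proof -
      have "degree (q t) \<le> d" unfolding d_def using that J(1) by (intro member_le_sum) auto
      then show ?thesis using \<open>i > d\<close> by (intro coeff_eq_0) simp
    qed
    then show ?thesis by (simp add: y_def fd_smul[OF V])
  qed
  have T0v: "T0 (v t) = - smul W t (T1 (v t))" if "t \<in> J" for t
    using v(3)[OF that] by (simp add: eq_neg_iff_add_eq_0)
  have T1y: "T1 (y i) = (\<Sum>t\<in>J. smul W (coeff (q t) i) (T1 (v t)))" for i
    unfolding y_def by (rule linear_on_comb[OF T1 V v(1)])
  have T0y: "T0 (y i) = (\<Sum>t\<in>J. smul W (- (t * coeff (q t) i)) (T1 (v t)))" for i
  proof -
    have "T0 (y i) = (\<Sum>t\<in>J. smul W (coeff (q t) i) (T0 (v t)))"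
      unfolding y_def by (rule linear_on_comb[OF T0 V v(1)])
    also have "\<dots> = (\<Sum>t\<in>J. smul W (- (t * coeff (q t) i)) (T1 (v t)))"
      by (rule sum.cong) (auto simp: T0v fd_smul[OF W] mult.commute)
    finally show ?thesis .
  qed
  have rel: "(\<Sum>t\<in>J. smul W (c t * a) (T1 (v t))) = 0" for a
  proof -
    have "(\<Sum>t\<in>J. smul W (c t * a) (T1 (v t))) = smul W a (\<Sum>t\<in>J. smul W (c t) (T1 (v t)))"
      by (simp add: fd_smul[OF W] mult.commute)
    then show ?thesis by (simp add: c fd_smul[OF W])
  qed
  have step: "T0 (y (Suc i)) + T1 (y i) = 0" for i
  proof -
    have "T0 (y (Suc i)) + T1 (y i) = (\<Sum>t\<in>J. smul W (coeff (q t) i - t * coeff (q t) (Suc i)) (T1 (v t)))"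
      by (simp add: T0y T1y sum.distrib[symmetric] fd_smul[OF W])
    also have "\<dots> = (\<Sum>t\<in>J. smul W (c t * coeff p (Suc i)) (T1 (v t)))"
      by (rule sum.cong) (auto simp: coeff_pq)
    finally show ?thesis by (simp add: rel)
  qed
  have base: "T0 (y 0) = 0"
  proof -
    have "T0 (y 0) = (\<Sum>t\<in>J. smul W (c t * coeff p 0) (T1 (v t)))"
      unfolding T0y by (rule sum.cong) (auto simp: coeff_pq)
    then show ?thesis by (simp add: rel)
  qed
  \<comment> \<open>The value of the interpolating vector at \<open>s\<close> is a nonzero multiple of \<open>v s\<close>.\<close>
  have "\<exists>i. y i \<noteq> 0"
  proof (rule ccontr)
    assume "\<not> ?thesis"
    then have "(\<Sum>i\<le>d. smul V (s ^ i) (y i)) = 0" by (simp add: fd_smul[OF V])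
    also have "(\<Sum>i\<le>d. smul V (s ^ i) (y i)) = (\<Sum>t\<in>J. smul V (\<Sum>i\<le>d. s ^ i * coeff (q t) i) (v t))"
      unfolding y_def by (simp add: fd_smul[OF V]) (rule sum.swap)
    also have "\<dots> = (\<Sum>t\<in>J. if t = s then smul V (poly (q s) s) (v s) else 0)"
    proof (rule sum.cong[OF refl])
      fix t assume t: "t \<in> J"
      have "degree (q t) \<le> d" unfolding d_def using t J(1) by (intro member_le_sum) auto
      then have "(\<Sum>i\<le>d. s ^ i * coeff (q t) i) = poly (q t) s"
        unfolding poly_altdef
        by (intro sum.mono_neutral_cong_right) (auto simp: mult.commute coeff_eq_0)
      moreover have "poly (q t) s = 0" if "t \<noteq> s"
        using that s(1) J(1) by (auto simp: q_def poly_prod prod_zero_iff)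
      ultimately show "smul V (\<Sum>i\<le>d. s ^ i * coeff (q t) i) (v t)
          = (if t = s then smul V (poly (q s) s) (v s) else 0)"
        by (auto simp: fd_smul[OF V])
    qed
    also have "\<dots> = smul V (poly (q s) s) (v s)" using s(1) J(1) by simp
    finally have "poly (q s) s = 0" using v(2)[OF s(1)] by (simp add: fd_smul[OF V])
    then show False using s J(1) by (auto simp: q_def poly_prod prod_zero_iff)
  qed
  define m where "m = (LEAST i. y i \<noteq> 0)"
  have ym: "y m \<noteq> 0" unfolding m_def using \<open>\<exists>i. y i \<noteq> 0\<close> by (rule LeastI_ex)
  have lt: "y i = 0" if "i < m" for i using that not_less_Least unfolding m_def by blast
  show thesis
  proof (rule that[of "\<lambda>i. y (m + i)" d])
    show "T0 (y (m + 0)) = 0"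
    proof (cases m)
      case (Suc k)
      then show ?thesis using step[of k] lt[of k] by (simp add: linear_on_0[OF T1 V])
    qed (simp add: base)
    show "T0 (y (m + Suc i)) + T1 (y (m + i)) = 0" for i using step[of "m + i"] by simp
  qed (use yc y0 ym in auto)
qed

text \<open>The first vector of the chain lies in the kernel at \<open>t = 0\<close>. Thus injectivity at \<open>t = 0\<close> spreads
  to almost all \<open>t\<close>; this plays the role of the openness of injectivity.\<close>

lemma finite_singular_pencil:
  assumes "fd_space V" "fd_space W" "linear_on V W T0" "linear_on V W T1"
    and "\<And>v. v \<in> car V \<Longrightarrow> T0 v = 0 \<Longrightarrow> v = 0"
  shows "finite {t. \<exists>v\<in>car V. v \<noteq> 0 \<and> T0 v + smul W t (T1 v) = 0}"
proof (rule ccontr)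
  assume "\<not> ?thesis"
  from singular_pencil_chain[OF assms(1-4) this] obtain x :: "nat \<Rightarrow> _" where
    "x 0 \<in> car V" "x 0 \<noteq> 0" "T0 (x 0) = 0" by metis
  then show False using assms(5) by blast
qed

text \<open>The chain is the list of coefficients of a polynomial vector in the kernel of the pencil: at any
  \<open>t\<close> the sum telescopes.\<close>

lemma chain_eval:
  fixes t :: "'k::field"
  assumes V: "fd_space V" and W: "fd_space W" and T0: "linear_on V W T0" and T1: "linear_on V W T1"
    and x: "\<And>i. x i \<in> car V" "\<And>i. i > d \<Longrightarrow> x i = 0" "T0 (x 0) = 0"
      "\<And>i. T0 (x (Suc i)) + T1 (x i) = 0"
  shows "T0 (\<Sum>i\<le>Suc d. smul V (t ^ i) (x i)) + smul W t (T1 (\<Sum>i\<le>Suc d. smul V (t ^ i) (x i))) = 0"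
proof -
  have "T0 (\<Sum>i\<le>n. smul V (t ^ i) (x i)) + smul W t (T1 (\<Sum>i\<le>n. smul V (t ^ i) (x i)))
      = smul W (t ^ Suc n) (T1 (x n))" for n
  proof (induction n)
    case 0
    show ?case using x(1,3) by (simp add: fd_smul[OF V])
  next
    case (Suc n)
    let ?S = "\<Sum>i\<le>n. smul V (t ^ i) (x i)" and ?u = "smul V (t ^ Suc n) (x (Suc n))"
    have c: "?S \<in> car V" "?u \<in> car V" using x(1) by (auto intro!: fd_car[OF V])
    have "T0 (?S + ?u) + smul W t (T1 (?S + ?u))
        = (T0 ?S + smul W t (T1 ?S)) + (T0 ?u + smul W t (T1 ?u))"
      using c by (simp only: linear_onD(2)[OF T0] linear_onD(2)[OF T1] fd_smul(1)[OF W]) simp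
    also have "T0 ?u = smul W (t ^ Suc n) (- T1 (x n))"
      using x(1) x(4)[of n] by (simp only: linear_onD(3)[OF T0] eq_neg_iff_add_eq_0[symmetric])
    also have "T1 ?u = smul W (t ^ Suc n) (T1 (x (Suc n)))"
      using x(1) by (simp only: linear_onD(3)[OF T1])
    finally show ?case using Suc by (simp add: fd_smul[OF W])
  qed
  from this[of "Suc d"] show ?thesis using x(2)[of "Suc d"] linear_on_0[OF T1 V]
    by (simp add: fd_smul[OF W])
qed

section \<open>Modules and triples\<close>

lemma fd_module_space: "fd_module A M \<Longrightarrow> fd_space M"
  by (simp add: fd_module_def)

lemma fd_moduleD:
  assumes "fd_module A M"
  shows "x \<in> car M \<Longrightarrow> act M x (unt A) = x"
    "x \<in> car M \<Longrightarrow> a \<in> car A \<Longrightarrow> act M x a \<in> car M"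
    "x \<in> car M \<Longrightarrow> a \<in> car A \<Longrightarrow> act M (smul M r x) a = smul M r (act M x a)"
    "x \<in> car M \<Longrightarrow> a \<in> car A \<Longrightarrow> act M x (smul A r a) = smul M r (act M x a)"
    "x \<in> car M \<Longrightarrow> y \<in> car M \<Longrightarrow> a \<in> car A \<Longrightarrow> act M (x + y) a = act M x a + act M y a"
    "x \<in> car M \<Longrightarrow> a \<in> car A \<Longrightarrow> b \<in> car A \<Longrightarrow> act M x (a + b) = act M x a + act M x b"
    "x \<in> car M \<Longrightarrow> a \<in> car A \<Longrightarrow> b \<in> car A \<Longrightarrow> act M x (mul A a b) = act M (act M x a) b"
  using assms unfolding fd_module_def by simp_all

lemma act_0:
  assumes "fd_module A M" "a \<in> car A"
  shows "act M 0 a = 0"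
  using fd_moduleD(3)[OF assms(1) fd_car(1)[OF fd_module_space[OF assms(1)]] assms(2), of 0]
  by (simp add: fd_smul[OF fd_module_space[OF assms(1)]])

lemma hom_lin: "f \<in> hom A M N \<Longrightarrow> f \<in> lin M N"
  by (simp add: hom_def)

lemma hom_linear_on: "f \<in> hom A M N \<Longrightarrow> linear_on M N f"
  by (simp add: hom_lin lin_linear_on)

lemma lin_off: "f \<in> lin V W \<Longrightarrow> x \<notin> car V \<Longrightarrow> f x = 0"
  by (simp add: lin_def)

lemma lin_car: "f \<in> lin V W \<Longrightarrow> fd_space W \<Longrightarrow> f x \<in> car W"
  by (cases "x \<in> car V") (auto simp: lin_def fd_car)

lemma lin_0: "f \<in> lin V W \<Longrightarrow> fd_space V \<Longrightarrow> f 0 = 0"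
  by (rule linear_on_0[OF lin_linear_on])

lemma hom_space_eq: "hom_space A M N = (lin_space M N)\<lparr>car := hom A M N\<rparr>"
  by (simp add: hom_space_def lin_space_def)

lemma fd_hom_space:
  assumes M: "fd_module A M" and N: "fd_module A N"
  shows "fd_space (hom_space A M N)"
proof -
  note sM = fd_module_space[OF M] and sN = fd_module_space[OF N]
  interpret L: vector_space "smul (lin_space M N)" by (rule vector_space_lin_space[OF sN])
  have "L.subspace (hom A M N)"
    unfolding L.subspace_def
    using L.subspace_0[OF subspace_lin[OF sN]] L.subspace_add[OF subspace_lin[OF sN]]
      L.subspace_scale[OF subspace_lin[OF sN]]
    by (auto simp: hom_def act_0[OF N] lin_def fd_moduleD[OF N] lin_space_def)
  then show ?thesis
    unfolding hom_space_eq
    by (intro fd_sub fd_lin_space sM sN) (auto simp: lin_space_def hom_def)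
qed

lemma lin_comp:
  assumes "f \<in> lin U V" "g \<in> lin V W" "fd_space V"
  shows "g \<circ> f \<in> lin U W"
  using assms lin_0[OF assms(2,3)] by (auto simp: lin_def)

lemma hom_comp:
  assumes "f \<in> hom A L M" "g \<in> hom A M N" "fd_space M"
  shows "g \<circ> f \<in> hom A L N"
  using assms lin_comp[of f L M g N] lin_linear_on[of f L M]
  by (auto simp: hom_def linear_on_def)

lemma homothety_lin: "fd_space V \<Longrightarrow> homothety V r \<in> lin V V"
  by (auto simp: homothety_def lin_def fd_car fd_smul mult.commute)

lemma homothety_hom: "fd_module A M \<Longrightarrow> homothety M r \<in> hom A M M"
  using homothety_lin[OF fd_module_space, of A M r]
  by (auto simp: hom_def homothety_def fd_moduleD)

lemma homothety_1: "fd_space V \<Longrightarrow> x \<in> car V \<Longrightarrow> homothety V 1 x = x"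
  by (simp add: homothety_def fd_smul)

lemma bij_homothety:
  assumes "fd_space V"
  shows "bij_betw (homothety V 1) (car V) (car V)"
  using bij_betw_cong[of "car V" "homothety V 1" "\<lambda>x. x"] homothety_1[OF assms] bij_betw_id by (auto simp: id_def)

lemma lin_inverse:
  assumes f: "f \<in> lin V W" "bij_betw f (car V) (car W)" and V: "fd_space V"
  obtains g where "g \<in> lin W V" "bij_betw g (car W) (car V)"
    "\<And>x. x \<in> car V \<Longrightarrow> g (f x) = x" "\<And>y. y \<in> car W \<Longrightarrow> f (g y) = y"
proof -
  define g where "g y = (if y \<in> car W then inv_into (car V) f y else 0)" for y
  have gf: "g (f x) = x" if "x \<in> car V" for x
    using that f by (simp add: g_def bij_betw_def lin_def inv_into_f_f)
  have fg: "f (g y) = y" and gc: "g y \<in> car V" if "y \<in> car W" for y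
    using that f(2) f_inv_into_f[of y f "car V"] inv_into_into[of y f "car V"]
    by (auto simp: g_def bij_betw_def)
  have "g (y + z) = g y + g z" if "y \<in> car W" "z \<in> car W" for y z
    using that gf[of "g y + g z"] gc fg linear_onD(2)[OF lin_linear_on[OF f(1)], of "g y" "g z"]
    by (simp add: fd_car[OF V])
  moreover have "g (smul W r y) = smul V r (g y)" if "y \<in> car W" for y r
    using that gf[of "smul V r (g y)"] gc fg linear_onD(3)[OF lin_linear_on[OF f(1)], of "g y" r]
    by (simp add: fd_car[OF V])
  ultimately have "g \<in> lin W V" using gc by (auto simp: lin_def g_def)
  moreover have "bij_betw g (car W) (car V)"
    by (rule bij_betw_byWitness[of _ f]) (use gf fg gc f(1) in \<open>auto simp: lin_def\<close>)
  ultimately show thesis using gf fg that by blast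
qed

lemma hom_inverse:
  assumes f: "f \<in> hom A M N" "bij_betw f (car M) (car N)" and M: "fd_module A M"
  obtains g where "g \<in> hom A N M" "bij_betw g (car N) (car M)"
    "\<And>x. x \<in> car M \<Longrightarrow> g (f x) = x" "\<And>y. y \<in> car N \<Longrightarrow> f (g y) = y"
proof -
  obtain g where g: "g \<in> lin N M" "bij_betw g (car N) (car M)"
    "\<And>x. x \<in> car M \<Longrightarrow> g (f x) = x" "\<And>y. y \<in> car N \<Longrightarrow> f (g y) = y"
    using lin_inverse[OF hom_lin[OF f(1)] f(2) fd_module_space[OF M]] by metis
  have "g (act N y a) = act M (g y) a" if "y \<in> car N" "a \<in> car A" for y a
  proof -
    have gy: "g y \<in> car M" using g(1) that by (simp add: lin_def)
    have "f (act M (g y) a) = act N (f (g y)) a" using f(1) gy that by (simp add: hom_def)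
    then show ?thesis
      using g(3)[of "act M (g y) a"] g(4)[OF that(1)] fd_moduleD(2)[OF M gy that(2)] by simp
  qed
  then have "g \<in> hom A N M" using g(1) by (simp add: hom_def)
  then show thesis using g that by blast
qed

text \<open>This is how isomorphisms are recognised below: two composable morphisms are known, and the composition is a
  nonzero scalar.\<close>

lemma bij_endo:
  assumes V: "fd_space V" and f: "linear_on V V f" and g: "linear_on V V g"
    and gf: "\<And>x. x \<in> car V \<Longrightarrow> g (f x) = smul V c x" and c: "c \<noteq> 0"
  shows "bij_betw f (car V) (car V)" "bij_betw g (car V) (car V)"
proof -
  have f0: "x = 0" if "x \<in> car V" "f x = 0" for x
    using gf[OF that(1)] that(2) c by (simp add: linear_on_0[OF g V] fd_smul[OF V])
  have im: "f ` car V = car V" by (rule linear_inj_surj[OF V V f f0 order_refl])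
  then show "bij_betw f (car V) (car V)" using inj_on_linear[OF f V f0] by (simp add: bij_betw_def)
  have g0: "y = 0" if y: "y \<in> car V" "g y = 0" for y
  proof -
    obtain x where x: "x \<in> car V" "y = f x" using im y(1) by blast
    then have "x = 0" using gf[OF x(1)] y(2) c by (simp add: fd_smul[OF V])
    then show ?thesis using x linear_on_0[OF f V] by simp
  qed
  show "bij_betw g (car V) (car V)"
    using inj_on_linear[OF g V g0] linear_inj_surj[OF V V g g0 order_refl] by (simp add: bij_betw_def)
qed

text \<open>Triples \<open>(N, W, \<eta>)\<close> over arbitrary ambient types: the modules \<open>nmod Xs m\<close> do not
  live in the ambient type of coordinate modules, so they cannot be components of a \<open>triple\<close>.\<close>

definition is_trip :: "('k::field, 'b::ab_group_add) algebra \<Rightarrow> ('k, 'b, 'e::ab_group_add) rmodule \<Rightarrow>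
    ('k, 'b, 'v::ab_group_add) rmodule \<Rightarrow> ('k, 'w::ab_group_add) space \<Rightarrow> ('w \<Rightarrow> 'e \<Rightarrow> 'v) \<Rightarrow> bool" where
  "is_trip B E N W \<eta> \<longleftrightarrow> fd_module B N \<and> fd_space W \<and> \<eta> \<in> lin W (hom_space B E N)"

definition trip_hom :: "('k::field, 'b::ab_group_add) algebra \<Rightarrow>
    ('k, 'b, 'v::ab_group_add) rmodule \<Rightarrow> ('k, 'w::ab_group_add) space \<Rightarrow> ('w \<Rightarrow> 'e::ab_group_add \<Rightarrow> 'v) \<Rightarrow>
    ('k, 'b, 'v2::ab_group_add) rmodule \<Rightarrow> ('k, 'w2::ab_group_add) space \<Rightarrow> ('w2 \<Rightarrow> 'e \<Rightarrow> 'v2) \<Rightarrow>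
    (('v \<Rightarrow> 'v2) \<times> ('w \<Rightarrow> 'w2)) set" where
  "trip_hom B N W \<eta> N' W' \<eta>' = {(f, g). f \<in> hom B N N' \<and> g \<in> lin W W' \<and>
     (\<forall>w\<in>car W. f \<circ> \<eta> w = \<eta>' (g w))}"

definition trip_iso where
  "trip_iso B N W \<eta> N' W' \<eta>' \<longleftrightarrow> (\<exists>(f, g)\<in>trip_hom B N W \<eta> N' W' \<eta>'.
     bij_betw f (car N) (car N') \<and> bij_betw g (car W) (car W'))"

definition scalar_endos where
  "scalar_endos B N W \<eta> \<longleftrightarrow>
     trip_hom B N W \<eta> N W \<eta> = range (\<lambda>r. (homothety N r, homothety W r))"

lemma trip_homI:
  "f \<in> hom B N N' \<Longrightarrow> g \<in> lin W W' \<Longrightarrow> (\<And>w. w \<in> car W \<Longrightarrow> f \<circ> \<eta> w = \<eta>' (g w)) \<Longrightarrow>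
    (f, g) \<in> trip_hom B N W \<eta> N' W' \<eta>'"
  by (simp add: trip_hom_def)

lemma trip_homD:
  assumes "(f, g) \<in> trip_hom B N W \<eta> N' W' \<eta>'"
  shows "f \<in> hom B N N'" "g \<in> lin W W'" "w \<in> car W \<Longrightarrow> f \<circ> \<eta> w = \<eta>' (g w)"
  using assms by (auto simp: trip_hom_def)

lemma is_tripD:
  assumes "is_trip B E N W \<eta>"
  shows "fd_module B N" "fd_space N" "fd_space W" "\<eta> \<in> lin W (hom_space B E N)"
    "w \<in> car W \<Longrightarrow> \<eta> w \<in> hom B E N"
  using assms by (auto simp: is_trip_def fd_module_def lin_def hom_space_def)

lemma trip_hom_comp:
  assumes "(f, g) \<in> trip_hom B N W \<eta> N' W' \<eta>'" "(f', g') \<in> trip_hom B N' W' \<eta>' N'' W'' \<eta>''"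
    and "fd_space N'" "fd_space W'"
  shows "(f' \<circ> f, g' \<circ> g) \<in> trip_hom B N W \<eta> N'' W'' \<eta>''"
proof (rule trip_homI)
  show "f' \<circ> f \<in> hom B N N''"
    by (rule hom_comp[OF trip_homD(1)[OF assms(1)] trip_homD(1)[OF assms(2)] assms(3)])
  show "g' \<circ> g \<in> lin W W''"
    by (rule lin_comp[OF trip_homD(2)[OF assms(1)] trip_homD(2)[OF assms(2)] assms(4)])
  fix w assume w: "w \<in> car W"
  then have "g w \<in> car W'" using trip_homD(2)[OF assms(1)] by (simp add: lin_def)
  then show "f' \<circ> f \<circ> \<eta> w = \<eta>'' ((g' \<circ> g) w)"
    using trip_homD(3)[OF assms(1) w] trip_homD(3)[OF assms(2)] by (simp add: comp_assoc)
qed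

lemma homothety_comp_hom:
  assumes E: "fd_module B E" and "is_trip B E N W \<eta>" "w \<in> car W"
  shows "homothety N r \<circ> \<eta> w = \<eta> (smul W r w)"
proof
  fix e
  have "\<eta> (smul W r w) = (\<lambda>e. smul N r (\<eta> w e))"
    using linear_onD(3)[OF lin_linear_on[OF is_tripD(4)[OF assms(2)]] assms(3), of r]
    by (simp add: hom_space_def)
  moreover have "\<eta> w e \<in> car N"
    using lin_car[OF hom_lin[OF is_tripD(5)[OF assms(2,3)]] is_tripD(2)[OF assms(2)]] .
  ultimately show "(homothety N r \<circ> \<eta> w) e = \<eta> (smul W r w) e" by (simp add: homothety_def)
qed

lemma homothety_trip_hom:
  assumes "fd_module B E" "is_trip B E N W \<eta>"
  shows "(homothety N r, homothety W r) \<in> trip_hom B N W \<eta> N W \<eta>"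
proof (rule trip_homI)
  fix w assume "w \<in> car W"
  then show "homothety N r \<circ> \<eta> w = \<eta> (homothety W r w)"
    using homothety_comp_hom[OF assms] by (simp add: homothety_def)
qed (use homothety_hom[OF is_tripD(1)[OF assms(2)]] homothety_lin[OF is_tripD(3)[OF assms(2)]] in auto)

lemma scalar_endosI:
  assumes "fd_module B E" "is_trip B E N W \<eta>"
    and "\<And>f g. (f, g) \<in> trip_hom B N W \<eta> N W \<eta> \<Longrightarrow> \<exists>r. f = homothety N r \<and> g = homothety W r"
  shows "scalar_endos B N W \<eta>"
  unfolding scalar_endos_def using homothety_trip_hom[OF assms(1,2)] assms(3) by fast

lemma trip_iso_refl:
  assumes "fd_module B E" "is_trip B E N W \<eta>"
  shows "trip_iso B N W \<eta> N W \<eta>"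
  unfolding trip_iso_def
  using homothety_trip_hom[OF assms, of 1] bij_homothety[OF is_tripD(2)[OF assms(2)]]
    bij_homothety[OF is_tripD(3)[OF assms(2)]] by blast

lemma trip_iso_trans:
  assumes "trip_iso B N W \<eta> N' W' \<eta>'" "trip_iso B N' W' \<eta>' N'' W'' \<eta>''" "fd_space N'" "fd_space W'"
  shows "trip_iso B N W \<eta> N'' W'' \<eta>''"
proof -
  obtain f g where f: "(f, g) \<in> trip_hom B N W \<eta> N' W' \<eta>'"
    "bij_betw f (car N) (car N')" "bij_betw g (car W) (car W')"
    using assms(1) by (auto simp: trip_iso_def)
  obtain f' g' where f': "(f', g') \<in> trip_hom B N' W' \<eta>' N'' W'' \<eta>''"
    "bij_betw f' (car N') (car N'')" "bij_betw g' (car W') (car W'')"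
    using assms(2) by (auto simp: trip_iso_def)
  show ?thesis
    unfolding trip_iso_def
    using trip_hom_comp[OF f(1) f'(1) assms(3,4)] bij_betw_trans[OF f(2) f'(2)]
      bij_betw_trans[OF f(3) f'(3)] by blast
qed

lemma trip_iso_inverse:
  assumes T: "is_trip B E N W \<eta>" and T': "is_trip B E N' W' \<eta>'"
    and f: "(f, g) \<in> trip_hom B N W \<eta> N' W' \<eta>'" "bij_betw f (car N) (car N')"
      "bij_betw g (car W) (car W')"
  obtains f' g' where "(f', g') \<in> trip_hom B N' W' \<eta>' N W \<eta>"
    "bij_betw f' (car N') (car N)" "bij_betw g' (car W') (car W)"
    "\<And>x. x \<in> car N \<Longrightarrow> f' (f x) = x" "\<And>y. y \<in> car N' \<Longrightarrow> f (f' y) = y"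
    "\<And>x. x \<in> car W \<Longrightarrow> g' (g x) = x" "\<And>y. y \<in> car W' \<Longrightarrow> g (g' y) = y"
proof -
  obtain f' where f': "f' \<in> hom B N' N" "bij_betw f' (car N') (car N)"
    "\<And>x. x \<in> car N \<Longrightarrow> f' (f x) = x" "\<And>y. y \<in> car N' \<Longrightarrow> f (f' y) = y"
    using hom_inverse[OF trip_homD(1)[OF f(1)] f(2) is_tripD(1)[OF T]] by metis
  obtain g' where g': "g' \<in> lin W' W" "bij_betw g' (car W') (car W)"
    "\<And>x. x \<in> car W \<Longrightarrow> g' (g x) = x" "\<And>y. y \<in> car W' \<Longrightarrow> g (g' y) = y"
    using lin_inverse[OF trip_homD(2)[OF f(1)] f(3) is_tripD(3)[OF T]] by metis
  have "(f', g') \<in> trip_hom B N' W' \<eta>' N W \<eta>"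
  proof (rule trip_homI[OF f'(1) g'(1)])
    fix w assume w: "w \<in> car W'"
    then have gw: "g' w \<in> car W" using g'(1) by (simp add: lin_def)
    have "f \<circ> \<eta> (g' w) = \<eta>' w" using trip_homD(3)[OF f(1) gw] g'(4)[OF w] by simp
    then have "f' \<circ> \<eta>' w = f' \<circ> f \<circ> \<eta> (g' w)" by (simp add: comp_assoc)
    also have "\<dots> = \<eta> (g' w)"
    proof
      fix e
      have "\<eta> (g' w) e \<in> car N"
        using lin_car[OF hom_lin[OF is_tripD(5)[OF T gw]] is_tripD(2)[OF T]] .
      then show "(f' \<circ> f \<circ> \<eta> (g' w)) e = \<eta> (g' w) e" by (simp add: f'(3))
    qed
    finally show "f' \<circ> \<eta>' w = \<eta> (g' w)" .
  qed
  then show thesis by (rule that[OF _ f'(2) g'(2) f'(3,4) g'(3,4)])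
qed

lemma trip_iso_sym:
  assumes "is_trip B E N W \<eta>" "is_trip B E N' W' \<eta>'" "trip_iso B N W \<eta> N' W' \<eta>'"
  shows "trip_iso B N' W' \<eta>' N W \<eta>"
proof -
  obtain f g where f: "(f, g) \<in> trip_hom B N W \<eta> N' W' \<eta>'"
    "bij_betw f (car N) (car N')" "bij_betw g (car W) (car W')"
    using assms(3) by (auto simp: trip_iso_def)
  show ?thesis
    by (rule trip_iso_inverse[OF assms(1,2) f]) (auto simp: trip_iso_def)
qed

text \<open>Endomorphisms are conjugated by the isomorphism, and conjugation fixes scalars.\<close>

lemma scalar_endos_iso:
  assumes E: "fd_module B E" and T: "is_trip B E N W \<eta>" and T': "is_trip B E N' W' \<eta>'"
    and iso: "trip_iso B N W \<eta> N' W' \<eta>'" and s: "scalar_endos B N W \<eta>"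
  shows "scalar_endos B N' W' \<eta>'"
proof (rule scalar_endosI[OF E T'])
  obtain f g where f: "(f, g) \<in> trip_hom B N W \<eta> N' W' \<eta>'"
    "bij_betw f (car N) (car N')" "bij_betw g (car W) (car W')"
    using iso by (auto simp: trip_iso_def)
  obtain f' g' where f': "(f', g') \<in> trip_hom B N' W' \<eta>' N W \<eta>"
    "\<And>x. x \<in> car N \<Longrightarrow> f' (f x) = x" "\<And>y. y \<in> car N' \<Longrightarrow> f (f' y) = y"
    "\<And>x. x \<in> car W \<Longrightarrow> g' (g x) = x" "\<And>y. y \<in> car W' \<Longrightarrow> g (g' y) = y"
    using trip_iso_inverse[OF T T' f] by metis
  note N = is_tripD(2)[OF T] and W = is_tripD(3)[OF T] and N' = is_tripD(2)[OF T'] and W' = is_tripD(3)[OF T']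
  fix a b assume a: "(a, b) \<in> trip_hom B N' W' \<eta>' N' W' \<eta>'"
  have "(f' \<circ> (a \<circ> f), g' \<circ> (b \<circ> g)) \<in> trip_hom B N W \<eta> N W \<eta>"
    by (rule trip_hom_comp[OF trip_hom_comp[OF f(1) a N' W'] f'(1) N' W'])
  then obtain r where r: "f' \<circ> (a \<circ> f) = homothety N r" "g' \<circ> (b \<circ> g) = homothety W r"
    using s unfolding scalar_endos_def by auto
  have "a = homothety N' r"
  proof
    fix y show "a y = homothety N' r y"
    proof (cases "y \<in> car N'")
      case True
      have c: "f' y \<in> car N" "a y \<in> car N'"
        using trip_homD(1)[OF f'(1)] trip_homD(1)[OF a] True by (auto simp: hom_def lin_def)
      have "f' (a y) = smul N r (f' y)"
        using fun_cong[OF r(1), of "f' y"] c by (simp add: f'(3)[OF True] homothety_def)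
      then have "f (f' (a y)) = f (smul N r (f' y))" by simp
      also have "\<dots> = smul N' r (f (f' y))"
        using c by (intro linear_onD(3)[OF hom_linear_on[OF trip_homD(1)[OF f(1)]]])
      finally show ?thesis using c True by (simp add: f'(3) homothety_def)
    qed (use trip_homD(1)[OF a] in \<open>simp add: homothety_def hom_def lin_def\<close>)
  qed
  moreover have "b = homothety W' r"
  proof
    fix y show "b y = homothety W' r y"
    proof (cases "y \<in> car W'")
      case True
      have c: "g' y \<in> car W" "b y \<in> car W'"
        using trip_homD(2)[OF f'(1)] trip_homD(2)[OF a] True by (auto simp: lin_def)
      have "g' (b y) = smul W r (g' y)"
        using fun_cong[OF r(2), of "g' y"] c by (simp add: f'(5)[OF True] homothety_def)
      then have "g (g' (b y)) = g (smul W r (g' y))" by simp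
      also have "\<dots> = smul W' r (g (g' y))"
        using c by (intro linear_onD(3)[OF lin_linear_on[OF trip_homD(2)[OF f(1)]]])
      finally show ?thesis using c True by (simp add: f'(5) homothety_def)
    qed (use trip_homD(2)[OF a] in \<open>simp add: homothety_def lin_def\<close>)
  qed
  ultimately show "\<exists>r. a = homothety N' r \<and> b = homothety W' r" by blast
qed

text \<open>Transport of structure along \<open>f\<close> and \<open>g\<close>: the new map is \<open>w \<mapsto> f \<circ> \<eta> (g\<^sup>-\<^sup>1 w)\<close>.\<close>

lemma trip_transport:
  assumes T: "is_trip B E N W \<eta>" and N': "fd_module B N'" and W': "fd_space W'"
    and f: "f \<in> hom B N N'" "bij_betw f (car N) (car N')"
    and g: "g \<in> lin W W'" "bij_betw g (car W) (car W')" and E: "fd_module B E"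
  obtains \<eta>' where "is_trip B E N' W' \<eta>'" "trip_iso B N W \<eta> N' W' \<eta>'"
proof -
  note N = is_tripD(2)[OF T] and W = is_tripD(3)[OF T]
  obtain g' where g': "g' \<in> lin W' W" "bij_betw g' (car W') (car W)"
    "\<And>x. x \<in> car W \<Longrightarrow> g' (g x) = x" "\<And>y. y \<in> car W' \<Longrightarrow> g (g' y) = y"
    using lin_inverse[OF g W] by metis
  define \<eta>' where "\<eta>' = (\<lambda>\<phi>. f \<circ> \<phi>) \<circ> (\<eta> \<circ> g')"
  have \<eta>1: "\<eta> \<circ> g' \<in> lin W' (hom_space B E N)" by (rule lin_comp[OF g'(1) is_tripD(4)[OF T] W])
  have f0: "f 0 = 0" by (rule lin_0[OF hom_lin[OF f(1)] N])
  have val: "(\<eta> \<circ> g') w e \<in> car N" for w e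
    using lin_car[OF \<eta>1 fd_hom_space[OF E is_tripD(1)[OF T]], of w]
      lin_car[OF hom_lin N, of _ B E e] by (simp add: hom_space_def)
  have "is_trip B E N' W' \<eta>'"
    unfolding is_trip_def
  proof (intro conjI N' W')
    show "\<eta>' \<in> lin W' (hom_space B E N')"
      unfolding lin_iff linear_on_def
    proof (intro conjI ballI allI impI)
      fix x assume x: "x \<in> car W'"
      have "(\<eta> \<circ> g') x \<in> hom B E N" using linear_onD(1)[OF lin_linear_on[OF \<eta>1] x] by (simp add: hom_space_def)
      then show "\<eta>' x \<in> car (hom_space B E N')"
        using hom_comp[OF _ f(1) N] by (simp add: \<eta>'_def hom_space_def)
      { fix y assume y: "y \<in> car W'"
        have "(\<eta> \<circ> g') (x + y) = (\<eta> \<circ> g') x + (\<eta> \<circ> g') y"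
          by (rule linear_onD(2)[OF lin_linear_on[OF \<eta>1] x y])
        then show "\<eta>' (x + y) = \<eta>' x + \<eta>' y"
          using val linear_onD(2)[OF hom_linear_on[OF f(1)]] by (auto simp: \<eta>'_def fun_eq_iff) }
      fix r
      have "(\<eta> \<circ> g') (smul W' r x) = smul (hom_space B E N) r ((\<eta> \<circ> g') x)"
        by (rule linear_onD(3)[OF lin_linear_on[OF \<eta>1] x])
      then show "\<eta>' (smul W' r x) = smul (hom_space B E N') r (\<eta>' x)"
        using val linear_onD(3)[OF hom_linear_on[OF f(1)]]
        by (auto simp: \<eta>'_def fun_eq_iff hom_space_def)
    next
      fix x assume "x \<notin> car W'"
      then have "(\<eta> \<circ> g') x = 0" by (rule lin_off[OF \<eta>1])
      then show "\<eta>' x = 0" by (auto simp: \<eta>'_def fun_eq_iff f0)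
    qed
  qed
  moreover have "(f, g) \<in> trip_hom B N W \<eta> N' W' \<eta>'"
    by (rule trip_homI[OF f(1) g(1)]) (simp add: \<eta>'_def g'(3))
  ultimately show thesis using that f(2) g(2) unfolding trip_iso_def by blast
qed

section \<open>Families of triples on a fixed module and a fixed vector space\<close>

locale triple_family =
  fixes B :: "('k::field, 'b::ab_group_add) algebra"
    and E :: "('k, 'b, 'e::ab_group_add) rmodule"
    and N :: "('k, 'b, 'v::ab_group_add) rmodule"
    and W :: "('k, 'w::ab_group_add) space"
  assumes E: "fd_module B E" and N: "fd_module B N" and W: "fd_space W"
begin

abbreviation H where "H \<equiv> hom_space B E N"
abbreviation P where "P \<equiv> prod_space (hom_space B N N) (lin_space W W)"
abbreviation Q where "Q \<equiv> lin_space W H"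

text \<open>The two halves of \<open>D\<close> below, as functions of the pair \<open>v = (f, g)\<close>.\<close>

definition Lm where "Lm \<zeta> v = (\<lambda>w. fst v \<circ> \<zeta> w)"
definition Rm where "Rm \<zeta> v = (\<lambda>w. \<zeta> (snd v w))"

text \<open>The kernel of \<open>D \<eta> \<eta>'\<close> is the space of morphisms from \<open>(N, W, \<eta>)\<close> to \<open>(N, W, \<eta>')\<close>; for
  \<open>\<eta> = \<eta>'\<close> it is the differential at \<open>1\<close> of the orbit map of \<open>\<eta>\<close> under \<open>Aut N \<times> GL W\<close>.\<close>

definition D where "D \<eta> \<eta>' v = Lm \<eta> v - Rm \<eta>' v"

definition one where "one = (homothety N 1, homothety W 1)"

lemma sN: "fd_space N" by (rule fd_module_space[OF N])
lemma fdH: "fd_space H" by (rule fd_hom_space[OF E N])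
lemma fdP: "fd_space P" by (intro fd_prod_space fd_hom_space fd_lin_space N W)
lemma fdQ: "fd_space Q" by (intro fd_lin_space fdH W)

lemma vdimP: "vdim P = vdim (hom_space B N N) + vdim W * vdim W"
  by (simp add: fd_prod_space(2)[OF fd_hom_space[OF N N] fd_lin_space(1)[OF W W]] fd_lin_space(2)[OF W W])

lemma vdimQ: "vdim Q = vdim W * vdim H"
  by (rule fd_lin_space(2)[OF W fdH])

lemma car_P: "v \<in> car P \<longleftrightarrow> fst v \<in> hom B N N \<and> snd v \<in> lin W W"
  by (cases v) (simp add: prod_space_def hom_space_def lin_space_def)

lemma smul_P: "smul P r v = ((\<lambda>x. smul N r (fst v x)), (\<lambda>x. smul W r (snd v x)))"
  by (cases v) (simp add: prod_space_def hom_space_def lin_space_def)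

lemma car_Q: "car Q = lin W H"
  by (simp add: lin_space_def)

lemma smul_Q: "smul Q r \<zeta> = (\<lambda>w e. smul N r (\<zeta> w e))"
  by (simp add: lin_space_def hom_space_def)

lemma trip: "\<eta> \<in> lin W H \<Longrightarrow> is_trip B E N W \<eta>"
  by (simp add: is_trip_def N W)

lemma Q_hom: "\<zeta> \<in> lin W H \<Longrightarrow> \<zeta> w \<in> hom B E N"
  using lin_car[of \<zeta> W H, OF _ fdH] by (simp add: hom_space_def)

lemma Q_val: "\<zeta> \<in> lin W H \<Longrightarrow> \<zeta> w e \<in> car N"
  using lin_car[OF hom_lin[OF Q_hom] sN] .

lemma P_fst: "v \<in> car P \<Longrightarrow> x \<in> car N \<Longrightarrow> fst v x \<in> car N"
  "v \<in> car P \<Longrightarrow> x \<in> car N \<Longrightarrow> y \<in> car N \<Longrightarrow> fst v (x + y) = fst v x + fst v y"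
  "v \<in> car P \<Longrightarrow> x \<in> car N \<Longrightarrow> fst v (smul N r x) = smul N r (fst v x)"
  "v \<in> car P \<Longrightarrow> fst v 0 = 0"
  using linear_onD[OF hom_linear_on, of "fst v" B N N] lin_0[OF hom_lin sN, of "fst v" B N]
  by (auto simp: car_P)

lemma P_snd: "v \<in> car P \<Longrightarrow> x \<in> car W \<Longrightarrow> snd v x \<in> car W"
  "v \<in> car P \<Longrightarrow> x \<in> car W \<Longrightarrow> y \<in> car W \<Longrightarrow> snd v (x + y) = snd v x + snd v y"
  "v \<in> car P \<Longrightarrow> x \<in> car W \<Longrightarrow> snd v (smul W r x) = smul W r (snd v x)"
  "v \<in> car P \<Longrightarrow> x \<notin> car W \<Longrightarrow> snd v x = 0"
  "v \<in> car P \<Longrightarrow> snd v x \<in> car W"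
  using linear_onD[OF lin_linear_on, of "snd v" W W] lin_off[of "snd v" W W] lin_car[OF _ W, of "snd v" W]
  by (auto simp: car_P)

lemma Q_lin: "\<zeta> \<in> lin W H \<Longrightarrow> x \<in> car W \<Longrightarrow> y \<in> car W \<Longrightarrow> \<zeta> (x + y) = (\<lambda>e. \<zeta> x e + \<zeta> y e)"
  "\<zeta> \<in> lin W H \<Longrightarrow> x \<in> car W \<Longrightarrow> \<zeta> (smul W r x) = (\<lambda>e. smul N r (\<zeta> x e))"
  "\<zeta> \<in> lin W H \<Longrightarrow> x \<notin> car W \<Longrightarrow> \<zeta> x = 0" "\<zeta> \<in> lin W H \<Longrightarrow> \<zeta> 0 = 0"
  using linear_onD[OF lin_linear_on, of \<zeta> W H] lin_off[of \<zeta> W H] lin_0[OF _ W, of \<zeta> H]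
  by (auto simp: fun_eq_iff) (simp add: hom_space_def)

lemma linear_Lm:
  assumes \<zeta>: "\<zeta> \<in> lin W H"
  shows "linear_on P Q (Lm \<zeta>)"
  unfolding linear_on_def car_Q
proof (intro conjI ballI allI)
  fix v assume v: "v \<in> car P"
  then have fv: "fst v \<in> hom B N N" by (simp only: car_P)
  show "Lm \<zeta> v \<in> lin W H"
    unfolding lin_iff linear_on_def
    using hom_comp[OF Q_hom[OF \<zeta>] fv sN] P_fst[OF v] Q_val[OF \<zeta>]
    by (auto simp: Lm_def hom_space_def Q_lin[OF \<zeta>] fun_eq_iff)
  show "Lm \<zeta> (v + v') = Lm \<zeta> v + Lm \<zeta> v'" for v'
    by (simp add: Lm_def fun_eq_iff)
  show "Lm \<zeta> (smul P r v) = smul Q r (Lm \<zeta> v)" for r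
    by (simp add: Lm_def smul_P smul_Q fun_eq_iff)
qed

lemma linear_Rm:
  assumes \<zeta>: "\<zeta> \<in> lin W H"
  shows "linear_on P Q (Rm \<zeta>)"
  unfolding linear_on_def car_Q
proof (intro conjI ballI allI)
  fix v assume v: "v \<in> car P"
  show "Rm \<zeta> v \<in> lin W H"
    unfolding lin_iff linear_on_def
    using Q_hom[OF \<zeta>] P_snd[OF v]
    by (auto simp: Rm_def hom_space_def Q_lin[OF \<zeta>] fun_eq_iff)
  fix v' assume v': "v' \<in> car P"
  show "Rm \<zeta> (v + v') = Rm \<zeta> v + Rm \<zeta> v'"
    using P_snd(5)[OF v] P_snd(5)[OF v'] by (simp add: Rm_def fun_eq_iff Q_lin(1)[OF \<zeta>])
next
  fix r v assume v: "v \<in> car P"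
  show "Rm \<zeta> (smul P r v) = smul Q r (Rm \<zeta> v)"
    using P_snd(5)[OF v] by (simp add: Rm_def smul_P smul_Q fun_eq_iff Q_lin(2)[OF \<zeta>])
qed

lemma linear_on_restrict:
  "linear_on V U f \<Longrightarrow> C \<subseteq> car V \<Longrightarrow> linear_on (V\<lparr>car := C\<rparr>) U f"
  by (auto simp: linear_on_def subset_iff)

lemma linear_on_compose:
  "linear_on V U f \<Longrightarrow> linear_on U X g \<Longrightarrow> linear_on V X (\<lambda>v. g (f v))"
  by (auto simp: linear_on_def)

lemma linear_on_minus:
  assumes "linear_on V U f" "linear_on V U g" "fd_space U"
  shows "linear_on V U (\<lambda>v. f v - g v)"
  using assms by (auto simp: linear_on_def fd_car fd_smul algebra_simps)

lemma linear_on_uminus: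
  assumes "linear_on V U f" "fd_space U"
  shows "linear_on V U (\<lambda>v. - f v)"
  using assms by (auto simp: linear_on_def fd_car fd_smul algebra_simps)

lemma linear_D: "\<eta> \<in> lin W H \<Longrightarrow> \<eta>' \<in> lin W H \<Longrightarrow> linear_on P Q (D \<eta> \<eta>')"
  using linear_on_minus[OF linear_Lm linear_Rm fdQ, of \<eta> \<eta>'] by (simp add: D_def[abs_def])

lemma D_ker:
  assumes "v \<in> car P" "\<eta> \<in> lin W H" "\<eta>' \<in> lin W H"
  shows "D \<eta> \<eta>' v = 0 \<longleftrightarrow> v \<in> trip_hom B N W \<eta> N W \<eta>'"
proof -
  have "D \<eta> \<eta>' v = 0 \<longleftrightarrow> (\<forall>w. fst v \<circ> \<eta> w = \<eta>' (snd v w))"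
    by (simp add: D_def Lm_def Rm_def fun_eq_iff)
  also have "\<dots> \<longleftrightarrow> (\<forall>w\<in>car W. fst v \<circ> \<eta> w = \<eta>' (snd v w))"
  proof (intro iffI allI ballI)
    fix w assume h: "\<forall>w\<in>car W. fst v \<circ> \<eta> w = \<eta>' (snd v w)"
    show "fst v \<circ> \<eta> w = \<eta>' (snd v w)"
    proof (cases "w \<in> car W")
      case False
      then show ?thesis
        using P_fst(4)[OF assms(1)] P_snd(4)[OF assms(1)]
        by (simp add: Q_lin(3)[OF assms(2)] Q_lin(4)[OF assms(3)] fun_eq_iff)
    qed (use h in blast)
  qed blast
  finally show ?thesis using assms(1) by (cases v) (auto simp: trip_hom_def car_P)
qed

lemma trip_hom_car: "v \<in> trip_hom B N W \<eta> N W \<eta>' \<Longrightarrow> v \<in> car P"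
  by (cases v) (auto simp: trip_hom_def car_P)

lemma scale_one: "smul P r one = (homothety N r, homothety W r)"
  by (auto simp: smul_P one_def homothety_def fun_eq_iff fd_smul[OF sN] fd_smul[OF W])

lemma one_car: "one \<in> car P"
  by (simp add: car_P one_def homothety_hom[OF N] homothety_lin[OF W])

lemma one_nonzero: "nonzero N \<Longrightarrow> one \<noteq> 0"
proof
  assume n: "nonzero N" and 0: "one = 0"
  obtain x where x: "x \<in> car N" "x \<noteq> 0" using n fd_car(1)[OF sN] by (auto simp: nonzero_def)
  have "fst one x = 0" using 0 by simp
  then show False using x by (simp add: one_def homothety_1[OF sN])
qed

lemma scalar_endos_iff:
  assumes "\<eta> \<in> lin W H"
  shows "scalar_endos B N W \<eta> \<longleftrightarrow> (\<forall>v\<in>car P. D \<eta> \<eta> v = 0 \<longrightarrow> (\<exists>r. v = smul P r one))"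
proof
  assume "scalar_endos B N W \<eta>"
  then show "\<forall>v\<in>car P. D \<eta> \<eta> v = 0 \<longrightarrow> (\<exists>r. v = smul P r one)"
    using D_ker[OF _ assms assms] by (auto simp: scalar_endos_def scale_one)
next
  assume h: "\<forall>v\<in>car P. D \<eta> \<eta> v = 0 \<longrightarrow> (\<exists>r. v = smul P r one)"
  show "scalar_endos B N W \<eta>"
  proof (rule scalar_endosI[OF E trip[OF assms]])
    fix f g assume fg: "(f, g) \<in> trip_hom B N W \<eta> N W \<eta>"
    then have "D \<eta> \<eta> (f, g) = 0" using D_ker[OF trip_hom_car[OF fg] assms assms] by simp
    then obtain r where "(f, g) = smul P r one" using h trip_hom_car[OF fg] by blast
    then show "\<exists>r. f = homothety N r \<and> g = homothety W r" by (auto simp: scale_one)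
  qed
qed

lemma D_one: "\<eta> \<in> lin W H \<Longrightarrow> D \<eta> \<eta> (smul P r one) = 0"
  using D_ker[of "smul P r one" \<eta> \<eta>] homothety_trip_hom[OF E trip]
  by (simp add: scale_one fd_car[OF fdP] one_car car_P homothety_hom[OF N] homothety_lin[OF W])

lemma line_car: "\<eta> \<in> lin W H \<Longrightarrow> \<zeta> \<in> lin W H \<Longrightarrow> \<eta> + smul Q t \<zeta> \<in> lin W H"
  using fd_car(2,3)[OF fdQ] by (simp add: car_Q)

lemma D_line1:
  "D \<eta> (\<eta> + smul Q t \<zeta>) v = D \<eta> \<eta> v + smul Q t (- Rm \<zeta> v)"
  by (auto simp: D_def Rm_def smul_Q fun_eq_iff fd_smul[OF sN])

lemma Lm_line:
  assumes "v \<in> car P" "\<eta> \<in> lin W H" "\<zeta> \<in> lin W H"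
  shows "Lm (\<eta> + smul Q t \<zeta>) v = Lm \<eta> v + smul Q t (Lm \<zeta> v)"
  using P_fst[OF assms(1)] Q_val[OF assms(2)] Q_val[OF assms(3)]
  by (simp add: Lm_def smul_Q fun_eq_iff fd_car[OF sN])

lemma D_line2:
  assumes "v \<in> car P" "\<eta> \<in> lin W H" "\<zeta> \<in> lin W H"
  shows "D (\<eta> + smul Q t \<zeta>) \<eta> v = D \<eta> \<eta> v + smul Q t (Lm \<zeta> v)"
  by (simp add: D_def Lm_line[OF assms])

lemma D_line:
  assumes "v \<in> car P" "\<eta> \<in> lin W H" "\<zeta> \<in> lin W H"
  shows "D (\<eta> + smul Q t \<zeta>) (\<eta> + smul Q t \<zeta>) v = D \<eta> \<eta> v + smul Q t (Lm \<zeta> v - Rm \<zeta> v)"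
  by (auto simp: D_def Lm_line[OF assms]) (auto simp: Rm_def smul_Q fun_eq_iff fd_smul[OF sN])

text \<open>If \<open>\<eta>\<close> has only scalar endomorphisms, its orbit has dimension \<open>vdim P - 1\<close>, hence at most the
  dimension of \<open>Q\<close>; and if the inequality is strict, some direction is transversal to the orbit.\<close>

lemma scalar_endos_dimension:
  assumes n: "nonzero N" and \<eta>: "\<eta> \<in> lin W H" and s: "scalar_endos B N W \<eta>"
  shows "vdim P \<le> Suc (vdim Q)"
    "vdim P < Suc (vdim Q) \<Longrightarrow> \<exists>\<zeta>\<in>lin W H. \<forall>v\<in>car P. D \<eta> \<eta> v \<noteq> \<zeta>"
proof -
  obtain C where C: "C \<subseteq> car P" "fd_space (P\<lparr>car := C\<rparr>)" "Suc (vdim (P\<lparr>car := C\<rparr>)) = vdim P"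
    "\<And>a. smul P a one \<in> C \<Longrightarrow> a = 0" "\<And>v. v \<in> car P \<Longrightarrow> \<exists>a. v - smul P a one \<in> C"
    using ex_hyperplane_complement[OF fdP one_car one_nonzero[OF n]] by metis
  note lin = linear_D[OF \<eta> \<eta>]
  have linC: "linear_on (P\<lparr>car := C\<rparr>) Q (D \<eta> \<eta>)"
    by (rule linear_on_restrict[OF lin C(1)])
  have inj: "v = 0" if "v \<in> car (P\<lparr>car := C\<rparr>)" "D \<eta> \<eta> v = 0" for v
  proof -
    have v: "v \<in> C" "D \<eta> \<eta> v = 0" using that by simp_all
    then obtain r where "v = smul P r one" using C(1) s scalar_endos_iff[OF \<eta>] by blast
    moreover from this have "r = 0" using C(4) v(1) by simp
    ultimately show ?thesis by (simp add: fd_smul[OF fdP])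
  qed
  show "vdim P \<le> Suc (vdim Q)" using vdim_le_of_inj[OF C(2) fdQ linC inj] C(3) by simp
  assume lt: "vdim P < Suc (vdim Q)"
  show "\<exists>\<zeta>\<in>lin W H. \<forall>v\<in>car P. D \<eta> \<eta> v \<noteq> \<zeta>"
  proof (rule ccontr)
    assume "\<not> ?thesis"
    then have onto: "\<exists>v\<in>car P. D \<eta> \<eta> v = \<zeta>" if "\<zeta> \<in> lin W H" for \<zeta> using that by blast
    have "D \<eta> \<eta> ` C = car Q"
    proof
      show "D \<eta> \<eta> ` C \<subseteq> car Q" using linear_onD(1)[OF linC] by auto
      show "car Q \<subseteq> D \<eta> \<eta> ` C"
      proof
        fix \<zeta> assume "\<zeta> \<in> car Q"
        then have "\<zeta> \<in> lin W H" by (simp only: car_Q)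
        then obtain v where v: "v \<in> car P" "D \<eta> \<eta> v = \<zeta>" using onto by blast
        obtain a where a: "v - smul P a one \<in> C" using C(5)[OF v(1)] by blast
        have "D \<eta> \<eta> (v - smul P a one) = \<zeta>"
          using linear_on_diff[OF lin fdP v(1), of "smul P a one"] v(2)
          by (simp add: D_one[OF \<eta>] fd_car[OF fdP] one_car)
        then show "\<zeta> \<in> D \<eta> \<eta> ` C" using a by blast
      qed
    qed
    then have "bij_betw (D \<eta> \<eta>) (car (P\<lparr>car := C\<rparr>)) (car Q)"
      using inj_on_linear[OF linC C(2) inj] by (simp add: bij_betw_def)
    from vdim_bij[OF C(2) fdQ linC this] show False using lt C(3) by simp
  qed
qed

text \<open>The critical case. For every \<open>t\<close> there are, by dimension, nonzero morphisms between
  \<open>\<eta>\<close> and \<open>\<eta> + t \<zeta>\<close> in both directions. By the pencil lemma they can be chosen polynomially in \<open>t\<close>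
  and nonzero at \<open>t = 0\<close>, where they are nonzero scalars. The composition is an endomorphism of \<open>\<eta>\<close>,
  that is a scalar \<open>c(t)\<close>; it is polynomial in \<open>t\<close> and \<open>c(0) \<noteq> 0\<close>, so it vanishes only
  finitely often.\<close>

lemma critical_line_iso:
  assumes inf: "infinite (UNIV :: 'k set)" and n: "nonzero N"
    and \<eta>: "\<eta> \<in> lin W H" and \<zeta>: "\<zeta> \<in> lin W H" and s: "scalar_endos B N W \<eta>"
    and d: "vdim P = Suc (vdim Q)"
  shows "finite {t. \<not> trip_iso B N W \<eta> N W (\<eta> + smul Q t \<zeta>)}"
proof -
  have T1: "linear_on P Q (\<lambda>v. - Rm \<zeta> v)" by (rule linear_on_uminus[OF linear_Rm[OF \<zeta>] fdQ])
  note T0 = linear_D[OF \<eta> \<eta>] and T2 = linear_Lm[OF \<zeta>]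
  have all: "{t. \<exists>v\<in>car P. v \<noteq> 0 \<and> D \<eta> \<eta> v + smul Q t (- Rm \<zeta> v) = 0} = UNIV"
    using linear_kernel_nonzero[OF fdP fdQ linear_D[OF \<eta> line_car[OF \<eta> \<zeta>]]] d
    by (auto simp: D_line1[symmetric])
  have all': "{t. \<exists>v\<in>car P. v \<noteq> 0 \<and> D \<eta> \<eta> v + smul Q t (Lm \<zeta> v) = 0} = UNIV"
  proof -
    have "\<exists>v\<in>car P. v \<noteq> 0 \<and> D \<eta> \<eta> v + smul Q t (Lm \<zeta> v) = 0" for t
      using linear_kernel_nonzero[OF fdP fdQ linear_D[OF line_car[OF \<eta> \<zeta>, of t] \<eta>]] d
      by (auto simp: D_line2[OF _ \<eta> \<zeta>])
    then show ?thesis by blast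
  qed
  obtain x m where x: "\<And>i. x i \<in> car P" "\<And>i. i > m \<Longrightarrow> x i = 0" "x 0 \<noteq> 0" "D \<eta> \<eta> (x 0) = 0"
    "\<And>i. D \<eta> \<eta> (x (Suc i)) + - Rm \<zeta> (x i) = 0"
    by (rule singular_pencil_chain[OF fdP fdQ T0 T1 inf[folded all]]) (rule that)
  obtain y n where y: "\<And>i. y i \<in> car P" "\<And>i. i > n \<Longrightarrow> y i = 0" "y 0 \<noteq> 0" "D \<eta> \<eta> (y 0) = 0"
    "\<And>i. D \<eta> \<eta> (y (Suc i)) + Lm \<zeta> (y i) = 0"
    by (rule singular_pencil_chain[OF fdP fdQ T0 T2 inf[folded all']]) (rule that)
  define X where "X t = (\<Sum>i\<le>Suc m. smul P (t ^ i) (x i))" for t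
  define Y where "Y t = (\<Sum>i\<le>Suc n. smul P (t ^ i) (y i))" for t
  have XP: "X t \<in> car P" and YP: "Y t \<in> car P" for t
    unfolding X_def Y_def using x(1) y(1) by (auto intro!: fd_car[OF fdP])
  have X: "X t \<in> trip_hom B N W \<eta> N W (\<eta> + smul Q t \<zeta>)" for t
  proof -
    have "D \<eta> \<eta> (X t) + smul Q t (- Rm \<zeta> (X t)) = 0"
      unfolding X_def by (rule chain_eval[OF fdP fdQ T0 T1 x(1,2,4,5)])
    then show ?thesis using D_ker[OF XP \<eta> line_car[OF \<eta> \<zeta>]] by (simp add: D_line1)
  qed
  have Y: "Y t \<in> trip_hom B N W (\<eta> + smul Q t \<zeta>) N W \<eta>" for t
  proof -
    have "D \<eta> \<eta> (Y t) + smul Q t (Lm \<zeta> (Y t)) = 0"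
      unfolding Y_def by (rule chain_eval[OF fdP fdQ T0 T2 y(1,2,4,5)])
    then show ?thesis using D_ker[OF YP line_car[OF \<eta> \<zeta>] \<eta>] by (simp add: D_line2[OF YP \<eta> \<zeta>])
  qed
  have "\<exists>c. fst (Y t) \<circ> fst (X t) = homothety N c \<and> snd (Y t) \<circ> snd (X t) = homothety W c" for t
  proof -
    have "(fst (Y t) \<circ> fst (X t), snd (Y t) \<circ> snd (X t)) \<in> trip_hom B N W \<eta> N W \<eta>"
      using trip_hom_comp[OF _ _ sN W] X[of t] Y[of t] by (metis prod.collapse)
    then show ?thesis using s by (auto simp: scalar_endos_def)
  qed
  then obtain c where c: "\<And>t. fst (Y t) \<circ> fst (X t) = homothety N (c t)"
    "\<And>t. snd (Y t) \<circ> snd (X t) = homothety W (c t)" by metis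
  \<comment> \<open>To see that \<open>c\<close> is a polynomial, evaluate the composition at \<open>u\<close> and apply a functional.\<close>
  obtain u where u: "u \<in> car N" "u \<noteq> 0" using n fd_car(1)[OF sN] by (auto simp: nonzero_def)
  obtain \<kappa> where \<kappa>: "\<And>x y. x \<in> car N \<Longrightarrow> y \<in> car N \<Longrightarrow> \<kappa> (x + y) = \<kappa> x + \<kappa> y"
     "\<And>r x. x \<in> car N \<Longrightarrow> \<kappa> (smul N r x) = r * \<kappa> x" "\<kappa> u \<noteq> (0::'k)"
    by (rule ex_functional_nonzero[OF sN u]) (rule that)
  have \<kappa>0: "\<kappa> 0 = 0" using \<kappa>(2)[OF fd_car(1)[OF sN], of 0] by (simp add: fd_smul[OF sN])
  have \<kappa>sum: "\<kappa> (\<Sum>i\<in>I. f i) = (\<Sum>i\<in>I. \<kappa> (f i))" if "\<And>i. f i \<in> car N" for f and I :: "nat set"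
    by (induction I rule: infinite_finite_induct) (simp_all add: \<kappa>0 \<kappa>(1) that fd_car[OF sN])
  have sum_fst: "fst (\<Sum>i\<in>I. smul P (a i) (z i)) v = (\<Sum>i\<in>I. smul N (a i) (fst (z i) v))"
    for I :: "nat set" and a z v
    by (induction I rule: infinite_finite_induct) (simp_all add: smul_P)
  define a where "a j i = \<kappa> (fst (y j) (fst (x i) u))" for j i
  define p where "p = (\<Sum>j\<le>Suc n. \<Sum>i\<le>Suc m. monom (a j i) (j + i))"
  have val: "\<kappa> (fst (Y t) (fst (X t) u)) = poly p t" for t
  proof -
    have xi: "fst (x i) u \<in> car N" for i by (rule P_fst(1)[OF x(1) u(1)])
    have Xu: "fst (X t) u \<in> car N" by (rule P_fst(1)[OF XP u(1)])
    have yx: "fst (y j) (fst (x i) u) \<in> car N" for i j by (rule P_fst(1)[OF y(1) xi])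
    have lin: "linear_on N N (fst (y j))" for j using y(1)[of j] by (auto simp: car_P hom_linear_on)
    have "fst (y j) (fst (X t) u) = (\<Sum>i\<le>Suc m. smul N (t ^ i) (fst (y j) (fst (x i) u)))" for j
      unfolding X_def sum_fst by (rule linear_on_comb[OF lin sN xi])
    then have "\<kappa> (fst (y j) (fst (X t) u)) = (\<Sum>i\<le>Suc m. t ^ i * a j i)" for j
      using \<kappa>sum[of "\<lambda>i. smul N (t ^ i) (fst (y j) (fst (x i) u))"] yx
      by (simp only: fd_car(3)[OF sN] \<kappa>(2) a_def)
    moreover have "\<kappa> (fst (Y t) (fst (X t) u)) = (\<Sum>j\<le>Suc n. t ^ j * \<kappa> (fst (y j) (fst (X t) u)))"
      unfolding Y_def sum_fst
      using \<kappa>sum[of "\<lambda>j. smul N (t ^ j) (fst (y j) (fst (X t) u))"] P_fst(1)[OF y(1) Xu]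
      by (simp only: fd_car(3)[OF sN] \<kappa>(2))
    ultimately show ?thesis
      by (simp only: p_def poly_sum poly_monom sum_distrib_left) (simp add: power_add mult_ac)
  qed
  have cp: "c t * \<kappa> u = poly p t" for t
    using val[of t] fun_cong[OF c(1)[of t], of u] u by (simp add: homothety_def \<kappa>(2))
  have ev0: "(\<Sum>i\<le>Suc l. smul P (0 ^ i) (z i)) = z 0" for z :: "nat \<Rightarrow> ('v \<Rightarrow> 'v) \<times> ('w \<Rightarrow> 'w)" and l
    by (subst sum.atMost_shift) (simp add: fd_smul[OF fdP])
  obtain r r' where r: "x 0 = smul P r one" "y 0 = smul P r' one"
    using s scalar_endos_iff[OF \<eta>] x(1,4) y(1,4) by metis
  have "r \<noteq> 0" "r' \<noteq> 0" using r x(3) y(3) by (auto simp: fd_smul[OF fdP])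
  moreover have "poly p 0 = r' * (r * \<kappa> u)"
    using val[of 0] u unfolding X_def Y_def ev0 r scale_one
    by (simp add: homothety_def fd_car[OF sN] \<kappa>(2))
  ultimately have "poly p 0 \<noteq> 0" using \<kappa>(3) by simp
  then have fin: "finite {t. poly p t = 0}" by (intro poly_roots_finite) auto
  have "trip_iso B N W \<eta> N W (\<eta> + smul Q t \<zeta>)" if t: "poly p t \<noteq> 0" for t
  proof -
    have ct: "c t \<noteq> 0" using cp[of t] t by auto
    have "bij_betw (fst (X t)) (car N) (car N)"
      using XP[of t] YP[of t] fun_cong[OF c(1)[of t]] ct
      by (intro bij_endo(1)[OF sN, of _ "fst (Y t)" "c t"])
        (auto simp: car_P hom_linear_on homothety_def)
    moreover have "bij_betw (snd (X t)) (car W) (car W)"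
      using XP[of t] YP[of t] fun_cong[OF c(2)[of t]] ct
      by (intro bij_endo(1)[OF W, of _ "snd (Y t)" "c t"])
        (auto simp: car_P lin_linear_on homothety_def)
    ultimately show ?thesis unfolding trip_iso_def using X[of t] by (intro bexI[of _ "X t"]) auto
  qed
  then have "{t. \<not> trip_iso B N W \<eta> N W (\<eta> + smul Q t \<zeta>)} \<subseteq> {t. poly p t = 0}" by blast
  then show ?thesis using fin finite_subset by blast
qed

text \<open>Two points with scalar endomorphisms are both isomorphic to almost every point of the line
  through them.\<close>

lemma critical_unique:
  assumes inf: "infinite (UNIV :: 'k set)" and n: "nonzero N"
    and \<eta>: "\<eta> \<in> lin W H" "scalar_endos B N W \<eta>" and \<eta>': "\<eta>' \<in> lin W H" "scalar_endos B N W \<eta>'"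
    and d: "vdim P = Suc (vdim Q)"
  shows "trip_iso B N W \<eta> N W \<eta>'"
proof -
  define \<zeta> where "\<zeta> = \<eta>' - \<eta>"
  have \<zeta>: "\<zeta> \<in> lin W H" unfolding \<zeta>_def using fd_car(5)[OF fdQ] \<eta> \<eta>' by (simp add: car_Q)
  have f1: "finite {t. \<not> trip_iso B N W \<eta> N W (\<eta> + smul Q t \<zeta>)}"
    by (rule critical_line_iso[OF inf n \<eta>(1) \<zeta> \<eta>(2) d])
  have f2: "finite ((\<lambda>t. t + 1) ` {t. \<not> trip_iso B N W \<eta>' N W (\<eta>' + smul Q t \<zeta>)})"
    by (intro finite_imageI critical_line_iso[OF inf n \<eta>'(1) \<zeta> \<eta>'(2) d])
  obtain t where t: "trip_iso B N W \<eta> N W (\<eta> + smul Q t \<zeta>)"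
    "t \<notin> (\<lambda>t. t + 1) ` {t. \<not> trip_iso B N W \<eta>' N W (\<eta>' + smul Q t \<zeta>)}"
    using ex_new_if_finite[OF inf finite_UnI[OF f1 f2]] by blast
  have "\<eta>' + smul Q (t - 1) \<zeta> = \<eta> + smul Q t \<zeta>"
    by (simp add: fd_smul[OF fdQ] \<zeta>_def)
  moreover have "trip_iso B N W \<eta>' N W (\<eta>' + smul Q (t - 1) \<zeta>)"
  proof (rule ccontr)
    assume "\<not> ?thesis"
    then have "(t - 1) + 1 \<in> (\<lambda>t. t + 1) ` {t. \<not> trip_iso B N W \<eta>' N W (\<eta>' + smul Q t \<zeta>)}" by blast
    then show False using t(2) by simp
  qed
  ultimately have "trip_iso B N W \<eta>' N W (\<eta> + smul Q t \<zeta>)" by simp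
  then have "trip_iso B N W (\<eta> + smul Q t \<zeta>) N W \<eta>'"
    using trip_iso_sym trip[OF \<eta>'(1)] trip[OF line_car[OF \<eta>(1) \<zeta>]] by blast
  then show ?thesis using trip_iso_trans[OF t(1) _ sN W] by blast
qed

text \<open>The non-critical case. Take a direction \<open>\<zeta>\<close> transversal to the orbit of \<open>\<eta>\<close>. Having scalar
  endomorphisms and being transversal to \<open>\<zeta>\<close> are open conditions, so they hold at almost all points
  of the line through \<open>\<eta>\<close>. At such a point \<open>\<sigma>\<close>, infinitely many nonzero morphisms to points
  of the line would by the pencil lemma give a chain starting with a nonzero scalar, whose
  first-order term exhibits \<open>\<zeta>\<close> as tangent to the orbit of \<open>\<sigma>\<close>.\<close>

lemma noncritical_infinite:
  assumes inf: "infinite (UNIV :: 'k set)" and n: "nonzero N"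
    and \<eta>: "\<eta> \<in> lin W H" and s: "scalar_endos B N W \<eta>" and d: "vdim P < Suc (vdim Q)"
  obtains F :: "'k \<Rightarrow> 'w \<Rightarrow> 'e \<Rightarrow> 'v" and G where "infinite G" "\<And>t. t \<in> G \<Longrightarrow> F t \<in> lin W H"
    "\<And>t. t \<in> G \<Longrightarrow> scalar_endos B N W (F t)"
    "\<And>t. t \<in> G \<Longrightarrow> finite {t'. trip_iso B N W (F t) N W (F t')}"
proof -
  obtain \<zeta> where \<zeta>: "\<zeta> \<in> lin W H" "\<And>v. v \<in> car P \<Longrightarrow> D \<eta> \<eta> v \<noteq> \<zeta>"
    using scalar_endos_dimension(2)[OF n \<eta> s d] by blast
  define F where "F t = \<eta> + smul Q t \<zeta>" for t
  have F: "F t \<in> lin W H" for t unfolding F_def by (rule line_car[OF \<eta> \<zeta>(1)])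
  define G where "G = {t. scalar_endos B N W (F t) \<and> (\<forall>v\<in>car P. D (F t) (F t) v \<noteq> \<zeta>)}"
  obtain C where C: "C \<subseteq> car P" "fd_space (P\<lparr>car := C\<rparr>)"
    "\<And>a. smul P a one \<in> C \<Longrightarrow> a = 0" "\<And>v. v \<in> car P \<Longrightarrow> \<exists>a. v - smul P a one \<in> C"
    using ex_hyperplane_complement[OF fdP one_car one_nonzero[OF n]] by metis
  \<comment> \<open>A pair \<open>(v, a)\<close> in the kernel of \<open>S0 + t S1\<close> satisfies \<open>D (F t) (F t) v = a \<zeta>\<close>. Restricting \<open>v\<close> to the
    complement \<open>C\<close> of the scalars makes this kernel zero at \<open>t = 0\<close> and nonzero for \<open>t\<close> outside \<open>G\<close>.\<close>
  define K :: "('k, 'k) space" where "K = \<lparr>car = UNIV, smul = (*)\<rparr>"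
  have vsK: "vector_space (smul K)" unfolding K_def by unfold_locales (auto simp: algebra_simps)
  have subK: "module.subspace (smul K) (car K)"
  proof -
    interpret K: vector_space "smul K" by (rule vsK)
    show ?thesis unfolding K.subspace_def by (simp add: K_def)
  qed
  have "basis_fam K {()} (\<lambda>_. 1)" by (auto simp: basis_fam_def K_def)
  then have fdK: "fd_space K"
    by (rule basis_fam_vdim(1)[OF vsK subK])
  let ?U = "prod_space (P\<lparr>car := C\<rparr>) K"
  have fdU: "fd_space ?U" by (rule fd_prod_space(1)[OF C(2) fdK])
  define S0 where "S0 u = D \<eta> \<eta> (fst u) - smul Q (snd u) \<zeta>" for u
  define S1 where "S1 u = Lm \<zeta> (fst u) - Rm \<zeta> (fst u)" for u :: "(('v \<Rightarrow> 'v) \<times> ('w \<Rightarrow> 'w)) \<times> 'k"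
  have carU: "u \<in> car ?U \<longleftrightarrow> fst u \<in> C" for u by (cases u) (simp add: prod_space_def K_def)
  have smulU: "smul ?U r u = (smul P r (fst u), r * snd u)" for r u
    by (cases u) (simp add: prod_space_def K_def)
  have linfst: "linear_on ?U P fst"
    unfolding linear_on_def smulU
    by (intro conjI ballI allI) (use C(1) carU in blast, simp, simp)
  have linS0: "linear_on ?U Q S0"
  proof -
    have "linear_on ?U Q (\<lambda>u. smul Q (snd u) \<zeta>)"
      unfolding linear_on_def smulU using \<zeta>(1) fd_car(3)[OF fdQ] by (simp add: fd_smul[OF fdQ] car_Q)
    then show ?thesis
      unfolding S0_def by (rule linear_on_minus[OF linear_on_compose[OF linfst linear_D[OF \<eta> \<eta>]] _ fdQ])
  qed
  have linS1: "linear_on ?U Q S1"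
    unfolding S1_def
    by (rule linear_on_compose[OF linfst linear_on_minus[OF linear_Lm[OF \<zeta>(1)] linear_Rm[OF \<zeta>(1)] fdQ]])
  have injS0: "u = 0" if u: "u \<in> car ?U" "S0 u = 0" for u
  proof -
    have uC: "fst u \<in> C" and uP: "fst u \<in> car P" using u(1) C(1) by (auto simp: carU)
    have eq: "D \<eta> \<eta> (fst u) = smul Q (snd u) \<zeta>" using u(2) by (simp add: S0_def)
    have "snd u = 0"
    proof (rule ccontr)
      assume c: "snd u \<noteq> 0"
      have "D \<eta> \<eta> (smul P (inverse (snd u)) (fst u)) = smul Q (inverse (snd u)) (smul Q (snd u) \<zeta>)"
        unfolding eq[symmetric] by (rule linear_onD(3)[OF linear_D[OF \<eta> \<eta>] uP])
      also have "\<dots> = \<zeta>" using c by (simp add: fd_smul[OF fdQ])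
      finally show False using \<zeta>(2) fd_car(3)[OF fdP uP] by blast
    qed
    moreover from this have "D \<eta> \<eta> (fst u) = 0" using eq by (simp add: fd_smul[OF fdQ])
    then obtain r where r: "fst u = smul P r one" using s scalar_endos_iff[OF \<eta>] uP by blast
    then have "r = 0" using C(3) uC by simp
    then have "fst u = 0" using r by (simp add: fd_smul[OF fdP])
    ultimately show ?thesis by (simp add: prod_eq_iff)
  qed
  have fin: "finite {t. \<exists>u\<in>car ?U. u \<noteq> 0 \<and> S0 u + smul Q t (S1 u) = 0}"
    by (rule finite_singular_pencil[OF fdU fdQ linS0 linS1 injS0])
  have S: "S0 u + smul Q t (S1 u) = D (F t) (F t) (fst u) - smul Q (snd u) \<zeta>"
    if "fst u \<in> car P" for u t
    using D_line[OF that \<eta> \<zeta>(1), of t] by (simp add: S0_def S1_def F_def)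
  have "- G \<subseteq> {t. \<exists>u\<in>car ?U. u \<noteq> 0 \<and> S0 u + smul Q t (S1 u) = 0}"
  proof clarify
    fix t assume t: "t \<notin> G"
    have sub: "D (F t) (F t) (v - smul P a one) = D (F t) (F t) v" if "v \<in> car P" for v a
      using linear_on_diff[OF linear_D[OF F F] fdP that, of "smul P a one"]
      by (simp add: D_one[OF F] fd_car[OF fdP] one_car)
    consider v where "v \<in> car P" "D (F t) (F t) v = 0" "\<And>r. v \<noteq> smul P r one"
      | v where "v \<in> car P" "D (F t) (F t) v = \<zeta>"
      using t scalar_endos_iff[OF F] unfolding G_def by blast
    then show "\<exists>u\<in>car ?U. u \<noteq> 0 \<and> S0 u + smul Q t (S1 u) = 0"
    proof cases
      case 1
      obtain a where a: "v - smul P a one \<in> C" using C(4)[OF 1(1)] by blast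
      show ?thesis
      proof (intro bexI[of _ "(v - smul P a one, 0)"] conjI)
        show "(v - smul P a one, 0) \<noteq> 0" using 1(3)[of a] by (metis eq_iff_diff_eq_0 fst_conv fst_zero)
      qed (use a C(1) 1 in \<open>auto simp: S carU sub fd_smul[OF fdQ]\<close>)
    next
      case 2
      obtain a where a: "v - smul P a one \<in> C" using C(4)[OF 2(1)] by blast
      show ?thesis
        using a C(1) 2 by (intro bexI[of _ "(v - smul P a one, 1)"])
          (auto simp: S carU sub fd_smul[OF fdQ] zero_prod_def)
    qed
  qed
  then have finG: "finite (- G)" using fin finite_subset by blast
  have infG: "infinite G"
    using inf finG finite_UnI[of G "- G"] by (metis Compl_partition)
  have "finite {t'. trip_iso B N W (F t) N W (F t')}" if t: "t \<in> G" for t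
  proof (rule ccontr)
    assume i: "\<not> ?thesis"
    \<comment> \<open>An isomorphism from \<open>F t\<close> to \<open>F (t + r)\<close> is in the kernel of the pencil in \<open>r\<close> based at \<open>F t\<close>.\<close>
    define A where "A = {r. \<exists>v\<in>car P. v \<noteq> 0 \<and> D (F t) (F t) v + smul Q r (- Rm \<zeta> v) = 0}"
    have "{t'. trip_iso B N W (F t) N W (F t')} \<subseteq> (\<lambda>r. t + r) ` A"
    proof
      fix t' assume "t' \<in> {t'. trip_iso B N W (F t) N W (F t')}"
      then obtain v where v: "v \<in> trip_hom B N W (F t) N W (F t')" "bij_betw (fst v) (car N) (car N)"
        unfolding trip_iso_def by auto
      have vP: "v \<in> car P" by (rule trip_hom_car[OF v(1)])
      have F': "F t' = F t + smul Q (t' - t) \<zeta>"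
        by (simp add: F_def fd_smul[OF fdQ])
      have "D (F t) (F t') v = 0" using v(1) D_ker[OF vP F F] by simp
      then have "D (F t) (F t) v + smul Q (t' - t) (- Rm \<zeta> v) = 0"
        unfolding F' D_line1 .
      moreover have "v \<noteq> 0"
      proof
        assume "v = 0"
        then have "\<forall>x\<in>car N. fst v x = 0" by simp
        moreover obtain u where "u \<in> car N" "u \<noteq> 0" using n fd_car(1)[OF sN] by (auto simp: nonzero_def)
        ultimately show False
          using v(2) fd_car(1)[OF sN] by (auto simp: bij_betw_def dest: inj_onD)
      qed
      ultimately have "t' - t \<in> A" using vP by (auto simp: A_def)
      then show "t' \<in> (\<lambda>r. t + r) ` A" by (intro image_eqI[of _ _ "t' - t"]) simp_all
    qed
    then have infA: "infinite A" using i finite_subset by blast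
    obtain x :: "nat \<Rightarrow> ('v \<Rightarrow> 'v) \<times> ('w \<Rightarrow> 'w)" where x: "\<And>i. x i \<in> car P" "x 0 \<noteq> 0"
      "D (F t) (F t) (x 0) = 0" "D (F t) (F t) (x (Suc 0)) + - Rm \<zeta> (x 0) = 0"
      by (rule singular_pencil_chain[OF fdP fdQ linear_D[OF F F] linear_on_uminus[OF linear_Rm[OF \<zeta>(1)] fdQ]
            infA[unfolded A_def]]) blast
    obtain r where r: "x 0 = smul P r one"
      using t x(1,3) scalar_endos_iff[OF F] unfolding G_def by blast
    have r0: "r \<noteq> 0" using r x(2) by (auto simp: fd_smul[OF fdP])
    have "Rm \<zeta> (x 0) = smul Q r \<zeta>"
    proof
      fix w
      show "Rm \<zeta> (x 0) w = smul Q r \<zeta> w"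
        using Q_lin(2)[OF \<zeta>(1)] Q_lin(3,4)[OF \<zeta>(1)]
        by (cases "w \<in> car W") (auto simp: r scale_one Rm_def homothety_def smul_Q fd_smul[OF sN] fun_eq_iff)
    qed
    then have eq: "D (F t) (F t) (x (Suc 0)) = smul Q r \<zeta>" using x(4) by simp
    have "D (F t) (F t) (smul P (inverse r) (x (Suc 0))) = smul Q (inverse r) (smul Q r \<zeta>)"
      unfolding eq[symmetric] by (rule linear_onD(3)[OF linear_D[OF F F] x(1)])
    also have "\<dots> = \<zeta>" using r0 by (simp add: fd_smul[OF fdQ])
    finally show False using t fd_car(3)[OF fdP x(1)] unfolding G_def by blast
  qed
  then show thesis using that[of G F] infG F unfolding G_def by blast
qed

end

section \<open>Decomposing modules\<close>

text \<open>Indices of a basis of \<open>nmod Xs m\<close>: the summand, the copy of it, and the basis vector.\<close>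

definition nmod_index :: "('k::field, 'b) cmodule list \<Rightarrow> nat list \<Rightarrow> (nat \<times> nat \<times> nat) set" where
  "nmod_index Xs m = (SIGMA i:{..<length Xs}. {..<m ! i} \<times> {..<vdim (Xs ! i)})"

lemma nmod_simps:
  "u \<in> car (nmod Xs m) \<longleftrightarrow>
     (\<forall>i j. if i < length Xs \<and> j < m ! i then u (i, j) \<in> car (Xs ! i) else u (i, j) = 0)"
  "smul (nmod Xs m) r u (i, j) =
     (if i < length Xs then smul (Xs ! i) r (u (i, j)) else (\<lambda>n. r * u (i, j) n))"
  "act (nmod Xs m) u b (i, j) = (if i < length Xs \<and> j < m ! i then act (Xs ! i) (u (i, j)) b else 0)"
  by (simp_all add: nmod_def)

lemma nmod_fd:
  fixes Xs :: "('k::field, 'b) cmodule list"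
  assumes Xs: "\<And>i. i < length Xs \<Longrightarrow> fd_space (Xs ! i)"
  shows "fd_space (nmod Xs m)" "vdim (nmod Xs m) = (\<Sum>i<length Xs. m ! i * vdim (Xs ! i))"
proof -
  let ?M = "nmod Xs m" and ?I = "nmod_index Xs m"
  have vs: "vector_space (smul ?M)"
    by unfold_locales (auto simp: fun_eq_iff nmod_simps fd_smul[OF Xs] algebra_simps)
  have sub: "module.subspace (smul ?M) (car ?M)"
  proof -
    interpret M: vector_space "smul ?M" by (rule vs)
    show ?thesis
      unfolding M.subspace_def by (auto simp: nmod_simps fd_car[OF Xs] fd_smul[OF Xs])
  qed
  have "\<exists>b. basis_fam (Xs ! i) {..<vdim (Xs ! i)} b" if "i < length Xs" for i
    using ex_basis_fam[OF Xs[OF that]] .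
  then obtain \<beta> where \<beta>: "\<And>i. i < length Xs \<Longrightarrow> basis_fam (Xs ! i) {..<vdim (Xs ! i)} (\<beta> i)" by metis
  define b where "b = (\<lambda>(i, j :: nat, a) p. if p = (i, j) then \<beta> i a else 0)"
  have fin: "finite ?I" by (simp add: nmod_index_def)
  have val: "(\<Sum>q\<in>?I. smul ?M (c q) (b q)) (i, j)
      = (if i < length Xs \<and> j < m ! i then (\<Sum>a<vdim (Xs ! i). smul (Xs ! i) (c (i, j, a)) (\<beta> i a)) else 0)"
    for c i j
  proof (cases "i < length Xs \<and> j < m ! i")
    case True
    have "(\<Sum>q\<in>?I. smul ?M (c q) (b q)) (i, j) = (\<Sum>q\<in>?I. smul (Xs ! i) (c q) (b q (i, j)))"
      using True by (simp add: sum_fun_apply nmod_simps)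
    also have "\<dots> = (\<Sum>q\<in>(\<lambda>a. (i, j, a)) ` {..<vdim (Xs ! i)}. smul (Xs ! i) (c q) (b q (i, j)))"
      using True fin
      by (intro sum.mono_neutral_right) (auto simp: nmod_index_def b_def fd_smul[OF Xs] image_iff split: if_splits)
    also have "\<dots> = (\<Sum>a<vdim (Xs ! i). smul (Xs ! i) (c (i, j, a)) (\<beta> i a))"
      by (subst sum.reindex) (auto simp: inj_on_def b_def)
    finally show ?thesis using True by simp
  next
    case False
    have "(\<Sum>q\<in>?I. smul ?M (c q) (b q)) (i, j) = (\<Sum>q\<in>?I. smul ?M (c q) (b q) (i, j))"
      by (rule sum_fun_apply)
    also have "\<dots> = 0"
    proof (intro sum.neutral ballI)
      fix q assume "q \<in> ?I"
      then have "b q (i, j) = 0" using False by (auto simp: nmod_index_def b_def)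
      then show "smul ?M (c q) (b q) (i, j) = 0" by (auto simp: nmod_simps fd_smul[OF Xs])
    qed
    finally show ?thesis unfolding if_not_P[OF False] .
  qed
  have "basis_fam ?M ?I b"
    unfolding basis_fam_def
  proof (intro conjI ballI allI impI)
    show "b q \<in> car ?M" if "q \<in> ?I" for q
      using that basis_famD(2)[OF \<beta>] by (auto simp: nmod_index_def b_def nmod_simps fd_car[OF Xs])
    show "\<exists>c. u = (\<Sum>q\<in>?I. smul ?M (c q) (b q))" if u: "u \<in> car ?M" for u
    proof -
      have "\<exists>c. u (i, j) = (\<Sum>a<vdim (Xs ! i). smul (Xs ! i) (c a) (\<beta> i a))"
        if "i < length Xs" "j < m ! i" for i j
        using u that by (intro basis_famD(3)[OF \<beta>]) (auto simp: nmod_simps split: if_splits)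
      note ex = this
      define c where "c i j = (SOME c. u (i, j) = (\<Sum>a<vdim (Xs ! i). smul (Xs ! i) (c a) (\<beta> i a)))" for i j
      have c: "u (i, j) = (\<Sum>a<vdim (Xs ! i). smul (Xs ! i) (c i j a) (\<beta> i a))"
        if "i < length Xs" "j < m ! i" for i j
        unfolding c_def by (rule someI_ex[OF ex[OF that]])
      show ?thesis
      proof (rule exI, rule ext)
        fix p :: "nat \<times> nat"
        obtain i j where p: "p = (i, j)" by (cases p)
        show "u p = (\<Sum>q\<in>?I. smul ?M ((\<lambda>(i, j, a). c i j a) q) (b q)) p"
        proof (cases "i < length Xs \<and> j < m ! i")
          case True
          then show ?thesis unfolding p val if_P[OF True] using c[of i j] by simp
        next
          case False
          then show ?thesis
            unfolding p val if_not_P[OF False] using u[unfolded nmod_simps, rule_format, of i j] by auto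
        qed
      qed
    qed
    fix c q assume h: "(\<Sum>q\<in>?I. smul ?M (c q) (b q)) = 0" "q \<in> ?I"
    then obtain i j a where q: "q = (i, j, a)" "i < length Xs" "j < m ! i" "a < vdim (Xs ! i)"
      by (auto simp: nmod_index_def)
    have "(\<Sum>a<vdim (Xs ! i). smul (Xs ! i) (c (i, j, a)) (\<beta> i a)) = 0"
      using val[of c i j] h(1) q by simp
    then show "c q = 0" using basis_famD(4)[OF \<beta>[OF q(2)], of "\<lambda>a. c (i, j, a)" a] q by simp
  qed (rule fin)
  from basis_fam_vdim[OF vs sub this]
  show "fd_space ?M" "vdim ?M = (\<Sum>i<length Xs. m ! i * vdim (Xs ! i))"
    by (simp_all add: nmod_index_def)
qed

lemma nmod_fd_module:
  fixes Xs :: "('k::field, 'b::ab_group_add) cmodule list"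
  assumes Xs: "\<And>i. i < length Xs \<Longrightarrow> fd_module B (Xs ! i)"
  shows "fd_module B (nmod Xs m)"
proof -
  note fs = fd_module_space[OF Xs]
  have v: "u (i, j) \<in> car (Xs ! i)" if "u \<in> car (nmod Xs m)" "i < length Xs" "j < m ! i" for u i j
    using that by (auto simp: nmod_simps)
  have v0: "u (i, j) = 0" if "u \<in> car (nmod Xs m)" "\<not> (i < length Xs \<and> j < m ! i)" for u i j
    using that(1)[unfolded nmod_simps(1), rule_format, of i j] that(2) by auto
  show ?thesis
    unfolding fd_module_def
  proof (intro conjI ballI allI)
    fix u assume u: "u \<in> car (nmod Xs m)"
    show "act (nmod Xs m) u (unt B) = u"
      using v[OF u] v0[OF u] by (auto simp: fun_eq_iff nmod_simps fd_moduleD(1)[OF Xs])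
    fix a assume a: "a \<in> car B"
    show "act (nmod Xs m) u a \<in> car (nmod Xs m)"
      using v[OF u] a by (auto simp: nmod_simps(1,3) fd_moduleD(2)[OF Xs])
    show "act (nmod Xs m) (smul (nmod Xs m) r u) a = smul (nmod Xs m) r (act (nmod Xs m) u a)" for r
      using v[OF u] a by (auto simp: fun_eq_iff nmod_simps fd_moduleD(3)[OF Xs] fd_smul[OF fs])
    show "act (nmod Xs m) u (smul B r a) = smul (nmod Xs m) r (act (nmod Xs m) u a)" for r
      using v[OF u] a by (auto simp: fun_eq_iff nmod_simps fd_moduleD(4)[OF Xs] fd_smul[OF fs])
    { fix w assume w: "w \<in> car (nmod Xs m)"
      show "act (nmod Xs m) (u + w) a = act (nmod Xs m) u a + act (nmod Xs m) w a"
        using v[OF u] v[OF w] a by (auto simp: fun_eq_iff nmod_simps fd_moduleD(5)[OF Xs]) }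
    fix b assume b: "b \<in> car B"
    show "act (nmod Xs m) u (a + b) = act (nmod Xs m) u a + act (nmod Xs m) u b"
      using v[OF u] a b by (auto simp: fun_eq_iff nmod_simps fd_moduleD(6)[OF Xs])
    show "act (nmod Xs m) u (mul B a b) = act (nmod Xs m) (act (nmod Xs m) u a) b"
      using v[OF u] a b by (auto simp: fun_eq_iff nmod_simps fd_moduleD(7)[OF Xs])
  qed (rule nmod_fd(1)[OF fs])
qed

lemma submodule_fd_module:
  assumes "fd_module B N" "submodule B N U"
  shows "fd_module B (N\<lparr>car := U\<rparr>)"
proof -
  have U: "U \<subseteq> car N" "module.subspace (smul N) U" "\<And>x a. x \<in> U \<Longrightarrow> a \<in> car B \<Longrightarrow> act N x a \<in> U"
    using assms(2) by (auto simp: submodule_def)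
  have U': "x \<in> U \<Longrightarrow> x \<in> car N" for x using U(1) by blast
  show ?thesis
    unfolding fd_module_def
    using fd_sub[OF fd_module_space[OF assms(1)] U(1,2)]
    by (simp add: U(3) U' fd_moduleD[OF assms(1)])
qed

lemma vdim_strict_mono:
  assumes V: "fd_space V" and U: "fd_space (V\<lparr>car := U\<rparr>)" "U \<subset> car V"
  shows "vdim (V\<lparr>car := U\<rparr>) < vdim V"
proof (rule ccontr)
  assume "\<not> ?thesis"
  moreover have "linear_on (V\<lparr>car := U\<rparr>) V (\<lambda>x. x)" using U(2) by (auto simp: linear_on_def)
  ultimately have "(\<lambda>x. x) ` car (V\<lparr>car := U\<rparr>) = car V"
    using linear_inj_surj[OF U(1) V, of "\<lambda>x. x"] by simp
  then show False using U(2) by simp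
qed

lemma direct_sum_projections:
  fixes N :: "('k::field, 'b::ab_group_add, 'v::ab_group_add) rmodule"
  assumes N: "fd_module B N" and U: "submodule B N U" and V: "submodule B N V"
    and int: "U \<inter> V = {0}" and sum: "{u + v | u v. u \<in> U \<and> v \<in> V} = car N"
  obtains p q where "p \<in> hom B N (N\<lparr>car := U\<rparr>)" "q \<in> hom B N (N\<lparr>car := V\<rparr>)"
    "\<And>x. x \<in> car N \<Longrightarrow> p x + q x = x" "\<And>u v. u \<in> U \<Longrightarrow> v \<in> V \<Longrightarrow> p (u + v) = u"
    "\<And>u v. u \<in> U \<Longrightarrow> v \<in> V \<Longrightarrow> q (u + v) = v"
proof -
  note fU = fd_car[OF fd_module_space[OF submodule_fd_module[OF N U]], simplified]
  note fV = fd_car[OF fd_module_space[OF submodule_fd_module[OF N V]], simplified]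
  note fs = fd_smul[OF fd_module_space[OF N]]
  have UN: "U \<subseteq> car N" "V \<subseteq> car N" using U V by (auto simp: submodule_def)
  have aU: "\<And>x a. x \<in> U \<Longrightarrow> a \<in> car B \<Longrightarrow> act N x a \<in> U" "\<And>x a. x \<in> V \<Longrightarrow> a \<in> car B \<Longrightarrow> act N x a \<in> V"
    using U V by (auto simp: submodule_def)
  have uniq: "u = u' \<and> v = v'" if "u \<in> U" "u' \<in> U" "v \<in> V" "v' \<in> V" "u + v = u' + v'" for u u' v v'
  proof -
    have "u - u' = v' - v" using that(5) by (simp add: algebra_simps)
    then have "u - u' \<in> U \<inter> V" using fU(5)[OF that(1,2)] fV(5)[OF that(4,3)] by simp
    then have "u - u' = 0" using int by blast
    then show ?thesis using that(5) by simp
  qed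
  have "\<forall>x\<in>car N. \<exists>u v. u \<in> U \<and> v \<in> V \<and> x = u + v" using sum by blast
  then obtain p0 q0 where pq: "\<And>x. x \<in> car N \<Longrightarrow> p0 x \<in> U" "\<And>x. x \<in> car N \<Longrightarrow> q0 x \<in> V"
    "\<And>x. x \<in> car N \<Longrightarrow> x = p0 x + q0 x" by metis
  define p where "p x = (if x \<in> car N then p0 x else 0)" for x
  define q where "q x = (if x \<in> car N then q0 x else 0)" for x
  have mem: "u + v \<in> car N" if "u \<in> U" "v \<in> V" for u v using that sum by blast
  have eq: "p (u + v) = u" "q (u + v) = v" if "u \<in> U" "v \<in> V" for u v
    using uniq[OF pq(1)[OF mem[OF that]] that(1) pq(2)[OF mem[OF that]] that(2)]
      pq(3)[OF mem[OF that]] mem[OF that] by (simp_all add: p_def q_def)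
  have val: "p x \<in> U" "q x \<in> V" "p x + q x = x" if "x \<in> car N" for x
    using pq(1,2)[OF that] pq(3)[OF that, symmetric] that by (simp_all add: p_def q_def)
  have add: "p (x + y) = p x + p y" "q (x + y) = q x + q y" if "x \<in> car N" "y \<in> car N" for x y
  proof -
    have "x + y = (p x + p y) + (q x + q y)"
      using val(3)[OF that(1)] val(3)[OF that(2)] by (metis add.assoc add.left_commute)
    then show "p (x + y) = p x + p y" "q (x + y) = q x + q y"
      using eq[of "p x + p y" "q x + q y"] val that fU(2) fV(2) by simp_all
  qed
  have scale: "p (smul N r x) = smul N r (p x)" "q (smul N r x) = smul N r (q x)"
    if "x \<in> car N" for x r
  proof -
    have "smul N r x = smul N r (p x) + smul N r (q x)"
      by (simp only: fs(1)[symmetric] val(3)[OF that])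
    then show "p (smul N r x) = smul N r (p x)" "q (smul N r x) = smul N r (q x)"
      using eq[of "smul N r (p x)" "smul N r (q x)"] val that fU(3) fV(3) by simp_all
  qed
  have act: "p (act N x a) = act N (p x) a" "q (act N x a) = act N (q x) a"
    if x: "x \<in> car N" and a: "a \<in> car B" for x a
  proof -
    have "act N x a = act N (p x) a + act N (q x) a"
      using fd_moduleD(5)[OF N _ _ a, of "p x" "q x"] val[OF x] UN by auto
    then show "p (act N x a) = act N (p x) a" "q (act N x a) = act N (q x) a"
      using eq[of "act N (p x) a" "act N (q x) a"] val[OF x] aU a by simp_all
  qed
  have off: "p x = 0" "q x = 0" if "x \<notin> car N" for x using that by (simp_all add: p_def q_def)
  show thesis
  proof (rule that[of p q])
    show "p \<in> hom B N (N\<lparr>car := U\<rparr>)" "q \<in> hom B N (N\<lparr>car := V\<rparr>)"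
      using val add scale act by (auto simp: hom_def lin_def off)
  qed (use val eq in auto)
qed

text \<open>Applied to the projection onto a summand, this says that \<open>E\<close> maps nontrivially to every
  nonzero summand. The form with arbitrary endomorphisms passes to summands at once, by
  composing with the projection.\<close>

definition hom_faithful :: "('k::field, 'b::ab_group_add) algebra \<Rightarrow> ('k, 'b, 'e::ab_group_add) rmodule \<Rightarrow>
    ('k, 'b, 'v::ab_group_add) rmodule \<Rightarrow> bool" where
  "hom_faithful B E N \<longleftrightarrow> (\<forall>f\<in>hom B N N. (\<forall>\<phi>\<in>hom B E N. f \<circ> \<phi> = 0) \<longrightarrow> f = 0)"

lemma hom_faithful_summand:
  assumes f: "hom_faithful B E N" and N: "fd_module B N" and U: "submodule B N U"
    and p: "p \<in> hom B N (N\<lparr>car := U\<rparr>)" "\<And>u. u \<in> U \<Longrightarrow> p u = u"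
  shows "hom_faithful B E (N\<lparr>car := U\<rparr>)"
  unfolding hom_faithful_def
proof (intro ballI impI)
  fix e assume e: "e \<in> hom B (N\<lparr>car := U\<rparr>) (N\<lparr>car := U\<rparr>)"
    and 0: "\<forall>\<phi>\<in>hom B E (N\<lparr>car := U\<rparr>). e \<circ> \<phi> = 0"
  note fU = fd_module_space[OF submodule_fd_module[OF N U]]
  have "e \<circ> p \<in> hom B N (N\<lparr>car := U\<rparr>)" by (rule hom_comp[OF p(1) e fU])
  then have ep: "e \<circ> p \<in> hom B N N"
    using U by (auto simp: hom_def lin_def submodule_def)
  have "(e \<circ> p) \<circ> \<phi> = 0" if "\<phi> \<in> hom B E N" for \<phi>
  proof -
    have "e \<circ> (p \<circ> \<phi>) = 0" using 0 hom_comp[OF that p(1) fd_module_space[OF N]] by blast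
    then show ?thesis by (simp add: comp_assoc)
  qed
  then have z: "e \<circ> p = 0" using f ep by (auto simp: hom_faithful_def)
  show "e = 0"
  proof
    fix x show "e x = 0 x"
      using fun_cong[OF z, of x] p(2)[of x] e by (cases "x \<in> U") (auto simp: hom_def lin_def)
  qed
qed

lemma iso_bijI: "f \<in> hom A M N \<Longrightarrow> bij_betw f (car M) (car N) \<Longrightarrow> iso A M N"
  by (auto simp: iso_def)

lemma visible_reps_fd: "visible_reps B E Xs \<Longrightarrow> i < length Xs \<Longrightarrow> fd_module B (Xs ! i)"
  by (auto simp: visible_reps_def visible_indec_def indecomposable_def)

lemma nmod_iso_zero:
  assumes N: "fd_module B N" "\<not> nonzero N" and Xs: "\<And>i. i < length Xs \<Longrightarrow> fd_module B (Xs ! i)"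
  shows "iso B N (nmod Xs (replicate (length Xs) 0))"
proof (rule iso_bijI[of "\<lambda>_. 0"])
  note M = nmod_fd_module[OF Xs, of "replicate (length Xs) 0"]
  have "u \<in> car (nmod Xs (replicate (length Xs) 0)) \<longleftrightarrow> u = 0" for u
    by (auto simp: nmod_simps fun_eq_iff)
  then have "car (nmod Xs (replicate (length Xs) 0)) = {0}" by blast
  moreover have "car N = {0}" using N by (simp add: nonzero_def)
  ultimately show "(\<lambda>_. 0) \<in> hom B N (nmod Xs (replicate (length Xs) 0))"
    "bij_betw (\<lambda>_. 0) (car N) (car (nmod Xs (replicate (length Xs) 0)))"
    using act_0[OF M] fd_smul(6)[OF fd_module_space[OF M]] by (auto simp: hom_def lin_def bij_betw_def)
qed

lemma nmod_iso_single:
  assumes N: "fd_module B N" and Xs: "\<And>i. i < length Xs \<Longrightarrow> fd_module B (Xs ! i)"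
    and i: "i < length Xs" and iso: "iso B N (Xs ! i)"
  shows "iso B N (nmod Xs ((replicate (length Xs) 0)[i := 1]))"
proof -
  obtain f where f: "f \<in> hom B N (Xs ! i)" "bij_betw f (car N) (car (Xs ! i))"
    using iso by (auto simp: iso_def)
  let ?m = "(replicate (length Xs) (0::nat))[i := 1]"
  define F where "F x = (\<lambda>p. if p = (i, 0::nat) then f x else 0)" for x
  have m: "j < length Xs \<and> l < ?m ! j \<longleftrightarrow> j = i \<and> l = 0" for j l
    using i by (cases "j = i") auto
  have car: "u \<in> car (nmod Xs ?m) \<longleftrightarrow> u (i, 0) \<in> car (Xs ! i) \<and> (\<forall>p. p \<noteq> (i, 0) \<longrightarrow> u p = 0)" for u
    unfolding nmod_simps m by (auto split: if_splits)
  show ?thesis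
  proof (rule iso_bijI[of F])
    show "F \<in> hom B N (nmod Xs ?m)"
      unfolding hom_def lin_def car mem_Collect_eq
    proof (intro conjI ballI allI impI)
      fix x assume x: "x \<in> car N"
      show "F (x + y) = F x + F y" if "y \<in> car N" for y
        using f(1) x that by (intro ext) (simp add: F_def hom_def lin_def)
      show "F (smul N r x) = smul (nmod Xs ?m) r (F x)" for r
      proof (rule ext)
        fix p :: "nat \<times> nat"
        obtain j l where p: "p = (j, l)" by (cases p)
        show "F (smul N r x) p = smul (nmod Xs ?m) r (F x) p"
          using f(1) x i fd_smul(6)[OF fd_module_space[OF Xs]]
          by (auto simp: F_def hom_def lin_def p nmod_simps)
      qed
      show "F (act N x a) = act (nmod Xs ?m) (F x) a" if a: "a \<in> car B" for a
      proof (rule ext)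
        fix p :: "nat \<times> nat"
        obtain j l where p: "p = (j, l)" by (cases p)
        show "F (act N x a) p = act (nmod Xs ?m) (F x) a p"
          using f(1) x a unfolding p nmod_simps(3) m by (simp add: F_def hom_def)
      qed
    qed (use f(1) in \<open>auto simp: F_def hom_def lin_def\<close>)
    show "bij_betw F (car N) (car (nmod Xs ?m))"
    proof (rule bij_betw_byWitness[of _ "\<lambda>u. inv_into (car N) f (u (i, 0))"])
      show "\<forall>a\<in>car N. inv_into (car N) f (F a (i, 0)) = a"
        using f(2) by (auto simp: F_def bij_betw_def inv_into_f_f)
      show "\<forall>u\<in>car (nmod Xs ?m). F (inv_into (car N) f (u (i, 0))) = u"
      proof
        fix u assume u: "u \<in> car (nmod Xs ?m)"
        then have "f (inv_into (car N) f (u (i, 0))) = u (i, 0)"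
          using f(2) by (intro f_inv_into_f) (simp only: car bij_betw_def)
        then show "F (inv_into (car N) f (u (i, 0))) = u" using u by (simp only: F_def car) auto
      qed
      show "F ` car N \<subseteq> car (nmod Xs ?m)"
        using f(2) unfolding image_subset_iff car by (auto simp: F_def bij_betw_def)
      show "(\<lambda>u. inv_into (car N) f (u (i, 0))) ` car (nmod Xs ?m) \<subseteq> car N"
      proof (rule image_subsetI)
        fix u assume "u \<in> car (nmod Xs ?m)"
        then have "u (i, 0) \<in> f ` car N" using f(2) by (simp only: car bij_betw_def)
        then show "inv_into (car N) f (u (i, 0)) \<in> car N" by (rule inv_into_into)
      qed
    qed
  qed
qed

lemma nmod_iso_sum:
  fixes N :: "('k::field, 'b::ab_group_add, 'v::ab_group_add) rmodule"
  assumes N: "fd_module B N" and Xs: "\<And>i. i < length Xs \<Longrightarrow> fd_module B (Xs ! i)"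
    and U: "submodule B N U" and V: "submodule B N V"
    and p: "p \<in> hom B N (N\<lparr>car := U\<rparr>)" and q: "q \<in> hom B N (N\<lparr>car := V\<rparr>)"
    and pq: "\<And>x. x \<in> car N \<Longrightarrow> p x + q x = x" "\<And>u v. u \<in> U \<Longrightarrow> v \<in> V \<Longrightarrow> p (u + v) = u"
    "\<And>u v. u \<in> U \<Longrightarrow> v \<in> V \<Longrightarrow> q (u + v) = v"
    and m: "length m1 = length Xs" "length m2 = length Xs"
    and iso: "iso B (N\<lparr>car := U\<rparr>) (nmod Xs m1)" "iso B (N\<lparr>car := V\<rparr>) (nmod Xs m2)"
  shows "iso B N (nmod Xs (map2 (+) m1 m2))"
proof -
  let ?m = "map2 (+) m1 m2"
  obtain f where f: "f \<in> hom B (N\<lparr>car := U\<rparr>) (nmod Xs m1)" "bij_betw f U (car (nmod Xs m1))"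
    using iso(1) by (auto simp: iso_def)
  obtain g where g: "g \<in> hom B (N\<lparr>car := V\<rparr>) (nmod Xs m2)" "bij_betw g V (car (nmod Xs m2))"
    using iso(2) by (auto simp: iso_def)
  have sp: "fd_space (Xs ! i)" if "i < length Xs" for i using fd_module_space[OF Xs[OF that]] .
  note fU = submodule_fd_module[OF N U] and fV = submodule_fd_module[OF N V]
  have fp: "f \<circ> p \<in> hom B N (nmod Xs m1)" by (rule hom_comp[OF p f(1) fd_module_space[OF fU]])
  have gq: "g \<circ> q \<in> hom B N (nmod Xs m2)" by (rule hom_comp[OF q g(1) fd_module_space[OF fV]])
  define F where "F x = (\<lambda>(i, j). if i < length Xs then
      (if j < m1 ! i then f (p x) (i, j) else if j < m1 ! i + m2 ! i then g (q x) (i, j - m1 ! i) else 0) else 0)" for x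
  have lm: "?m ! i = m1 ! i + m2 ! i" if "i < length Xs" for i using m that by simp
  have fv: "f (p x) (i, j) \<in> car (Xs ! i)" if "i < length Xs" "j < m1 ! i" "x \<in> car N" for x i j
  proof -
    have "f (p x) \<in> car (nmod Xs m1)" using fp that(3) by (auto simp: hom_def lin_def)
    then show ?thesis using that by (auto simp: nmod_simps)
  qed
  have gv: "g (q x) (i, j) \<in> car (Xs ! i)" if "i < length Xs" "j < m2 ! i" "x \<in> car N" for x i j
  proof -
    have "g (q x) \<in> car (nmod Xs m2)" using gq that(3) by (auto simp: hom_def lin_def)
    then show ?thesis using that by (auto simp: nmod_simps)
  qed
  note lf = linear_onD(2,3)[OF hom_linear_on[OF fp], simplified]
  note lg = linear_onD(2,3)[OF hom_linear_on[OF gq], simplified]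
  have af: "f (p (act N x a)) = act (nmod Xs m1) (f (p x)) a" "g (q (act N x a)) = act (nmod Xs m2) (g (q x)) a"
    if "x \<in> car N" "a \<in> car B" for x a
    using fp gq that by (auto simp: hom_def)
  have z: "f (p x) = 0" "g (q x) = 0" if "x \<notin> car N" for x
    using that lin_off[OF hom_lin[OF fp] that] lin_off[OF hom_lin[OF gq] that] by simp_all
  have hom: "F \<in> hom B N (nmod Xs ?m)"
    unfolding hom_def lin_iff linear_on_def mem_Collect_eq
  proof (intro conjI ballI allI impI)
    fix x assume x: "x \<in> car N"
    show "F x \<in> car (nmod Xs ?m)"
      using fv[OF _ _ x] gv[OF _ _ x] fd_car(1)[OF sp] by (auto simp: nmod_simps lm F_def)
    show "F (x + y) = F x + F y" if "y \<in> car N" for y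
      using lf(1)[OF x that] lg(1)[OF x that] by (auto simp: F_def fun_eq_iff)
    show "F (smul N r x) = smul (nmod Xs ?m) r (F x)" for r
      using lf(2)[OF x] lg(2)[OF x]
      by (auto simp: F_def fun_eq_iff nmod_simps fd_smul[OF sp])
    show "F (act N x a) = act (nmod Xs ?m) (F x) a" if "a \<in> car B" for a
      using af[OF x that] by (auto simp: F_def fun_eq_iff nmod_simps lm)
  next
    fix x assume "x \<notin> car N"
    then show "F x = 0" using z by (auto simp: F_def fun_eq_iff)
  qed
  \<comment> \<open>\<open>u1\<close> and \<open>u2\<close> cut out the first \<open>m1 ! i\<close> and the remaining \<open>m2 ! i\<close> copies of \<open>Xs ! i\<close>.\<close>
  define u1 where "u1 u = (\<lambda>(i, j). if i < length Xs \<and> j < m1 ! i then u (i, j) else 0)" for u :: "nat \<times> nat \<Rightarrow> nat \<Rightarrow> 'k"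
  define u2 where "u2 u = (\<lambda>(i, j). if i < length Xs \<and> j < m2 ! i then u (i, j + m1 ! i) else 0)" for u :: "nat \<times> nat \<Rightarrow> nat \<Rightarrow> 'k"
  have u1: "u1 u \<in> car (nmod Xs m1)" and u2: "u2 u \<in> car (nmod Xs m2)" if "u \<in> car (nmod Xs ?m)" for u
    using that by (auto simp: nmod_simps u1_def u2_def lm split: if_splits)
  have u1F: "u1 (F x) = f (p x)" and u2F: "u2 (F x) = g (q x)" if "x \<in> car N" for x
  proof -
    have "f (p x) \<in> car (nmod Xs m1)" "g (q x) \<in> car (nmod Xs m2)"
      using fp gq that by (auto simp: hom_def lin_def)
    then show "u1 (F x) = f (p x)" "u2 (F x) = g (q x)"
      by (auto simp: u1_def u2_def F_def fun_eq_iff nmod_simps)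
  qed
  have inj: "u = u'" if "u \<in> car (nmod Xs ?m)" "u' \<in> car (nmod Xs ?m)" "u1 u = u1 u'" "u2 u = u2 u'" for u u'
  proof
    fix ij :: "nat \<times> nat"
    obtain i j where ij: "ij = (i, j)" by (cases ij)
    consider "i < length Xs" "j < m1 ! i" | "i < length Xs" "m1 ! i \<le> j" "j < m1 ! i + m2 ! i"
      | "\<not> (i < length Xs \<and> j < ?m ! i)" using lm by fastforce
    then show "u ij = u' ij"
    proof cases
      case 1
      then show ?thesis using fun_cong[OF that(3), of "(i, j)"] by (simp add: u1_def ij)
    next
      case 2
      then have "j - m1 ! i < m2 ! i" by arith
      then show ?thesis using 2 fun_cong[OF that(4), of "(i, j - m1 ! i)"] by (simp add: u2_def ij)
    next
      case 3
      then have "u (i, j) = 0" "u' (i, j) = 0"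
        using that(1,2)[unfolded nmod_simps(1), rule_format, of i j] by auto
      then show ?thesis by (simp add: ij)
    qed
  qed
  have pqv: "p x \<in> U" "q x \<in> V" if "x \<in> car N" for x
    using p q that by (auto simp: hom_def lin_def)
  have UN: "u + v \<in> car N" if "u \<in> U" "v \<in> V" for u v
    using that U V fd_car(2)[OF fd_module_space[OF N]] by (auto simp: submodule_def)
  have "bij_betw F (car N) (car (nmod Xs ?m))"
    unfolding bij_betw_def
  proof
    show "inj_on F (car N)"
    proof (rule inj_onI)
      fix x y assume xy: "x \<in> car N" "y \<in> car N" "F x = F y"
      then have "f (p x) = f (p y)" "g (q x) = g (q y)" 
        using u1F[OF xy(1)] u1F[OF xy(2)] u2F[OF xy(1)] u2F[OF xy(2)] by simp_all
      note eq = this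
      have "p x = p y"
        by (rule inj_onD[OF bij_betw_imp_inj_on[OF f(2)] eq(1) pqv(1)[OF xy(1)] pqv(1)[OF xy(2)]])
      moreover have "q x = q y"
        by (rule inj_onD[OF bij_betw_imp_inj_on[OF g(2)] eq(2) pqv(2)[OF xy(1)] pqv(2)[OF xy(2)]])
      ultimately have "p x + q x = p y + q y" by (rule arg_cong2)
      then show "x = y" by (simp only: pq(1)[OF xy(1)] pq(1)[OF xy(2)])
    qed
    have FN: "F x \<in> car (nmod Xs ?m)" if "x \<in> car N" for x using hom that by (simp add: hom_def lin_def)
    show "F ` car N = car (nmod Xs ?m)"
    proof
      show "F ` car N \<subseteq> car (nmod Xs ?m)" using FN by blast
      show "car (nmod Xs ?m) \<subseteq> F ` car N"
      proof
        fix u assume u: "u \<in> car (nmod Xs ?m)"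
        have "u1 u \<in> f ` U" "u2 u \<in> g ` V"
          using u1[OF u] u2[OF u] f(2) g(2) by (simp_all add: bij_betw_def)
        then obtain x y where xy: "x \<in> U" "f x = u1 u" "y \<in> V" "g y = u2 u" by (metis imageE)
        have "u1 (F (x + y)) = u1 u" "u2 (F (x + y)) = u2 u"
          using u1F[OF UN[OF xy(1,3)]] u2F[OF UN[OF xy(1,3)]] pq(2,3)[OF xy(1,3)] xy by simp_all
        then have "F (x + y) = u" using inj FN[OF UN[OF xy(1,3)]] u by blast
        then show "u \<in> F ` car N" using UN[OF xy(1,3)] by blast
      qed
    qed
  qed
  then show ?thesis by (rule iso_bijI[OF hom])
qed

text \<open>Split \<open>N\<close> until the summands are indecomposable. These are visible, because faithfulness is inherited
  and the identity of a nonzero summand is nonzero.\<close>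

lemma ex_nmod_iso:
  fixes N :: "('k::field, 'b::ab_group_add) cmodule"
  assumes reps: "visible_reps B E Xs" and "fd_module B N" "hom_faithful B E N"
  shows "\<exists>m. length m = length Xs \<and> iso B N (nmod Xs m)"
  using assms(2,3)
proof (induction "vdim N" arbitrary: N rule: less_induct)
  case less
  note N = less.prems(1) and faithful = less.prems(2)
  note sN = fd_module_space[OF N]
  have Xs: "\<And>i. i < length Xs \<Longrightarrow> fd_module B (Xs ! i)" by (rule visible_reps_fd[OF reps])
  consider "\<not> nonzero N" | "nonzero N" "indecomposable B N" | "nonzero N" "\<not> indecomposable B N" by blast
  then show ?case
  proof cases
    case 1
    then show ?thesis
      using nmod_iso_zero[OF N 1 Xs] by (intro exI[of _ "replicate (length Xs) 0"]) simp
  next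
    case 2
    obtain x where x: "x \<in> car N" "x \<noteq> 0" using 2(1) fd_car(1)[OF sN] by (auto simp: nonzero_def)
    have "homothety N 1 \<noteq> 0"
    proof
      assume "homothety N 1 = 0"
      then have "homothety N 1 x = 0" by simp
      then show False using x homothety_1[OF sN x(1)] by simp
    qed
    then obtain \<phi> where \<phi>: "\<phi> \<in> hom B E N" "homothety N 1 \<circ> \<phi> \<noteq> 0"
      using faithful homothety_hom[OF N] by (auto simp: hom_faithful_def)
    have "homothety N 1 0 = 0" by (rule homothety_1[OF sN fd_car(1)[OF sN]])
    then have "homothety N 1 \<circ> (0 :: _ \<Rightarrow> _) = 0" by (intro ext) simp
    then have "\<phi> \<noteq> 0" using \<phi>(2) by auto
    then have "nonzero (hom_space B E N)" using \<phi>(1) by (auto simp: nonzero_def hom_space_def)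
    then have "visible_indec B E N" using 2 by (simp add: visible_indec_def)
    then obtain i where i: "i < length Xs" "iso B N (Xs ! i)" using reps by (auto simp: visible_reps_def)
    show ?thesis
      using nmod_iso_single[OF N Xs i] by (intro exI[of _ "(replicate (length Xs) 0)[i := 1]"]) simp
  next
    case 3
    then obtain U V where UV: "submodule B N U" "submodule B N V" "U \<inter> V = {0}"
      "{u + v | u v. u \<in> U \<and> v \<in> V} = car N" "U \<noteq> {0}" "V \<noteq> {0}"
      using N unfolding indecomposable_def by blast
    obtain p q where p: "p \<in> hom B N (N\<lparr>car := U\<rparr>)" and q: "q \<in> hom B N (N\<lparr>car := V\<rparr>)"
      and pq: "\<And>x. x \<in> car N \<Longrightarrow> p x + q x = x" "\<And>u v. u \<in> U \<Longrightarrow> v \<in> V \<Longrightarrow> p (u + v) = u"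
        "\<And>u v. u \<in> U \<Longrightarrow> v \<in> V \<Longrightarrow> q (u + v) = v"
      by (rule direct_sum_projections[OF N UV(1-4)]) (rule that)
    have sub: "U \<subset> car N" "V \<subset> car N"
      using UV by (auto simp: submodule_def)
    have zero: "0 \<in> U" "0 \<in> V" using UV(3) by auto
    note fU = submodule_fd_module[OF N UV(1)] and fV = submodule_fd_module[OF N UV(2)]
    have pU: "p u = u" if "u \<in> U" for u using pq(2)[OF that zero(2)] by simp
    have qV: "q v = v" if "v \<in> V" for v using pq(3)[OF zero(1) that] by simp
    obtain m1 where m1: "length m1 = length Xs" "iso B (N\<lparr>car := U\<rparr>) (nmod Xs m1)"
      using less.hyps[OF vdim_strict_mono[OF sN fd_module_space[OF fU] sub(1)] fU
          hom_faithful_summand[OF faithful N UV(1) p pU]] by blast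
    obtain m2 where m2: "length m2 = length Xs" "iso B (N\<lparr>car := V\<rparr>) (nmod Xs m2)"
      using less.hyps[OF vdim_strict_mono[OF sN fd_module_space[OF fV] sub(2)] fV
          hom_faithful_summand[OF faithful N UV(2) q qV]] by blast
    have "iso B N (nmod Xs (map2 (+) m1 m2))"
      by (rule nmod_iso_sum[OF N Xs UV(1,2) p q pq m1(1) m2(1) m1(2) m2(2)])
    moreover have "length (map2 (+) m1 m2) = length Xs" using m1(1) m2(1) by simp
    ultimately show ?thesis by blast
  qed
qed

section \<open>Counting isomorphism classes\<close>

lemma fin_many_reps:
  assumes "fin_many P R" and refl: "\<And>x. P x \<Longrightarrow> R x x"
  obtains F where "finite F" "\<And>x. x \<in> F \<Longrightarrow> P x" "\<And>x. P x \<Longrightarrow> \<exists>y\<in>F. R x y"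
proof -
  define r where "r = {(x, y). P x \<and> P y \<and> R x y}"
  have fin: "finite (Collect P // r)" using assms(1) by (simp add: fin_many_def r_def)
  have ne: "\<exists>y. y \<in> c" "c \<subseteq> Collect P" if "c \<in> Collect P // r" for c
    using that refl by (auto simp: quotient_def r_def)
  define F where "F = (\<lambda>c. SOME x. x \<in> c) ` (Collect P // r)"
  have "\<exists>y\<in>F. R x y" if "P x" for x
  proof -
    have c: "r `` {x} \<in> Collect P // r" using that by (auto intro: quotientI)
    define z where "z = (SOME y. y \<in> r `` {x})"
    have "z \<in> r `` {x}" unfolding z_def by (rule someI_ex[OF ne(1)[OF c]])
    moreover have "z \<in> F" unfolding z_def F_def by (rule imageI[OF c])
    ultimately show ?thesis by (auto simp: r_def)
  qed
  moreover have "P x" if "x \<in> F" for x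
  proof -
    obtain c where c: "c \<in> Collect P // r" "x = (SOME x. x \<in> c)" using \<open>x \<in> F\<close> unfolding F_def by blast
    then have "x \<in> c" using someI_ex[OF ne(1)[OF c(1)]] by simp
    then show ?thesis using ne(2)[OF c(1)] by blast
  qed
  ultimately show thesis using fin that[of F] by (auto simp: F_def)
qed

text \<open>Counting by finitely many labels \<open>y\<close> that determine an object up to \<open>R\<close>. The labels may be pairs of numbers or
  objects of another category.\<close>

lemma fin_manyI:
  assumes fin: "finite F" and ex: "\<And>x. P x \<Longrightarrow> \<exists>y\<in>F. S x y"
    and S: "\<And>x x' y. P x \<Longrightarrow> P x' \<Longrightarrow> y \<in> F \<Longrightarrow> S x y \<Longrightarrow> S x' y \<Longrightarrow> R x x'"
    and sym: "\<And>x y. P x \<Longrightarrow> P y \<Longrightarrow> R x y \<Longrightarrow> R y x"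
    and trans: "\<And>x y z. P x \<Longrightarrow> P y \<Longrightarrow> P z \<Longrightarrow> R x y \<Longrightarrow> R y z \<Longrightarrow> R x z"
  shows "fin_many P R"
proof -
  define r where "r = {(x, y). P x \<and> P y \<and> R x y}"
  define c where "c y = r `` {SOME x. P x \<and> S x y}" for y
  have "Collect P // r \<subseteq> c ` F"
  proof
    fix q assume "q \<in> Collect P // r"
    then obtain x where x: "P x" "q = r `` {x}" by (auto simp: quotient_def)
    obtain y where y: "y \<in> F" "S x y" using ex[OF x(1)] by blast
    define z where "z = (SOME x. P x \<and> S x y)"
    have z: "P z" "S z y" using someI_ex[of "\<lambda>x. P x \<and> S x y"] x(1) y(2) unfolding z_def by blast+
    have xz: "R x z" "R z x" using S[OF x(1) z(1) y(1) y(2) z(2)] S[OF z(1) x(1) y(1) z(2) y(2)] .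
    have "r `` {x} = r `` {z}"
      using x(1) z(1) trans[OF x(1) z(1) _ xz(1)] trans[OF z(1) x(1) _ xz(2)] by (auto simp: r_def)
    then show "q \<in> c ` F" using x(2) y(1) by (auto simp: c_def z_def)
  qed
  then show ?thesis using finite_subset[OF _ finite_imageI[OF fin]] by (simp add: fin_many_def r_def)
qed

section \<open>Realized pairs and mixed bricks\<close>

lemma nonzero_iff_vdim:
  assumes V: "fd_space V"
  shows "nonzero V \<longleftrightarrow> vdim V \<noteq> 0"
proof -
  obtain b where b: "basis_fam V {..<vdim V} b" using ex_basis_fam[OF V] by blast
  show ?thesis
  proof
    assume n: "nonzero V"
    show "vdim V \<noteq> 0"
    proof
      assume 0: "vdim V = 0"
      have "x = 0" if "x \<in> car V" for x using basis_famD(3)[OF b that] 0 by auto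
      then show False using n fd_car(1)[OF V] by (auto simp: nonzero_def)
    qed
  next
    assume d: "vdim V \<noteq> 0"
    show "nonzero V"
    proof (rule ccontr)
      assume "\<not> nonzero V"
      then have "b i = 0" if "i < vdim V" for i
        using basis_famD(2)[OF b, of i] that by (simp add: nonzero_def)
      then have "(\<Sum>i<vdim V. smul V 1 (b i)) = 0" by (simp add: fd_smul[OF V])
      then show False using basis_famD(4)[OF b, of "\<lambda>_. 1" 0] d by simp
    qed
  qed
qed

lemma ex_lin_bij:
  fixes V :: "('k::field, 'v::ab_group_add, 'y) space_scheme"
    and W :: "('k, 'w::ab_group_add, 'z) space_scheme"
  assumes V: "fd_space V" and W: "fd_space W" and d: "vdim V = vdim W"
  obtains f where "f \<in> lin V W" "bij_betw f (car V) (car W)"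
proof -
  obtain b where b: "basis_fam V {..<vdim V} b" using ex_basis_fam[OF V] by blast
  obtain c where c: "basis_fam W {..<vdim V} c" using ex_basis_fam[OF W] d by metis
  obtain \<kappa> where "coordinates V {..<vdim V} b \<kappa>" by (rule ex_coordinates[OF V b])
  note \<kappa> = coordinatesD[OF this]
  define f where "f x = (\<Sum>i<vdim V. smul W (\<kappa> i x) (c i))" for x
  have fc: "f x \<in> car W" for x
    unfolding f_def using basis_famD(2)[OF c] by (intro fd_car[OF W]) auto
  have f: "f \<in> lin V W"
    using fc by (auto simp: lin_def f_def \<kappa>(1-3) fd_smul[OF W] sum.distrib)
  have inj: "x = 0" if x: "x \<in> car V" "f x = 0" for x
  proof -
    have "\<kappa> i x = 0" if "i \<in> {..<vdim V}" for i
      using basis_famD(4)[OF c, of "\<lambda>i. \<kappa> i x" i] x(2) that by (simp add: f_def)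
    then have "(\<Sum>i<vdim V. smul V (\<kappa> i x) (b i)) = 0" by (simp add: fd_smul[OF V])
    then show ?thesis using \<kappa>(4)[OF x(1)] by simp
  qed
  have "bij_betw f (car V) (car W)"
    using inj_on_linear[OF lin_linear_on[OF f] V inj]
      linear_inj_surj[OF V W lin_linear_on[OF f] inj] d by (simp add: bij_betw_def)
  then show thesis using that f by blast
qed

text \<open>A model of the \<open>l\<close>-dimensional space in the ambient type used by \<open>triple\<close>.\<close>

definition coord_space :: "nat \<Rightarrow> ('k::field, nat \<Rightarrow> 'k) space" where
  "coord_space l = \<lparr>car = {v. \<forall>n\<ge>l. v n = 0}, smul = (\<lambda>r v n. r * v n)\<rparr>"

lemma fd_coord_space: "fd_space (coord_space l :: ('k::field, nat \<Rightarrow> 'k) space)"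
  "vdim (coord_space l :: ('k, nat \<Rightarrow> 'k) space) = l"
proof -
  let ?K = "coord_space l :: ('k, nat \<Rightarrow> 'k) space"
  define b where "b i n = (if n = i then 1 else 0 :: 'k)" for i n :: nat
  interpret K: vector_space "smul ?K" by (simp add: coord_space_def vector_space_pointwise)
  have val: "(\<Sum>i<l. smul ?K (c i) (b i)) n = (if n < l then c n else 0)" for c n
  proof -
    have "(\<Sum>i<l. smul ?K (c i) (b i)) n = (\<Sum>i<l. if i = n then c n else 0)"
      unfolding sum_fun_apply by (rule sum.cong) (auto simp: coord_space_def b_def)
    then show ?thesis by simp
  qed
  have "basis_fam ?K {..<l} b"
    unfolding basis_fam_def
  proof (intro conjI ballI allI impI)
    show "\<exists>c. x = (\<Sum>i<l. smul ?K (c i) (b i))" if "x \<in> car ?K" for x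
      using that by (intro exI[of _ x] ext) (simp only: val, simp add: coord_space_def)
    fix c i assume "(\<Sum>i<l. smul ?K (c i) (b i)) = 0" "i \<in> {..<l}"
    then show "c i = 0" using val[of c i] by simp
  qed (auto simp: coord_space_def b_def)
  note bf = this
  have sub: "K.subspace (car ?K)" unfolding K.subspace_def by (auto simp: coord_space_def)
  show "fd_space ?K" "vdim ?K = l"
    using basis_fam_vdim[OF K.vector_space_axioms sub bf] by simp_all
qed

lemma triple_iso_trip_iso:
  "triple_iso B T T' \<longleftrightarrow> trip_iso B (tmod T) (tspc T) (tmap T) (tmod T') (tspc T') (tmap T')"
  by (simp add: triple_iso_def trip_iso_def triple_hom_def trip_hom_def)

lemma triple_brick_iff:
  "triple_brick B E T \<longleftrightarrow> is_trip B E (tmod T) (tspc T) (tmap T) \<and>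
     (nonzero (tmod T) \<or> nonzero (tspc T)) \<and> scalar_endos B (tmod T) (tspc T) (tmap T)"
  by (auto simp add: triple_brick_def is_triple_def is_trip_def scalar_endos_def triple_hom_def trip_hom_def)

lemma mixed_brick_iff:
  "mixed_brick B E T \<longleftrightarrow> is_trip B E (tmod T) (tspc T) (tmap T) \<and> nonzero (tmod T) \<and> nonzero (tspc T) \<and>
     scalar_endos B (tmod T) (tspc T) (tmap T)"
  by (auto simp: mixed_brick_def triple_brick_iff)

lemma triple_iso_equiv:
  assumes "fd_module B E"
  shows "triple_brick B E T \<Longrightarrow> triple_iso B T T"
    "triple_brick B E T \<Longrightarrow> triple_brick B E T' \<Longrightarrow> triple_iso B T T' \<Longrightarrow> triple_iso B T' T"
    "triple_brick B E T' \<Longrightarrow> triple_iso B T T' \<Longrightarrow> triple_iso B T' T'' \<Longrightarrow> triple_iso B T T''"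
proof -
  show "triple_brick B E T \<Longrightarrow> triple_iso B T T"
    unfolding triple_brick_iff triple_iso_trip_iso by (blast intro: trip_iso_refl[OF assms])
  show "triple_brick B E T \<Longrightarrow> triple_brick B E T' \<Longrightarrow> triple_iso B T T' \<Longrightarrow> triple_iso B T' T"
    using trip_iso_sym[of B E "tmod T" "tspc T" "tmap T" "tmod T'" "tspc T'" "tmap T'"]
    by (simp add: triple_brick_iff triple_iso_trip_iso)
  show "triple_iso B T T''" if T: "triple_brick B E T'" "triple_iso B T T'" "triple_iso B T' T''"
  proof -
    have "is_trip B E (tmod T') (tspc T') (tmap T')" using T(1) by (simp add: triple_brick_iff)
    from trip_iso_trans[OF _ _ is_tripD(2,3)[OF this]] show ?thesis
      using T(2,3) unfolding triple_iso_trip_iso by blast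
  qed
qed

lemma homothety_eq_0:
  assumes V: "fd_space V" and n: "nonzero V" and h: "homothety V r = 0"
  shows "r = 0"
proof -
  obtain x where x: "x \<in> car V" "x \<noteq> 0" using n fd_car(1)[OF V] by (auto simp: nonzero_def)
  then show ?thesis using fun_cong[OF h, of x] by (simp add: homothety_def fd_smul[OF V])
qed

text \<open>A kernel vector \<open>w\<close> of \<open>\<eta>\<close> would yield the endomorphism \<open>(0, \<kappa>(-) w)\<close>.\<close>

lemma scalar_endos_inj:
  assumes T: "is_trip B E N W \<eta>" and n: "nonzero N" and s: "scalar_endos B N W \<eta>"
    and w: "w \<in> car W" "\<eta> w = 0"
  shows "w = 0"
proof (rule ccontr)
  assume w0: "w \<noteq> 0"
  note N = is_tripD(2)[OF T] and W = is_tripD(3)[OF T]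
  obtain g \<kappa> where g: "g \<in> lin W W" "\<And>x. x \<in> car W \<Longrightarrow> g x = smul W (\<kappa> x) w" "\<kappa> w \<noteq> 0"
    by (rule ex_rank_one_map[OF W w(1) w0]) (rule that)
  have eg: "\<eta> (g x) = 0" if "x \<in> car W" for x
    using linear_onD(3)[OF lin_linear_on[OF is_tripD(4)[OF T]] w(1), of "\<kappa> x"] that w(2)
    by (auto simp: g(2) hom_space_def fun_eq_iff fd_smul[OF N])
  have "homothety N 0 = 0" by (auto simp: homothety_def fun_eq_iff fd_smul[OF N])
  then have "0 \<in> hom B N N" using homothety_hom[OF is_tripD(1)[OF T], of 0] by simp
  then have "(0, g) \<in> trip_hom B N W \<eta> N W \<eta>"
    using g(1) eg by (auto simp: trip_hom_def fun_eq_iff)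
  then obtain r where r: "homothety N r = 0" "homothety W r = g"
    using s by (auto simp: scalar_endos_def)
  have "r = 0" by (rule homothety_eq_0[OF N n r(1)])
  then have "smul W (\<kappa> w) w = 0" using fun_cong[OF r(2), of w] w(1) by (simp add: g(2) homothety_def fd_smul[OF W])
  then show False using g(3) w0 by (simp add: fd_smul[OF W])
qed

text \<open>If \<open>f\<close> kills all maps from \<open>E\<close>, then \<open>(f, 0)\<close> is an endomorphism, so a scalar, and as it vanishes on
  \<open>W \<noteq> 0\<close> the scalar is \<open>0\<close>.\<close>

lemma scalar_endos_faithful:
  assumes T: "is_trip B E N W \<eta>" and n: "nonzero W" and s: "scalar_endos B N W \<eta>"
  shows "hom_faithful B E N"
  unfolding hom_faithful_def
proof (intro ballI impI)
  note N = is_tripD(2)[OF T] and W = is_tripD(3)[OF T]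
  fix f assume f: "f \<in> hom B N N" "\<forall>\<phi>\<in>hom B E N. f \<circ> \<phi> = 0"
  have "\<eta> 0 = 0" by (rule lin_0[OF is_tripD(4)[OF T] W])
  moreover have "0 \<in> lin W W" using homothety_lin[OF W, of 0]
    by (auto simp: lin_def fd_car[OF W] fd_smul[OF W])
  ultimately have "(f, 0) \<in> trip_hom B N W \<eta> N W \<eta>"
    using f is_tripD(5)[OF T] by (auto simp: trip_hom_def)
  then obtain r where r: "homothety N r = f" "homothety W r = 0"
    using s by (auto simp: scalar_endos_def)
  have "r = 0" by (rule homothety_eq_0[OF W n r(2)])
  then show "f = 0" unfolding r(1)[symmetric] by (auto simp: homothety_def fun_eq_iff fd_smul[OF N])
qed

text \<open>The realizing subspace is the image of \<open>\<eta>\<close>. An endomorphism \<open>f\<close> of \<open>N\<close> preserving it lifts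
  to \<open>(f, g)\<close> with \<open>g\<close> obtained from \<open>f\<close> through the injection \<open>\<eta>\<close>.\<close>

lemma realizedI:
  assumes E: "fd_module B E" and T: "is_trip B E (nmod Xs m) W \<eta>" and n: "nonzero (nmod Xs m)"
    and s: "scalar_endos B (nmod Xs m) W \<eta>"
  shows "realized B E Xs (m, vdim W)"
proof -
  define N where "N = nmod Xs m"
  define H where "H = hom_space B E N"
  note T = T[folded N_def] and s = s[folded N_def] and n = n[folded N_def]
  note N = is_tripD(2)[OF T] and W = is_tripD(3)[OF T] and mN = is_tripD(1)[OF T]
  have \<eta>: "\<eta> \<in> lin W H" unfolding H_def by (rule is_tripD(4)[OF T])
  note l\<eta> = lin_linear_on[OF \<eta>]
  have H: "fd_space H" unfolding H_def by (rule fd_hom_space[OF E mN])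
  note inj0 = scalar_endos_inj[OF T n s]
  have inj: "inj_on \<eta> (car W)" by (rule inj_on_linear[OF l\<eta> W inj0])
  let ?L = "\<eta> ` car W"
  have L: "?L \<subseteq> car H" using linear_onD(1)[OF l\<eta>] by auto
  interpret H: vector_space "smul H" by (rule fd_vs[OF H])
  have sub: "H.subspace ?L"
    unfolding H.subspace_def
  proof (intro conjI ballI allI)
    show "0 \<in> ?L" using lin_0[OF \<eta> W] fd_car(1)[OF W] by force
    fix x assume "x \<in> ?L"
    then obtain w where w: "w \<in> car W" "x = \<eta> w" by blast
    show "x + y \<in> ?L" if "y \<in> ?L" for y
    proof -
      obtain w' where w': "w' \<in> car W" "y = \<eta> w'" using \<open>y \<in> \<eta> ` car W\<close> by blast
      show ?thesis
        unfolding w(2) w'(2) linear_onD(2)[OF l\<eta> w(1) w'(1), symmetric]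
        by (rule imageI) (rule fd_car(2)[OF W w(1) w'(1)])
    qed
    show "smul H r x \<in> ?L" for r
      unfolding w(2) linear_onD(3)[OF l\<eta> w(1), symmetric]
      by (rule imageI) (rule fd_car(3)[OF W w(1)])
  qed
  have "vdim W = vdim (H\<lparr>car := ?L\<rparr>)"
    by (rule vdim_bij[OF W fd_sub[OF H L sub], of \<eta>])
      (use l\<eta> inj in \<open>auto simp: linear_on_def bij_betw_def\<close>)
  then have dim: "H.dim ?L = vdim W" by (simp add: vdim_def)
  have "{f \<in> hom B N N. (\<lambda>\<phi>. f \<circ> \<phi>) ` ?L \<subseteq> ?L} = range (homothety N)"
  proof
    show "range (homothety N) \<subseteq> {f \<in> hom B N N. (\<lambda>\<phi>. f \<circ> \<phi>) ` ?L \<subseteq> ?L}"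
      using homothety_hom[OF mN] homothety_comp_hom[OF E T] fd_car(3)[OF W] by auto
    show "{f \<in> hom B N N. (\<lambda>\<phi>. f \<circ> \<phi>) ` ?L \<subseteq> ?L} \<subseteq> range (homothety N)"
    proof (rule subsetI)
      fix f assume "f \<in> {f \<in> hom B N N. (\<lambda>\<phi>. f \<circ> \<phi>) ` ?L \<subseteq> ?L}"
      then have f: "f \<in> hom B N N" "(\<lambda>\<phi>. f \<circ> \<phi>) ` ?L \<subseteq> ?L" by simp_all
      have "\<exists>v. v \<in> car W \<and> f \<circ> \<eta> w = \<eta> v" if "w \<in> car W" for w using f(2) that by auto
      then obtain g0 where g0: "\<And>w. w \<in> car W \<Longrightarrow> g0 w \<in> car W" "\<And>w. w \<in> car W \<Longrightarrow> f \<circ> \<eta> w = \<eta> (g0 w)"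
        by metis
      define g where "g w = (if w \<in> car W then g0 w else 0)" for w
      have g: "g w \<in> car W" "f \<circ> \<eta> w = \<eta> (g w)" if "w \<in> car W" for w
        using g0 that by (simp_all add: g_def)
      have val: "\<eta> w e \<in> car N" if "w \<in> car W" for w e
        using lin_car[OF hom_lin[OF is_tripD(5)[OF T that]] N] .
      note lf = linear_onD[OF hom_linear_on[OF f(1)]]
      have "g (x + y) = g x + g y" if "x \<in> car W" "y \<in> car W" for x y
      proof (rule inj_onD[OF inj])
        show "\<eta> (g (x + y)) = \<eta> (g x + g y)"
          using that g fd_car(2)[OF W]
          by (simp add: linear_onD(2)[OF l\<eta>] g(2)[symmetric])
            (simp add: fun_eq_iff lf(2) val)
      qed (use that g(1) fd_car(2)[OF W] in auto)
      moreover have "g (smul W r x) = smul W r (g x)" if "x \<in> car W" for x r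
      proof (rule inj_onD[OF inj])
        show "\<eta> (g (smul W r x)) = \<eta> (smul W r (g x))"
          using that g fd_car(3)[OF W]
          by (simp add: linear_onD(3)[OF l\<eta>] g(2)[symmetric])
            (simp add: fun_eq_iff lf(3) val H_def hom_space_def)
      qed (use that g(1) fd_car(3)[OF W] in auto)
      ultimately have "g \<in> lin W W" using g(1) by (auto simp: lin_def g_def)
      then have "(f, g) \<in> trip_hom B N W \<eta> N W \<eta>" using f(1) g(2) by (simp add: trip_hom_def)
      then show "f \<in> range (homothety N)" using s by (auto simp: scalar_endos_def)
    qed
  qed
  then show ?thesis
    unfolding realized_def Let_def split N_def[symmetric] H_def[symmetric]
    using L sub dim by blast
qed

text \<open>Conversely, parametrise \<open>L\<close> by \<open>coord_space l\<close>.\<close>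

lemma realizedE:
  fixes Xs :: "('k::field, 'b::ab_group_add) cmodule list"
  assumes E: "fd_module B E" and mN: "fd_module B (nmod Xs m)" and r: "realized B E Xs (m, l)"
  obtains \<eta> where "is_trip B E (nmod Xs m) (coord_space l) \<eta>"
    "scalar_endos B (nmod Xs m) (coord_space l) \<eta>"
proof -
  define N where "N = nmod Xs m"
  define H where "H = hom_space B E N"
  define W where "W = (coord_space l :: ('k, nat \<Rightarrow> 'k) space)"
  note mN = mN[folded N_def]
  have N: "fd_space N" by (rule fd_module_space[OF mN])
  have W: "fd_space W" "vdim W = l" unfolding W_def by (rule fd_coord_space)+
  have H: "fd_space H" unfolding H_def by (rule fd_hom_space[OF E mN])
  obtain L where L: "L \<subseteq> car H" "module.subspace (smul H) L" "vector_space.dim (smul H) L = l"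
    "{f \<in> hom B N N. (\<lambda>\<phi>. f \<circ> \<phi>) ` L \<subseteq> L} = range (homothety N)"
    using r unfolding realized_def Let_def split N_def[symmetric] H_def[symmetric] by blast
  have "vdim W = vdim (H\<lparr>car := L\<rparr>)" using L(3) W(2) by (simp add: vdim_def)
  then obtain \<eta> where \<eta>: "\<eta> \<in> lin W (H\<lparr>car := L\<rparr>)" "bij_betw \<eta> (car W) L"
    using ex_lin_bij[OF W(1) fd_sub[OF H L(1,2)]] by auto
  have "\<eta> \<in> lin W H" using \<eta>(1) L(1) by (auto simp: lin_def)
  then have T: "is_trip B E N W \<eta>" using mN W(1) by (simp add: is_trip_def H_def)
  have \<eta>L: "\<eta> w \<in> L" if "w \<in> car W" for w using \<eta>(2) that by (auto simp: bij_betw_def)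
  have "scalar_endos B N W \<eta>"
  proof (rule scalar_endosI[OF E T])
    fix f g assume fg: "(f, g) \<in> trip_hom B N W \<eta> N W \<eta>"
    have g: "g w \<in> car W" if "w \<in> car W" for w using trip_homD(2)[OF fg] that by (simp add: lin_def)
    have "f \<circ> \<phi> \<in> L" if "\<phi> \<in> L" for \<phi>
    proof -
      obtain w where w: "w \<in> car W" "\<phi> = \<eta> w"
        using \<open>\<phi> \<in> L\<close> bij_betw_imp_surj_on[OF \<eta>(2)] by blast
      then show ?thesis using trip_homD(3)[OF fg w(1)] \<eta>L[OF g[OF w(1)]] by simp
    qed
    then have "(\<lambda>\<phi>. f \<circ> \<phi>) ` L \<subseteq> L" by (rule image_subsetI)
    then have "f \<in> {f \<in> hom B N N. (\<lambda>\<phi>. f \<circ> \<phi>) ` L \<subseteq> L}" using trip_homD(1)[OF fg] by simp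
    then have "f \<in> range (homothety N)" by (simp only: L(4))
    then obtain c where c: "f = homothety N c" by blast
    have "g = homothety W c"
    proof
      fix w show "g w = homothety W c w"
      proof (cases "w \<in> car W")
        case True
        have "\<eta> (g w) = \<eta> (smul W c w)"
          using trip_homD(3)[OF fg True] homothety_comp_hom[OF E T True] c by simp
        then have "g w = smul W c w"
          by (rule inj_onD[OF bij_betw_imp_inj_on[OF \<eta>(2)]]) (use g True fd_car(3)[OF W(1)] in auto)
        then show ?thesis using True by (simp add: homothety_def)
      qed (use trip_homD(2)[OF fg] in \<open>simp add: lin_def homothety_def\<close>)
    qed
    then show "\<exists>r. f = homothety N r \<and> g = homothety W r" using c by blast
  qed
  then show thesis using that[of \<eta>] T by (simp add: N_def W_def)
qed

text \<open>The polynomial \<open>1 + \<Prod>\<^sub>a (x - a)\<close>, with \<open>a\<close> running through a finite field, has no root in it.\<close>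

lemma infinite_alg_closed: "infinite (UNIV :: 'k::alg_closed_field set)"
proof
  assume fin: "finite (UNIV :: 'k set)"
  let ?p = "(\<Prod>a\<in>(UNIV :: 'k set). [:- a, 1:])"
  have deg: "degree ?p = card (UNIV :: 'k set)" by (subst degree_prod_eq_sum_degree) auto
  have "degree (?p + 1) = card (UNIV :: 'k set)"
    using deg fin finite_UNIV_card_ge_0[OF fin] by (subst degree_add_eq_left) auto
  then obtain x where "poly (?p + 1) x = 0"
    using alg_closed_imp_poly_has_root[of "?p + 1"] finite_UNIV_card_ge_0[OF fin] by auto
  moreover have "poly ?p x = 0" using fin by (auto simp: poly_prod prod_zero_iff)
  ultimately show False by simp
qed

section \<open>Finiteness of mixed bricks\<close>

lemma nonzero_nmod:
  fixes Xs :: "('k::field, 'b::ab_group_add) cmodule list"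
  assumes reps: "visible_reps B E Xs" and m: "length m = length Xs"
  shows "nonzero (nmod Xs m) \<longleftrightarrow> (\<exists>i<length m. m ! i \<noteq> 0)" "i < length Xs \<Longrightarrow> m ! i \<le> vdim (nmod Xs m)"
proof -
  have Xs: "fd_space (Xs ! i)" "vdim (Xs ! i) \<noteq> 0" if "i < length Xs" for i
  proof -
    have "Xs ! i \<in> set Xs" using that by simp
    then have "fd_module B (Xs ! i)" "nonzero (Xs ! i)"
      using reps by (auto simp: visible_reps_def visible_indec_def indecomposable_def)
    then show "fd_space (Xs ! i)" "vdim (Xs ! i) \<noteq> 0"
      using fd_module_space nonzero_iff_vdim by blast+
  qed
  note nm = nmod_fd[of Xs, OF Xs(1), of m]
  have "nonzero (nmod Xs m) \<longleftrightarrow> (\<Sum>i<length Xs. m ! i * vdim (Xs ! i)) \<noteq> 0"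
    using nonzero_iff_vdim[OF nm(1)] nm(2) by simp
  also have "\<dots> \<longleftrightarrow> (\<exists>i<length m. m ! i \<noteq> 0)" using Xs(2) m by auto
  finally show "nonzero (nmod Xs m) \<longleftrightarrow> (\<exists>i<length m. m ! i \<noteq> 0)" .
  assume i: "i < length Xs"
  have "m ! i \<le> m ! i * vdim (Xs ! i)" using Xs(2)[OF i] by simp
  also have "\<dots> \<le> vdim (nmod Xs m)"
    using member_le_sum[of i "{..<length Xs}" "\<lambda>i. m ! i * vdim (Xs ! i)"] i nm(2) by simp
  finally show "m ! i \<le> vdim (nmod Xs m)" .
qed

lemma mixed_brick_to_nmod:
  assumes E: "fd_module B E" and reps: "visible_reps B E Xs" and T: "mixed_brick B E T"
  obtains m \<eta> where "length m = length Xs"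
    "is_trip B E (nmod Xs m) (coord_space (vdim (tspc T))) \<eta>"
    "trip_iso B (tmod T) (tspc T) (tmap T) (nmod Xs m) (coord_space (vdim (tspc T))) \<eta>"
proof -
  have t: "is_trip B E (tmod T) (tspc T) (tmap T)" "nonzero (tspc T)"
    "scalar_endos B (tmod T) (tspc T) (tmap T)"
    using T by (auto simp: mixed_brick_iff)
  obtain m f where m: "length m = length Xs" and f: "f \<in> hom B (tmod T) (nmod Xs m)"
    "bij_betw f (car (tmod T)) (car (nmod Xs m))"
    using ex_nmod_iso[OF reps is_tripD(1)[OF t(1)] scalar_endos_faithful[OF t]] by (auto simp: iso_def)
  note W = is_tripD(3)[OF t(1)]
  obtain g where g: "g \<in> lin (tspc T) (coord_space (vdim (tspc T)))"
    "bij_betw g (car (tspc T)) (car (coord_space (vdim (tspc T))))"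
    using ex_lin_bij[OF W fd_coord_space(1) fd_coord_space(2)[symmetric]] by metis
  have "fd_module B (nmod Xs m)" by (rule nmod_fd_module[OF visible_reps_fd[OF reps]])
  from trip_transport[OF t(1) this fd_coord_space(1) f g E] m that show thesis by blast
qed

lemma trip_to_triple:
  fixes B :: "('k::field, 'b::ab_group_add) algebra" and E :: "('k, 'b, 'e::ab_group_add) rmodule"
    and W :: "('k, nat \<Rightarrow> 'k) space"
  assumes E: "fd_module B E" and T: "is_trip B E N W \<eta>"
  obtains T' :: "('k, 'b, 'e) triple" where "is_trip B E (tmod T') (tspc T') (tmap T')"
    "trip_iso B N W \<eta> (tmod T') (tspc T') (tmap T')"
proof -
  obtain N' :: "('k, _) cmodule" and f where N': "fd_module B N'"
    and f: "f \<in> hom B N N'" "bij_betw f (car N) (car N')"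
    using ex_iso_coordinate_module[OF is_tripD(1)[OF T]] by (auto simp: iso_def)
  note W = is_tripD(3)[OF T]
  obtain \<eta>' where "is_trip B E N' W \<eta>'" "trip_iso B N W \<eta> N' W \<eta>'"
    using trip_transport[OF T N' W f homothety_lin[OF W] bij_homothety[OF W] E] by blast
  then show thesis using that[of "\<lparr>tmod = N', tspc = W, tmap = \<eta>'\<rparr>"] by simp
qed

lemma trip_iso_vdim:
  assumes "is_trip B E N W \<eta>" "is_trip B E N' W' \<eta>'" "trip_iso B N W \<eta> N' W' \<eta>'"
  shows "vdim N = vdim N'" "vdim W = vdim W'"
proof -
  obtain f g where f: "(f, g) \<in> trip_hom B N W \<eta> N' W' \<eta>'" "bij_betw f (car N) (car N')"
    "bij_betw g (car W) (car W')" using assms(3) by (auto simp: trip_iso_def)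
  show "vdim N = vdim N'"
    by (rule vdim_bij[OF is_tripD(2)[OF assms(1)] is_tripD(2)[OF assms(2)]
          hom_linear_on[OF trip_homD(1)[OF f(1)]] f(2)])
  show "vdim W = vdim W'"
    by (rule vdim_bij[OF is_tripD(3)[OF assms(1)] is_tripD(3)[OF assms(2)]
          lin_linear_on[OF trip_homD(2)[OF f(1)]] f(3)])
qed

text \<open>Back from \<open>nmod Xs m\<close> to coordinate modules, where isomorphism classes are counted.\<close>

lemma mixed_brick_of_trip:
  fixes B :: "('k::field, 'b::ab_group_add) algebra" and E :: "('k, 'b, 'e::ab_group_add) rmodule"
    and W :: "('k, nat \<Rightarrow> 'k) space"
  assumes E: "fd_module B E" and T: "is_trip B E N W \<eta>" and s: "scalar_endos B N W \<eta>"
    and n: "nonzero N" "nonzero W"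
  obtains T' :: "('k, 'b, 'e) triple" where "mixed_brick B E T'" "trip_iso B N W \<eta> (tmod T') (tspc T') (tmap T')"
proof -
  obtain T' :: "('k, 'b, 'e) triple" where T': "is_trip B E (tmod T') (tspc T') (tmap T')"
    "trip_iso B N W \<eta> (tmod T') (tspc T') (tmap T')"
    by (rule trip_to_triple[OF E T]) (rule that)
  have "vdim (tmod T') \<noteq> 0" "vdim (tspc T') \<noteq> 0"
    using trip_iso_vdim[OF T T'] n nonzero_iff_vdim[OF is_tripD(2)[OF T]] nonzero_iff_vdim[OF is_tripD(3)[OF T]]
    by simp_all
  then have "mixed_brick B E T'"
    using T' scalar_endos_iso[OF E T T' s] nonzero_iff_vdim[OF is_tripD(2)[OF T'(1)]]
      nonzero_iff_vdim[OF is_tripD(3)[OF T'(1)]] by (simp add: mixed_brick_iff)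
  then show thesis using that T'(2) by blast
qed

text \<open>The admissibility inequality compares \<open>vdim P\<close> with \<open>vdim Q + 1\<close>.\<close>

lemma dimension_excess:
  fixes r l h :: nat
  shows "int r - 1 \<le> int l * (int h - int l) \<longleftrightarrow> r + l * l \<le> Suc (l * h)"
    "int r - 1 = int l * (int h - int l) \<longleftrightarrow> r + l * l = Suc (l * h)"
proof -
  have *: "int l * (int h - int l) = int (l * h) - int (l * l)" by (simp add: algebra_simps)
  show "int r - 1 \<le> int l * (int h - int l) \<longleftrightarrow> r + l * l \<le> Suc (l * h)"
    "int r - 1 = int l * (int h - int l) \<longleftrightarrow> r + l * l = Suc (l * h)"
    unfolding * by linarith+
qed

lemma scalar_endos_admissible:
  fixes Xs :: "('k::field, 'b::ab_group_add) cmodule list"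
  assumes E: "fd_module B E" and reps: "visible_reps B E Xs" and m: "length m = length Xs"
    and T: "is_trip B E (nmod Xs m) W \<eta>" and s: "scalar_endos B (nmod Xs m) W \<eta>"
    and n: "nonzero (nmod Xs m)" "nonzero W"
  shows "admissible B E Xs (m, vdim W)" "realized B E Xs (m, vdim W)"
proof -
  interpret triple_family B E "nmod Xs m" W
    using E T by unfold_locales (auto simp: is_trip_def)
  have \<eta>: "\<eta> \<in> lin W H" by (rule is_tripD(4)[OF T])
  have "vdim W \<le> vdim H"
    by (rule vdim_le_of_inj[OF W fdH lin_linear_on[OF \<eta>] scalar_endos_inj[OF T n(1) s]])
  moreover have "1 \<le> vdim W" using n(2) nonzero_iff_vdim[OF W] by simp
  moreover have "\<exists>i<length m. m ! i \<noteq> 0" using n(1) nonzero_nmod(1)[OF reps m] by simp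
  ultimately show "admissible B E Xs (m, vdim W)"
    using scalar_endos_dimension(1)[OF n(1) \<eta> s] m
    by (simp add: admissible_def h_dim_def r_dim_def dimension_excess vdimP vdimQ)
  show "realized B E Xs (m, vdim W)" by (rule realizedI[OF E T n(1) s])
qed

lemma realized_admissible_trip:
  fixes Xs :: "('k::field, 'b::ab_group_add) cmodule list"
  assumes E: "fd_module B E" and reps: "visible_reps B E Xs"
    and a: "admissible B E Xs (m, l)" and r: "realized B E Xs (m, l)"
  obtains \<eta> where "is_trip B E (nmod Xs m) (coord_space l) \<eta>"
    "scalar_endos B (nmod Xs m) (coord_space l) \<eta>"
    "nonzero (nmod Xs m)" "nonzero (coord_space l :: ('k, nat \<Rightarrow> 'k) space)" "length m = length Xs"
proof -
  have m: "length m = length Xs" "\<exists>i<length m. m ! i \<noteq> 0" "1 \<le> l"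
    using a by (auto simp: admissible_def)
  have mN: "fd_module B (nmod Xs m)" by (rule nmod_fd_module[OF visible_reps_fd[OF reps]])
  have "nonzero (nmod Xs m)" using nonzero_nmod(1)[OF reps m(1)] m(2) by simp
  moreover have "nonzero (coord_space l :: ('k, nat \<Rightarrow> 'k) space)"
    using nonzero_iff_vdim[OF fd_coord_space(1)] m(3) fd_coord_space(2) by (metis not_one_le_zero)
  ultimately show thesis using realizedE[OF E mN r] that m(1) by metis
qed

text \<open>The label of a mixed brick is its pair; \<open>critical_unique\<close> shows that it determines the brick.\<close>

lemma mixed_finite_if_critical:
  fixes E :: "('k::alg_closed_field, 'b::ab_group_add, 'e::ab_group_add) rmodule"
  assumes E: "fd_module B E" and reps: "visible_reps B E Xs"
    and fin: "finite {p. admissible B E Xs p \<and> realized B E Xs p}"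
    and crit: "\<And>p. admissible B E Xs p \<Longrightarrow> realized B E Xs p \<Longrightarrow> critical B E Xs p"
  shows "fin_many (mixed_brick B E) (triple_iso B)"
proof -
  define S where "S = (\<lambda>(T :: ('k, 'b, 'e) triple) (m, l). vdim (tspc T) = l \<and> length m = length Xs \<and>
    (\<exists>\<eta>. is_trip B E (nmod Xs m) (coord_space l) \<eta> \<and>
      trip_iso B (tmod T) (tspc T) (tmap T) (nmod Xs m) (coord_space l) \<eta>))"
  show ?thesis
  proof (rule fin_manyI[OF fin, where S = S])
    fix T assume T: "mixed_brick B E T"
    let ?l = "vdim (tspc T)"
    obtain m \<eta> where m: "length m = length Xs" "is_trip B E (nmod Xs m) (coord_space ?l) \<eta>"
      "trip_iso B (tmod T) (tspc T) (tmap T) (nmod Xs m) (coord_space ?l) \<eta>"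
      by (rule mixed_brick_to_nmod[OF E reps T]) (rule that)
    have t: "is_trip B E (tmod T) (tspc T) (tmap T)" "nonzero (tmod T)" "nonzero (tspc T)"
      "scalar_endos B (tmod T) (tspc T) (tmap T)" using T by (auto simp: mixed_brick_iff)
    have s: "scalar_endos B (nmod Xs m) (coord_space ?l) \<eta>"
      by (rule scalar_endos_iso[OF E t(1) m(2,3) t(4)])
    have n: "nonzero (nmod Xs m)" "nonzero (coord_space ?l :: ('k, nat \<Rightarrow> 'k) space)"
      using trip_iso_vdim[OF t(1) m(2,3)] t(2,3) nonzero_iff_vdim is_tripD(2,3)[OF t(1)] is_tripD(2,3)[OF m(2)]
      by metis+
    have "(m, ?l) \<in> {p. admissible B E Xs p \<and> realized B E Xs p}"
      using scalar_endos_admissible[OF E reps m(1,2) s n] by (simp add: fd_coord_space(2))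
    then show "\<exists>p\<in>{p. admissible B E Xs p \<and> realized B E Xs p}. S T p"
      by (rule bexI[rotated]) (use m in \<open>auto simp: S_def\<close>)
  next
    fix T T' p
    assume T: "mixed_brick B E T" "mixed_brick B E T'"
      and p: "p \<in> {p. admissible B E Xs p \<and> realized B E Xs p}"
      and S: "S T p" "S T' p"
    obtain m l where ml: "p = (m, l)" by (cases p)
    let ?N = "nmod Xs m" and ?W = "coord_space l :: ('k, nat \<Rightarrow> 'k) space"
    obtain \<eta> where \<eta>: "is_trip B E ?N ?W \<eta>" "trip_iso B (tmod T) (tspc T) (tmap T) ?N ?W \<eta>"
      using S(1) ml by (auto simp: S_def)
    obtain \<eta>' where \<eta>': "is_trip B E ?N ?W \<eta>'" "trip_iso B (tmod T') (tspc T') (tmap T') ?N ?W \<eta>'"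
      using S(2) ml by (auto simp: S_def)
    have t: "is_trip B E (tmod T) (tspc T) (tmap T)" "scalar_endos B (tmod T) (tspc T) (tmap T)"
      and t': "is_trip B E (tmod T') (tspc T') (tmap T')" "scalar_endos B (tmod T') (tspc T') (tmap T')"
      and n: "nonzero (tmod T)"
      using T by (auto simp: mixed_brick_iff)
    have nN: "nonzero ?N"
      using trip_iso_vdim(1)[OF t(1) \<eta>] n nonzero_iff_vdim is_tripD(2)[OF t(1)] is_tripD(2)[OF \<eta>(1)] by metis
    interpret triple_family B E ?N ?W
      using E \<eta>(1) by unfold_locales (auto simp: is_trip_def)
    have "critical B E Xs (m, l)" using crit p ml by blast
    then have "vdim P = Suc (vdim Q)"
      by (simp add: critical_def h_dim_def r_dim_def dimension_excess vdimP vdimQ fd_coord_space(2))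
    then have "trip_iso B ?N ?W \<eta> ?N ?W \<eta>'"
      by (intro critical_unique[OF infinite_alg_closed nN] is_tripD(4)[OF \<eta>(1)] is_tripD(4)[OF \<eta>'(1)]
          scalar_endos_iso[OF E t(1) \<eta> t(2)] scalar_endos_iso[OF E t'(1) \<eta>' t'(2)])
    then show "triple_iso B T T'"
      unfolding triple_iso_trip_iso
      by (rule trip_iso_trans[OF trip_iso_trans[OF \<eta>(2) _ sN W] trip_iso_sym[OF t'(1) \<eta>'] sN W])
  next
    fix T T' T''
    assume "mixed_brick B E T" "mixed_brick B E T'"
    then have b: "triple_brick B E T" "triple_brick B E T'" by (simp_all add: mixed_brick_def)
    show "triple_iso B T T' \<Longrightarrow> triple_iso B T' T" by (rule triple_iso_equiv(2)[OF E b])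
    show "triple_iso B T T' \<Longrightarrow> triple_iso B T' T'' \<Longrightarrow> triple_iso B T T''"
      by (rule triple_iso_equiv(3)[OF E b(2)])
  qed
qed

text \<open>Finitely many mixed bricks have bounded dimension, so only finitely many pairs occur. A
  non-critical pair would by \<open>noncritical_infinite\<close> yield infinitely many points with finite-to-one isomorphism
  classes; among finitely many classes one contains infinitely many of them.\<close>

lemma critical_if_mixed_finite:
  fixes Xs :: "('k::alg_closed_field, 'b::ab_group_add) cmodule list"
  assumes E: "fd_module B E" and reps: "visible_reps B E Xs"
    and fin: "fin_many (mixed_brick B E) (triple_iso B)"
  shows "finite {p. admissible B E Xs p \<and> realized B E Xs p}"
    "\<And>p. admissible B E Xs p \<Longrightarrow> realized B E Xs p \<Longrightarrow> critical B E Xs p"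
proof -
  obtain F where F: "finite F" "\<And>T. T \<in> F \<Longrightarrow> mixed_brick B E T"
    "\<And>T. mixed_brick B E T \<Longrightarrow> \<exists>T'\<in>F. triple_iso B T T'"
    using fin_many_reps[OF fin] triple_iso_equiv(1)[OF E] by (metis mixed_brick_def)
  let ?A = "{p. admissible B E Xs p \<and> realized B E Xs p}"
  let ?M = "\<lambda>T. {m. set m \<subseteq> {..vdim (tmod T)} \<and> length m = length Xs}"
  have "?A \<subseteq> (\<Union>T\<in>F. ?M T \<times> {vdim (tspc T)})"
  proof
    fix p assume p: "p \<in> ?A"
    obtain m l where ml: "p = (m, l)" by (cases p)
    let ?N = "nmod Xs m" and ?W = "coord_space l :: ('k, nat \<Rightarrow> 'k) space"
    obtain \<eta> where \<eta>: "is_trip B E ?N ?W \<eta>" "scalar_endos B ?N ?W \<eta>" "nonzero ?N" "nonzero ?W"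
      "length m = length Xs"
      using realized_admissible_trip[OF E reps] p ml by blast
    obtain T where T: "mixed_brick B E T" "trip_iso B ?N ?W \<eta> (tmod T) (tspc T) (tmap T)"
      by (rule mixed_brick_of_trip[OF E \<eta>(1-4)]) (rule that)
    obtain T' where T': "T' \<in> F" "triple_iso B T T'" using F(3)[OF T(1)] by blast
    have t: "is_trip B E (tmod T) (tspc T) (tmap T)" "is_trip B E (tmod T') (tspc T') (tmap T')"
      using T(1) F(2)[OF T'(1)] by (auto simp: mixed_brick_iff)
    have v: "vdim ?N = vdim (tmod T')" "l = vdim (tspc T')"
      using trip_iso_vdim[OF \<eta>(1) t(1) T(2)] trip_iso_vdim[OF t T'(2)[unfolded triple_iso_trip_iso]]
      by (simp_all add: fd_coord_space(2))
    have "m ! i \<le> vdim (tmod T')" if "i < length Xs" for i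
      using nonzero_nmod(2)[OF reps \<eta>(5) that] v(1) by simp
    then have "set m \<subseteq> {..vdim (tmod T')}" using \<eta>(5) by (auto simp: in_set_conv_nth)
    then show "p \<in> (\<Union>T\<in>F. ?M T \<times> {vdim (tspc T)})" using T'(1) \<eta>(5) v(2) ml by auto
  qed
  moreover have "finite (\<Union>T\<in>F. ?M T \<times> {vdim (tspc T)})"
    using F(1) by (intro finite_UN_I finite_cartesian_product finite_lists_length_eq) auto
  ultimately show "finite ?A" by (rule finite_subset)
  fix p assume a: "admissible B E Xs p" and r: "realized B E Xs p"
  obtain m l where ml: "p = (m, l)" by (cases p)
  let ?N = "nmod Xs m" and ?W = "coord_space l :: ('k, nat \<Rightarrow> 'k) space"
  obtain \<eta> where \<eta>: "is_trip B E ?N ?W \<eta>" "scalar_endos B ?N ?W \<eta>" "nonzero ?N" "nonzero ?W"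
    "length m = length Xs"
    using realized_admissible_trip[OF E reps] a r ml by blast
  interpret triple_family B E ?N ?W
    using E \<eta>(1) by unfold_locales (auto simp: is_trip_def)
  show "critical B E Xs p"
  proof (rule ccontr)
    assume nc: "\<not> critical B E Xs p"
    have "vdim P \<le> Suc (vdim Q)" by (rule scalar_endos_dimension(1)[OF \<eta>(3) is_tripD(4)[OF \<eta>(1)] \<eta>(2)])
    moreover have "vdim P \<noteq> Suc (vdim Q)"
      using nc a by (simp add: critical_def h_dim_def r_dim_def dimension_excess vdimP vdimQ fd_coord_space(2) ml)
    ultimately have lt: "vdim P < Suc (vdim Q)" by simp
    obtain \<Phi> G where G: "infinite G" "\<And>t. t \<in> G \<Longrightarrow> \<Phi> t \<in> lin ?W H"
      "\<And>t. t \<in> G \<Longrightarrow> scalar_endos B ?N ?W (\<Phi> t)"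
      "\<And>t. t \<in> G \<Longrightarrow> finite {t' :: 'k. trip_iso B ?N ?W (\<Phi> t) ?N ?W (\<Phi> t')}"
      by (rule noncritical_infinite[OF infinite_alg_closed \<eta>(3) is_tripD(4)[OF \<eta>(1)] \<eta>(2) lt]) (rule that)
    have "\<exists>T'\<in>F. trip_iso B ?N ?W (\<Phi> t) (tmod T') (tspc T') (tmap T')" if t: "t \<in> G" for t
    proof -
      obtain T where T: "mixed_brick B E T" "trip_iso B ?N ?W (\<Phi> t) (tmod T) (tspc T) (tmap T)"
        by (rule mixed_brick_of_trip[OF E trip[OF G(2)[OF t]] G(3)[OF t] \<eta>(3,4)]) (rule that)
      obtain T' where T': "T' \<in> F" "triple_iso B T T'" using F(3)[OF T(1)] by blast
      have "is_trip B E (tmod T) (tspc T) (tmap T)" using T(1) by (simp add: mixed_brick_iff)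
      from trip_iso_trans[OF T(2) T'(2)[unfolded triple_iso_trip_iso] is_tripD(2,3)[OF this]] T'(1)
      show ?thesis by blast
    qed
    then obtain \<rho> where \<rho>: "\<And>t. t \<in> G \<Longrightarrow> \<rho> t \<in> F"
      "\<And>t. t \<in> G \<Longrightarrow> trip_iso B ?N ?W (\<Phi> t) (tmod (\<rho> t)) (tspc (\<rho> t)) (tmap (\<rho> t))" by metis
    have "finite (\<rho> ` G)" using F(1) \<rho>(1) by (meson finite_subset image_subsetI)
    then obtain s where s: "s \<in> G" "infinite {t \<in> G. \<rho> t = \<rho> s}"
      using pigeonhole_infinite[OF G(1)] by blast
    have "{t \<in> G. \<rho> t = \<rho> s} \<subseteq> {t'. trip_iso B ?N ?W (\<Phi> s) ?N ?W (\<Phi> t')}"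
    proof (rule subsetI, rule CollectI)
      fix t assume "t \<in> {t \<in> G. \<rho> t = \<rho> s}"
      then have t: "t \<in> G" "\<rho> t = \<rho> s" by simp_all
      have T: "is_trip B E (tmod (\<rho> s)) (tspc (\<rho> s)) (tmap (\<rho> s))"
        using F(2)[OF \<rho>(1)[OF s(1)]] by (simp add: mixed_brick_iff)
      have "trip_iso B (tmod (\<rho> s)) (tspc (\<rho> s)) (tmap (\<rho> s)) ?N ?W (\<Phi> t)"
        using \<rho>(2)[OF t(1)] unfolding t(2) by (rule trip_iso_sym[OF trip[OF G(2)[OF t(1)]] T])
      from trip_iso_trans[OF \<rho>(2)[OF s(1)] this is_tripD(2,3)[OF T]]
      show "trip_iso B ?N ?W (\<Phi> s) ?N ?W (\<Phi> t)" .
    qed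
    then show False using s(2) finite_subset[OF _ G(4)[OF s(1)]] by blast
  qed
qed

section \<open>Modules over the one-point extension\<close>

lemma iso_equiv:
  shows "fd_module A M \<Longrightarrow> iso A M M"
    "fd_module A M \<Longrightarrow> iso A M N \<Longrightarrow> iso A N M"
    "fd_module A N \<Longrightarrow> iso A M N \<Longrightarrow> iso A N L \<Longrightarrow> iso A M L"
proof -
  show "iso A M M" if "fd_module A M"
    by (rule iso_bijI[OF homothety_hom[OF that] bij_homothety[OF fd_module_space[OF that]]])
  show "iso A N M" if M: "fd_module A M" and i: "iso A M N"
  proof -
    obtain f where f: "f \<in> hom A M N" "bij_betw f (car M) (car N)" using i by (auto simp: iso_def)
    show ?thesis by (rule hom_inverse[OF f M]) (rule iso_bijI)
  qed
  show "iso A M L" if N: "fd_module A N" and i: "iso A M N" "iso A N L"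
  proof -
    obtain f where f: "f \<in> hom A M N" "bij_betw f (car M) (car N)" using i(1) by (auto simp: iso_def)
    obtain g where g: "g \<in> hom A N L" "bij_betw g (car N) (car L)" using i(2) by (auto simp: iso_def)
    show ?thesis
      by (rule iso_bijI[OF hom_comp[OF f(1) g(1) fd_module_space[OF N]] bij_betw_trans[OF f(2) g(2)]])
  qed
qed

text \<open>Restriction of scalars along the projection of the one-point extension onto \<open>B\<close>.\<close>

definition inflate :: "('k, 'b, 'v) rmodule \<Rightarrow> ('k, 'b \<times> 'e \<times> 'k, 'v) rmodule" where
  "inflate N = \<lparr>car = car N, smul = smul N, act = (\<lambda>x (b, e, r). act N x b)\<rparr>"

text \<open>The triple of a module \<open>M\<close>: both components are cut out of \<open>M\<close> by the diagonal idempotents.\<close>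

definition triple_of :: "('k::field, 'b::ab_group_add) algebra \<Rightarrow> ('k, 'b, 'e::ab_group_add) rmodule \<Rightarrow>
    ('k, 'b \<times> 'e \<times> 'k) cmodule \<Rightarrow> ('k, 'b, 'e) triple" where
  "triple_of B E M =
    (let W = {x \<in> car M. act M x (0, 0, 1) = x} in
     \<lparr>tmod = \<lparr>car = {x \<in> car M. act M x (unt B, 0, 0) = x}, smul = smul M, act = (\<lambda>x b. act M x (b, 0, 0))\<rparr>,
      tspc = \<lparr>car = W, smul = smul M\<rparr>,
      tmap = (\<lambda>w e. if w \<in> W \<and> e \<in> car E then act M w (0, e, 0) else 0)\<rparr>)"

locale one_point =
  fixes B :: "('k::field, 'b::ab_group_add) algebra"
    and E :: "('k, 'b, 'e::ab_group_add) rmodule"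
  assumes B: "fd_algebra B" and E: "fd_module B E"
begin

abbreviation Lam where "Lam \<equiv> one_point_ext B E"

lemma sB: "fd_space B" using B by (simp add: fd_algebra_def)
lemma sE: "fd_space E" by (rule fd_module_space[OF E])

lemma B_alg:
  "unt B \<in> car B"
  "a \<in> car B \<Longrightarrow> mul B (unt B) a = a" "a \<in> car B \<Longrightarrow> mul B a (unt B) = a"
  "a \<in> car B \<Longrightarrow> b \<in> car B \<Longrightarrow> mul B a b \<in> car B"
  using B by (simp_all add: fd_algebra_def)

lemma B_zero:
  assumes "a \<in> car B"
  shows "mul B 0 a = 0" "mul B a 0 = 0"
proof -
  have "mul B (smul B 0 a) a = smul B 0 (mul B a a)" "mul B a (smul B 0 a) = smul B 0 (mul B a a)"
    using B assms unfolding fd_algebra_def by blast+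
  then show "mul B 0 a = 0" "mul B a 0 = 0" by (simp_all add: fd_smul[OF sB])
qed

lemma E_zero: "b \<in> car B \<Longrightarrow> act E 0 b = 0" "e \<in> car E \<Longrightarrow> act E e 0 = 0"
proof -
  show "b \<in> car B \<Longrightarrow> act E 0 b = 0" by (rule act_0[OF E])
  assume "e \<in> car E"
  then show "act E e 0 = 0"
    using fd_moduleD(4)[OF E, of e 0 0] fd_car(1)[OF sB] by (simp add: fd_smul[OF sB] fd_smul[OF sE])
qed

lemma Lam_simps:
  "(b, e, r) \<in> car Lam \<longleftrightarrow> b \<in> car B \<and> e \<in> car E" "unt Lam = (unt B, 0, 1)"
  "smul Lam c (b, e, r) = (smul B c b, smul E c e, c * r)"
  "mul Lam (b, e, r) (b', e', r') = (mul B b b', act E e b' + smul E r e', r * r')"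
  by (simp_all add: one_point_ext_def)

lemmas car0 = fd_car(1)[OF sB] fd_car(1)[OF sE]
lemmas zero_simps = car0 B_alg B_zero E_zero fd_moduleD(1,2)[OF E] fd_smul(4,5,6)[OF sE] fd_smul(4,5,6)[OF sB]

lemma Lam_act:
  assumes M: "fd_module Lam M" and x: "x \<in> car M"
  shows "b \<in> car B \<Longrightarrow> e \<in> car E \<Longrightarrow> act M x (b, e, r) \<in> car M"
    "b \<in> car B \<Longrightarrow> e \<in> car E \<Longrightarrow> b' \<in> car B \<Longrightarrow> e' \<in> car E \<Longrightarrow>
      act M x (b + b', e + e', r + r') = act M x (b, e, r) + act M x (b', e', r')"
    "b \<in> car B \<Longrightarrow> e \<in> car E \<Longrightarrow> act M x (smul B c b, smul E c e, c * r) = smul M c (act M x (b, e, r))"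
    "b \<in> car B \<Longrightarrow> e \<in> car E \<Longrightarrow> b' \<in> car B \<Longrightarrow> e' \<in> car E \<Longrightarrow>
      act M (act M x (b, e, r)) (b', e', r') = act M x (mul B b b', act E e b' + smul E r e', r * r')"
    "act M x (unt B, 0, 1) = x"
    "act M x (0, 0, 0) = 0"
    "b \<in> car B \<Longrightarrow> e \<in> car E \<Longrightarrow> act M x (b, e, r) = act M x (b, 0, 0) + act M x (0, e, 0) + act M x (0, 0, r)"
    "act M x (0, 0, r) = smul M r (act M x (0, 0, 1))"
proof -
  note d = fd_moduleD[OF M]
  show "b \<in> car B \<Longrightarrow> e \<in> car E \<Longrightarrow> act M x (b, e, r) \<in> car M"
    using d(2)[OF x, of "(b, e, r)"] by (simp add: Lam_simps)
  show add: "b \<in> car B \<Longrightarrow> e \<in> car E \<Longrightarrow> b' \<in> car B \<Longrightarrow> e' \<in> car E \<Longrightarrow>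
      act M x (b + b', e + e', r + r') = act M x (b, e, r) + act M x (b', e', r')" for b e r b' e' r'
    using d(6)[OF x, of "(b, e, r)" "(b', e', r')"] by (simp add: Lam_simps)
  show sc: "b \<in> car B \<Longrightarrow> e \<in> car E \<Longrightarrow>
      act M x (smul B c b, smul E c e, c * r) = smul M c (act M x (b, e, r))" for b e r c
    using d(4)[OF x, of "(b, e, r)" c] by (simp add: Lam_simps)
  show "b \<in> car B \<Longrightarrow> e \<in> car E \<Longrightarrow> b' \<in> car B \<Longrightarrow> e' \<in> car E \<Longrightarrow>
      act M (act M x (b, e, r)) (b', e', r') = act M x (mul B b b', act E e b' + smul E r e', r * r')"
    using d(7)[OF x, of "(b, e, r)" "(b', e', r')"] by (simp add: Lam_simps)
  show "act M x (unt B, 0, 1) = x" using d(1)[OF x] by (simp add: Lam_simps)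
  show "act M x (0, 0, 0) = 0"
    using sc[OF car0, of 0 0] by (simp add: zero_simps fd_smul[OF fd_module_space[OF M]])
  show "act M x (b, e, r) = act M x (b, 0, 0) + act M x (0, e, 0) + act M x (0, 0, r)"
    if "b \<in> car B" "e \<in> car E"
    using add[of b 0 0 e 0 0] add[of b e 0 0 0 r] that by (simp add: zero_simps)
  show "act M x (0, 0, r) = smul M r (act M x (0, 0, 1))"
    using sc[OF car0, of r 1] by (simp add: zero_simps)
qed

lemma fd_inflate:
  assumes N: "fd_module B N"
  shows "fd_module Lam (inflate N :: ('k, 'b \<times> 'e \<times> 'k, 'v::ab_group_add) rmodule)"
  using N by (auto simp: fd_module_def inflate_def Lam_simps fd_space_def)

lemma hom_inflate: "hom Lam (inflate N) (inflate N') = hom B N N'"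
proof (rule set_eqI)
  fix f
  have act: "act (inflate L) x (b, e, r) = act L x b" for L :: "('k, 'b, 'z) rmodule" and x b e r
    by (simp add: inflate_def)
  have car: "car (inflate L) = car L" for L :: "('k, 'b, 'z) rmodule" by (simp add: inflate_def)
  have lin: "lin (inflate N) (inflate N') = lin N N'" by (simp add: lin_def inflate_def)
  have "(\<forall>x\<in>car N. \<forall>a\<in>car Lam. f (act (inflate N) x a) = act (inflate N') (f x) a)
      \<longleftrightarrow> (\<forall>x\<in>car N. \<forall>b\<in>car B. f (act N x b) = act N' (f x) b)" (is "?L \<longleftrightarrow> ?R")
  proof
    assume h: ?L
    show ?R
    proof (intro ballI)
      fix x b assume "x \<in> car N" "b \<in> car B"
      then show "f (act N x b) = act N' (f x) b"
        using h[rule_format, of x "(b, 0, 0)"] car0(2) by (simp add: Lam_simps act)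
    qed
  next
    assume h: ?R
    show ?L
    proof (intro ballI)
      fix x a assume x: "x \<in> car N" and a: "a \<in> car Lam"
      obtain b e r where ber: "a = (b, e, r)" by (cases a)
      then show "f (act (inflate N) x a) = act (inflate N') (f x) a"
        using h x a by (simp add: Lam_simps act)
    qed
  qed
  then show "f \<in> hom Lam (inflate N) (inflate N') \<longleftrightarrow> f \<in> hom B N N'"
    unfolding hom_def lin car by simp
qed

lemma inflate_brick: "brick B N \<Longrightarrow> brick Lam (inflate N :: ('k, 'b \<times> 'e \<times> 'k, 'v::ab_group_add) rmodule)"
proof -
  assume b: "brick B N"
  have "homothety (inflate N :: ('k, 'b \<times> 'e \<times> 'k, 'v) rmodule) = homothety N"
    by (intro ext) (simp add: homothety_def inflate_def)
  moreover have "nonzero (inflate N :: ('k, 'b \<times> 'e \<times> 'k, 'v) rmodule) = nonzero N"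
    by (simp add: nonzero_def inflate_def)
  ultimately show ?thesis
    using b fd_inflate[of N] hom_inflate[of N N] by (simp add: brick_def)
qed

lemma inflate_iso: "iso Lam (inflate N :: ('k, 'b \<times> 'e \<times> 'k, 'v::ab_group_add) rmodule)
    (inflate N' :: ('k, 'b \<times> 'e \<times> 'k, 'w::ab_group_add) rmodule) \<longleftrightarrow> iso B N N'"
  using hom_inflate[of N N'] by (simp add: iso_def) (simp add: inflate_def)

lemma brick_finite_base:
  assumes "brick_finite Lam"
  shows "brick_finite B"
proof -
  have fd: "fd_module Lam M" if "brick Lam M" for M :: "('k, 'b \<times> 'e \<times> 'k) cmodule"
    using that by (simp add: brick_def)
  have fd': "fd_module B N" if "brick B N" for N :: "('k, 'b) cmodule" using that by (simp add: brick_def)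
  obtain F :: "('k, 'b \<times> 'e \<times> 'k) cmodule set" where F: "finite F" "\<And>M. M \<in> F \<Longrightarrow> brick Lam M"
    "\<And>M :: ('k, 'b \<times> 'e \<times> 'k) cmodule. brick Lam M \<Longrightarrow> \<exists>M'\<in>F. iso Lam M M'"
    by (rule fin_many_reps[OF assms[unfolded brick_finite_def] iso_equiv(1)[OF fd]], assumption)
      (rule that)
  show ?thesis
    unfolding brick_finite_def
  proof (rule fin_manyI[OF F(1), where S = "\<lambda>N. iso Lam (inflate N)"])
    show "\<exists>M\<in>F. iso Lam (inflate N) M" if "brick B N" for N :: "('k, 'b) cmodule"
      by (rule F(3)[OF inflate_brick[OF that]])
    fix N N' :: "('k, 'b) cmodule" and M assume N: "brick B N" "brick B N'" and M: "M \<in> F"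
      and i: "iso Lam (inflate N) M" "iso Lam (inflate N') M"
    have "iso Lam M (inflate N')" by (rule iso_equiv(2)[OF fd[OF inflate_brick[OF N(2)]] i(2)])
    then have "iso Lam (inflate N) (inflate N')" by (rule iso_equiv(3)[OF fd[OF F(2)[OF M]] i(1)])
    then show "iso B N N'" by (simp only: inflate_iso)
  qed (use iso_equiv(2,3) fd' in blast)+
qed

lemma triple_of_simps:
  "x \<in> car (tmod (triple_of B E M)) \<longleftrightarrow> x \<in> car M \<and> act M x (unt B, 0, 0) = x"
  "smul (tmod (triple_of B E M)) = smul M"
  "act (tmod (triple_of B E M)) x b = act M x (b, 0, 0)"
  "x \<in> car (tspc (triple_of B E M)) \<longleftrightarrow> x \<in> car M \<and> act M x (0, 0, 1) = x"
  "smul (tspc (triple_of B E M)) = smul M"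
  "tmap (triple_of B E M) w e =
     (if w \<in> car (tspc (triple_of B E M)) \<and> e \<in> car E then act M w (0, e, 0) else 0)"
  by (simp_all add: triple_of_def Let_def)

context
  fixes M :: "('k, 'b \<times> 'e \<times> 'k) cmodule"
  assumes M: "fd_module Lam M"
begin

lemma sM: "fd_space M" by (rule fd_module_space[OF M])

lemma act_sum: "x \<in> car M \<Longrightarrow> y \<in> car M \<Longrightarrow> b \<in> car B \<Longrightarrow> e \<in> car E \<Longrightarrow>
    act M (x + y) (b, e, r) = act M x (b, e, r) + act M y (b, e, r)"
  "x \<in> car M \<Longrightarrow> b \<in> car B \<Longrightarrow> e \<in> car E \<Longrightarrow>
    act M (smul M c x) (b, e, r) = smul M c (act M x (b, e, r))"
  using fd_moduleD(3,5)[OF M] by (simp_all add: Lam_simps)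

lemma act_idem_subspace:
  assumes "b \<in> car B" "e \<in> car E"
  shows "module.subspace (smul M) {x \<in> car M. act M x (b, e, r) = x}"
proof -
  interpret V: vector_space "smul M" by (rule fd_vs[OF sM])
  have "act M 0 (b, e, r) = 0" using act_0[OF M] assms by (simp add: Lam_simps)
  then show ?thesis
    unfolding V.subspace_def using assms by (auto simp: fd_car[OF sM] act_sum)
qed

lemma triple_of_components:
  assumes x: "x \<in> car M"
  shows "act M x (unt B, 0, 0) \<in> car (tmod (triple_of B E M))"
    "act M x (0, 0, 1) \<in> car (tspc (triple_of B E M))"
    "act M x (unt B, 0, 0) + act M x (0, 0, 1) = x"
  using Lam_act(4)[OF M x, of "unt B" 0 "unt B" 0 0 0] Lam_act(4)[OF M x, of 0 0 0 0 1 1]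
    Lam_act(7)[OF M x, of "unt B" 0 1] Lam_act(1)[OF M x] Lam_act(5,6)[OF M x]
  by (simp_all add: triple_of_simps zero_simps)

lemma tmod_act:
  assumes x: "x \<in> car (tmod (triple_of B E M))" and b: "b \<in> car B" "e \<in> car E"
  shows "act M x (b, e, r) = act M x (b, 0, 0)"
  using Lam_act(4)[OF M, of x "unt B" 0 b e 0 r] x b by (simp add: triple_of_simps zero_simps)

lemma tspc_act:
  assumes x: "x \<in> car (tspc (triple_of B E M))" and b: "b \<in> car B" "e \<in> car E"
  shows "act M x (b, e, r) = act M x (0, e, 0) + smul M r x"
proof -
  have xM: "x \<in> car M" "act M x (0, 0, 1) = x" using x by (simp_all add: triple_of_simps)
  have "act M x (b, e, r) = act M x (0, e, r)"
    using Lam_act(4)[OF M xM(1), of 0 0 b e 1 r] xM(2) b by (simp add: zero_simps)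
  also have "\<dots> = 0 + act M x (0, e, 0) + act M x (0, 0, r)"
    using Lam_act(7)[OF M xM(1) car0(1) b(2), of r] by (simp only: Lam_act(6)[OF M xM(1)])
  also have "act M x (0, 0, r) = smul M r (act M x (0, 0, 1))" by (rule Lam_act(8)[OF M xM(1)])
  finally show ?thesis by (simp only: xM(2) add_0_left)
qed

lemma tmap_car:
  assumes w: "w \<in> car (tspc (triple_of B E M))" and e: "e \<in> car E"
  shows "act M w (0, e, 0) \<in> car (tmod (triple_of B E M))"
proof -
  have wM: "w \<in> car M" using w by (simp add: triple_of_simps)
  show ?thesis
    using Lam_act(4)[OF M wM, of 0 e "unt B" 0 0 0] Lam_act(1)[OF M wM car0(1) e] e
    by (simp add: triple_of_simps zero_simps)
qed

lemma fd_tmod: "fd_module B (tmod (triple_of B E M))"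
proof -
  let ?N = "tmod (triple_of B E M)"
  have "fd_space (M\<lparr>car := {x \<in> car M. act M x (unt B, 0, 0) = x}\<rparr>)"
    by (rule fd_sub[OF sM _ act_idem_subspace]) (auto simp: zero_simps)
  then have sN: "fd_space ?N" by (simp add: fd_space_def triple_of_def Let_def)
  show ?thesis
    unfolding fd_module_def
  proof (intro conjI ballI allI sN)
    fix x assume x: "x \<in> car ?N"
    then have xM: "x \<in> car M" by (simp add: triple_of_simps)
    show "act ?N x (unt B) = x" using x by (simp add: triple_of_simps)
    fix a assume a: "a \<in> car B"
    show "act ?N x a \<in> car ?N"
      using Lam_act(4)[OF M xM, of a 0 "unt B" 0 0 0] Lam_act(1)[OF M xM a car0(2)] a
      by (simp add: triple_of_simps zero_simps)
    show "act ?N (smul ?N r x) a = smul ?N r (act ?N x a)" for r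
      using act_sum(2)[OF xM a car0(2)] by (simp add: triple_of_simps)
    show "act ?N x (smul B r a) = smul ?N r (act ?N x a)" for r
      using Lam_act(3)[OF M xM a car0(2), of r 0] by (simp add: triple_of_simps zero_simps)
    show "act ?N (x + y) a = act ?N x a + act ?N y a" if "y \<in> car ?N" for y
      using act_sum(1)[OF xM _ a car0(2)] that by (simp add: triple_of_simps)
    fix b assume b: "b \<in> car B"
    show "act ?N x (a + b) = act ?N x a + act ?N x b"
      using Lam_act(2)[OF M xM a car0(2) b car0(2), of 0 0] by (simp add: triple_of_simps)
    show "act ?N x (mul B a b) = act ?N (act ?N x a) b"
      using Lam_act(4)[OF M xM a car0(2) b car0(2), of 0 0] b by (simp add: triple_of_simps zero_simps)
  qed
qed

lemma fd_tspc: "fd_space (tspc (triple_of B E M))"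
proof -
  have "fd_space (M\<lparr>car := {x \<in> car M. act M x (0, 0, 1) = x}\<rparr>)"
    by (rule fd_sub[OF sM _ act_idem_subspace]) (auto simp: zero_simps)
  then show ?thesis by (simp add: fd_space_def triple_of_def Let_def)
qed

lemma triple_of_is_trip:
  "is_trip B E (tmod (triple_of B E M)) (tspc (triple_of B E M)) (tmap (triple_of B E M))"
  unfolding is_trip_def
proof (intro conjI fd_tmod fd_tspc)
  let ?N = "tmod (triple_of B E M)" and ?W = "tspc (triple_of B E M)" and ?\<eta> = "tmap (triple_of B E M)"
  have WM: "w \<in> car M" if "w \<in> car ?W" for w using that by (simp add: triple_of_simps)
  note smulNM = triple_of_simps(2)[of M]
  show "?\<eta> \<in> lin ?W (hom_space B E ?N)"
    unfolding lin_iff linear_on_def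
  proof (intro conjI ballI allI impI)
    fix w assume w: "w \<in> car ?W"
    have val: "?\<eta> w e = act M w (0, e, 0)" if "e \<in> car E" for e
      using w that triple_of_simps(6) by presburger
    have off: "?\<eta> w e = 0" if "e \<notin> car E" for e
      using that triple_of_simps(6) by presburger
    have "?\<eta> w \<in> hom B E ?N"
      unfolding hom_def lin_def mem_Collect_eq
    proof (intro conjI ballI allI impI)
      fix e assume e: "e \<in> car E"
      show "?\<eta> w e \<in> car ?N" using tmap_car[OF w e] val[OF e] by simp
      show "?\<eta> w (e + e') = ?\<eta> w e + ?\<eta> w e'" if e': "e' \<in> car E" for e'
        using Lam_act(2)[OF M WM[OF w] car0(1) e car0(1) e', of 0 0]
        by (simp add: val e e' fd_car(2)[OF sE e e'])
      show "?\<eta> w (smul E r e) = smul ?N r (?\<eta> w e)" for r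
        using Lam_act(3)[OF M WM[OF w] car0(1) e, of r 0]
        by (simp add: val e fd_car(3)[OF sE e] smulNM zero_simps)
      show "?\<eta> w (act E e b) = act ?N (?\<eta> w e) b" if b: "b \<in> car B" for b
        using Lam_act(4)[OF M WM[OF w] car0(1) e b car0(2), of 0 0]
        by (simp add: val e fd_moduleD(2)[OF E e b] triple_of_simps(3) zero_simps b)
    qed (rule off)
    then show "?\<eta> w \<in> car (hom_space B E ?N)" by (simp add: hom_space_def)
    show "?\<eta> (w + w') = ?\<eta> w + ?\<eta> w'" if w': "w' \<in> car ?W" for w'
      using act_sum(1)[OF WM[OF w] WM[OF w'] car0(1)] w w' fd_car(2)[OF fd_tspc w w']
      by (intro ext) (simp add: triple_of_simps(6))
    show "?\<eta> (smul ?W r w) = smul (hom_space B E ?N) r (?\<eta> w)" for r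
      using act_sum(2)[OF WM[OF w] car0(1)] w fd_car(3)[OF fd_tspc w]
      by (intro ext) (simp add: triple_of_simps(6) triple_of_simps(2,5) hom_space_def fd_smul[OF sM])
  next
    fix w assume "w \<notin> car ?W"
    then show "?\<eta> w = 0" by (intro ext) (simp add: triple_of_simps(6))
  qed
qed

end

text \<open>As \<open>M\<close> is the sum of its two components, \<open>F\<close> is \<open>f\<close> on the first and \<open>g\<close> on the second; compatibility of
  \<open>f\<close> and \<open>g\<close> with the structure maps is compatibility of \<open>F\<close> with the off-diagonal matrices.\<close>

lemma extend_triple_hom:
  fixes M M' :: "('k, 'b \<times> 'e \<times> 'k) cmodule"
  assumes M: "fd_module Lam M" and M': "fd_module Lam M'"
    and fg: "(f, g) \<in> triple_hom B (triple_of B E M) (triple_of B E M')"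
  obtains F where "F \<in> hom Lam M M'" "\<And>x. x \<in> car (tmod (triple_of B E M)) \<Longrightarrow> F x = f x"
    "\<And>x. x \<in> car (tspc (triple_of B E M)) \<Longrightarrow> F x = g x"
proof -
  let ?N = "tmod (triple_of B E M)" and ?W = "tspc (triple_of B E M)" and ?\<eta> = "tmap (triple_of B E M)"
  let ?N' = "tmod (triple_of B E M')" and ?W' = "tspc (triple_of B E M')" and ?\<eta>' = "tmap (triple_of B E M')"
  have f: "f \<in> hom B ?N ?N'" and g: "g \<in> lin ?W ?W'" and c: "\<And>w. w \<in> car ?W \<Longrightarrow> f \<circ> ?\<eta> w = ?\<eta>' (g w)"
    using fg by (auto simp: triple_hom_def)
  note lf = linear_onD[OF hom_linear_on[OF f]] and lg = linear_onD[OF lin_linear_on[OF g]]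
  have af: "f (act ?N x b) = act ?N' (f x) b" if "x \<in> car ?N" "b \<in> car B" for x b
    using f that by (simp add: hom_def)
  note sM = fd_module_space[OF M] and sM' = fd_module_space[OF M']
  define p where "p x = act M x (unt B, 0, 0)" for x
  define q where "q x = act M x (0, 0, 1)" for x
  have pq: "p x \<in> car ?N" "q x \<in> car ?W" "p x + q x = x" if "x \<in> car M" for x
    unfolding p_def q_def using triple_of_components[OF M that] by blast+
  have NM: "x \<in> car M" if "x \<in> car ?N \<or> x \<in> car ?W" for x using that by (auto simp: triple_of_simps)
  have NM': "x \<in> car M'" if "x \<in> car ?N' \<or> x \<in> car ?W'" for x using that by (auto simp: triple_of_simps)
  have lp: "p (x + y) = p x + p y" "q (x + y) = q x + q y" if "x \<in> car M" "y \<in> car M" for x y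
    using act_sum(1)[OF M that] by (simp_all add: p_def q_def zero_simps)
  have sp: "p (smul M r x) = smul M r (p x)" "q (smul M r x) = smul M r (q x)" if "x \<in> car M" for x r
    using act_sum(2)[OF M that] by (simp_all add: p_def q_def zero_simps)
  define F where "F x = (if x \<in> car M then f (p x) + g (q x) else 0)" for x
  have FM: "F x \<in> car M'" if "x \<in> car M" for x
    using that pq[OF that] lf(1) lg(1) NM' fd_car(2)[OF sM'] by (simp add: F_def)
  have "F (act M x a) = act M' (F x) a" if x: "x \<in> car M" and a: "a \<in> car Lam" for x a
  proof -
    obtain b e r where ber: "a = (b, e, r)" "b \<in> car B" "e \<in> car E"
      using a by (cases a) (auto simp: Lam_simps)
    note P = pq(1)[OF x] and Q = pq(2)[OF x]
    have xa: "act M x a \<in> car M" using Lam_act(1)[OF M x ber(2,3)] ber(1) by simp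
    have ve: "?\<eta> (q x) e = act M (q x) (0, e, 0)" using Q ber(3) triple_of_simps(6) by presburger
    have ve': "?\<eta>' (g (q x)) e = act M' (g (q x)) (0, e, 0)"
      using lg(1)[OF Q] ber(3) triple_of_simps(6) by presburger
    have "p (act M x a) = act M x (b, e, 0)"
      using Lam_act(4)[OF M x ber(2,3) B_alg(1) car0(2), of r 0] ber by (simp add: p_def zero_simps)
    also have "\<dots> = act M (p x + q x) (b, e, 0)" by (simp only: pq(3)[OF x])
    also have "\<dots> = act M (p x) (b, e, 0) + act M (q x) (b, e, 0)"
      by (rule act_sum(1)[OF M NM NM ber(2,3)]) (use P Q in auto)
    also have "\<dots> = act ?N (p x) b + ?\<eta> (q x) e"
      unfolding tmod_act[OF M P ber(2,3)] tspc_act[OF M Q ber(2,3)] ve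
      by (simp add: triple_of_simps(3) fd_smul[OF sM])
    finally have pa: "p (act M x a) = act ?N (p x) b + ?\<eta> (q x) e" .
    have "q (act M x a) = act M x (0, 0, r)"
      using Lam_act(4)[OF M x ber(2,3) car0, of r 1] ber by (simp add: q_def zero_simps)
    also have "\<dots> = smul ?W r (q x)"
      unfolding q_def triple_of_simps(5) by (rule Lam_act(8)[OF M x])
    finally have qa: "q (act M x a) = smul ?W r (q x)" .
    have \<eta>N: "?\<eta> (q x) e \<in> car ?N" unfolding ve by (rule tmap_car[OF M Q ber(3)])
    have "F (act M x a) = f (act ?N (p x) b) + f (?\<eta> (q x) e) + g (smul ?W r (q x))"
      unfolding F_def if_P[OF xa] pa qa
      by (subst lf(2)[OF fd_moduleD(2)[OF fd_tmod[OF M] P ber(2)] \<eta>N]) (rule refl)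
    also have "f (?\<eta> (q x) e) = ?\<eta>' (g (q x)) e" using fun_cong[OF c[OF Q], of e] by simp
    finally have L: "F (act M x a) = act ?N' (f (p x)) b + act M' (g (q x)) (0, e, 0) + smul ?W' r (g (q x))"
      by (simp only: ve' af[OF P ber(2)] lg(3)[OF Q])
    have "act M' (F x) a = act M' (f (p x)) (b, e, r) + act M' (g (q x)) (b, e, r)"
      unfolding F_def if_P[OF x] ber(1)
      by (rule act_sum(1)[OF M' NM' NM' ber(2,3)]) (use lf(1)[OF P] lg(1)[OF Q] in auto)
    also have "\<dots> = act M' (f (p x)) (b, 0, 0) + (act M' (g (q x)) (0, e, 0) + smul M' r (g (q x)))"
      by (simp only: tmod_act[OF M' lf(1)[OF P] ber(2,3)] tspc_act[OF M' lg(1)[OF Q] ber(2,3)])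
    finally show ?thesis unfolding L by (simp add: triple_of_simps(3,5) add.assoc)
  qed
  moreover have "F \<in> lin M M'"
    unfolding lin_iff linear_on_def
  proof (intro conjI ballI allI impI FM)
    fix x assume x: "x \<in> car M"
    show "F (x + y) = F x + F y" if y: "y \<in> car M" for y
      using fd_car(2)[OF sM x y] x y lp[OF x y] lf(2)[OF pq(1)[OF x] pq(1)[OF y]]
        lg(2)[OF pq(2)[OF x] pq(2)[OF y]] by (simp add: F_def)
    show "F (smul M r x) = smul M' r (F x)" for r
      using fd_car(3)[OF sM x] x sp[OF x] lf(3)[OF pq(1)[OF x]] lg(3)[OF pq(2)[OF x]]
      by (simp add: F_def triple_of_simps(2,5) fd_smul[OF sM'])
  qed (simp_all add: F_def)
  ultimately have F: "F \<in> hom Lam M M'" by (simp add: hom_def)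
  have f0: "f 0 = 0" "g 0 = 0"
    using lin_0[OF hom_lin[OF f] fd_module_space[OF fd_tmod[OF M]]] lin_0[OF g fd_tspc[OF M]] by simp_all
  have "F x = f x" if x: "x \<in> car ?N" for x
  proof -
    have px: "p x = x" using x by (simp add: p_def triple_of_simps)
    then have "q x = 0" using pq(3)[OF NM] x by (metis add_cancel_right_right)
    then show ?thesis using NM x px f0 by (simp add: F_def)
  qed
  moreover have "F x = g x" if x: "x \<in> car ?W" for x
  proof -
    have qx: "q x = x" using x by (simp add: q_def triple_of_simps)
    then have "p x = 0" using pq(3)[OF NM] x by (metis add_cancel_right_left)
    then show ?thesis using NM x qx f0 by (simp add: F_def)
  qed
  ultimately show thesis using that F by blast
qed

lemma triple_of_brick:
  fixes M :: "('k, 'b \<times> 'e \<times> 'k) cmodule"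
  assumes "brick Lam M"
  shows "triple_brick B E (triple_of B E M)"
proof -
  let ?N = "tmod (triple_of B E M)" and ?W = "tspc (triple_of B E M)"
  have M: "fd_module Lam M" and n: "nonzero M" and s: "hom Lam M M = range (homothety M)"
    using assms by (auto simp: brick_def)
  note T = triple_of_is_trip[OF M] and sM = fd_module_space[OF M]
  have "nonzero ?N \<or> nonzero ?W"
  proof (rule ccontr)
    assume "\<not> ?thesis"
    then have "x = 0" if "x \<in> car M" for x
      using triple_of_components[OF M that] by (simp add: nonzero_def)
    then show False using n fd_car(1)[OF sM] by (auto simp: nonzero_def)
  qed
  moreover have "scalar_endos B ?N ?W (tmap (triple_of B E M))"
  proof (rule scalar_endosI[OF E T])
    fix f g assume fg: "(f, g) \<in> trip_hom B ?N ?W (tmap (triple_of B E M)) ?N ?W (tmap (triple_of B E M))"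
    then obtain F where F: "F \<in> hom Lam M M" "\<And>x. x \<in> car ?N \<Longrightarrow> F x = f x" "\<And>x. x \<in> car ?W \<Longrightarrow> F x = g x"
      using extend_triple_hom[OF M M, of f g] unfolding triple_hom_def trip_hom_def by blast
    obtain r where r: "F = homothety M r" using F(1) s by blast
    have "f x = homothety ?N r x" for x
      using F(2)[of x] lin_off[OF hom_lin[OF trip_homD(1)[OF fg]], of x] unfolding r
      by (cases "x \<in> car ?N") (auto simp: homothety_def triple_of_simps)
    moreover have "g x = homothety ?W r x" for x
      using F(3)[of x] lin_off[OF trip_homD(2)[OF fg], of x] unfolding r
      by (cases "x \<in> car ?W") (auto simp: homothety_def triple_of_simps)
    ultimately show "\<exists>r. f = homothety ?N r \<and> g = homothety ?W r" by blast
  qed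
  ultimately show ?thesis using T by (simp add: triple_brick_iff)
qed

lemma triple_of_iso:
  fixes M M' :: "('k, 'b \<times> 'e \<times> 'k) cmodule"
  assumes M: "fd_module Lam M" and M': "fd_module Lam M'"
    and iso: "triple_iso B (triple_of B E M) (triple_of B E M')"
  shows "iso Lam M M'"
proof -
  let ?N = "tmod (triple_of B E M)" and ?W = "tspc (triple_of B E M)"
  let ?N' = "tmod (triple_of B E M')" and ?W' = "tspc (triple_of B E M')"
  obtain f g where fg: "(f, g) \<in> triple_hom B (triple_of B E M) (triple_of B E M')"
    and b: "bij_betw f (car ?N) (car ?N')" "bij_betw g (car ?W) (car ?W')"
    using iso by (auto simp: triple_iso_def)
  obtain F where F: "F \<in> hom Lam M M'" "\<And>x. x \<in> car ?N \<Longrightarrow> F x = f x" "\<And>x. x \<in> car ?W \<Longrightarrow> F x = g x"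
    by (rule extend_triple_hom[OF M M' fg]) (rule that)
  note sM = fd_module_space[OF M] and sM' = fd_module_space[OF M']
  note lF = hom_linear_on[OF F(1)]
  have comp: "F (act M x a) = act M' (F x) a" if "x \<in> car M" "a \<in> car Lam" for x a
    using F(1) that by (simp add: hom_def)
  have N0: "0 \<in> car ?N" "0 \<in> car ?W" using fd_car(1) fd_module_space[OF fd_tmod[OF M]] fd_tspc[OF M] by blast+
  have NM: "x \<in> car M" if "x \<in> car ?N \<or> x \<in> car ?W" for x using that by (auto simp: triple_of_simps)
  have F0: "F 0 = 0" by (rule linear_on_0[OF lF sM])
  have inj: "x = 0" if x: "x \<in> car M" "F x = 0" for x
  proof -
    note c = triple_of_components[OF M x(1)]
    have "F (act M x (unt B, 0, 0)) = F 0" "F (act M x (0, 0, 1)) = F 0"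
      using comp[OF x(1), of "(unt B, 0, 0)"] comp[OF x(1), of "(0, 0, 1)"] x(2) act_0[OF M'] F0
      by (simp_all add: Lam_simps zero_simps)
    then have "f (act M x (unt B, 0, 0)) = f 0" "g (act M x (0, 0, 1)) = g 0"
      using F(2)[OF c(1)] F(2)[OF N0(1)] F(3)[OF c(2)] F(3)[OF N0(2)] by simp_all
    then have "act M x (unt B, 0, 0) = 0" "act M x (0, 0, 1) = 0"
      using inj_onD[OF bij_betw_imp_inj_on[OF b(1)] _ c(1) N0(1)]
        inj_onD[OF bij_betw_imp_inj_on[OF b(2)] _ c(2) N0(2)] by simp_all
    then show "x = 0" using c(3) by simp
  qed
  have "car M' \<subseteq> F ` car M"
  proof
    fix y assume y: "y \<in> car M'"
    note c = triple_of_components[OF M' y]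
    obtain u where u: "act M' y (unt B, 0, 0) = f u" "u \<in> car ?N"
      by (rule imageE[OF c(1)[folded bij_betw_imp_surj_on[OF b(1)]]])
    obtain w where w: "act M' y (0, 0, 1) = g w" "w \<in> car ?W"
      by (rule imageE[OF c(2)[folded bij_betw_imp_surj_on[OF b(2)]]])
    have uw: "u \<in> car M" "w \<in> car M" using NM u(2) w(2) by simp_all
    have "F (u + w) = F u + F w" by (rule linear_onD(2)[OF lF uw])
    then have "F (u + w) = y" using F(2)[OF u(2)] F(3)[OF w(2)] u(1) w(1) c(3) by simp
    moreover have "u + w \<in> car M" by (rule fd_car(2)[OF sM uw])
    ultimately show "y \<in> F ` car M" by blast
  qed
  then have "bij_betw F (car M) (car M')"
    unfolding bij_betw_def
    by (intro conjI inj_on_linear[OF lF sM inj] equalityI image_subsetI linear_onD(1)[OF lF])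
  then show ?thesis by (rule iso_bijI[OF F(1)])
qed

text \<open>For \<open>N = 0\<close> every linear endomorphism of \<open>W\<close> is an endomorphism of the triple. One of
  rank one is a scalar only if \<open>W\<close> is a line.\<close>

lemma simple_triples_iso:
  assumes T: "triple_brick B E T" "\<not> nonzero (tmod T)" and T': "triple_brick B E T'" "\<not> nonzero (tmod T')"
  shows "triple_iso B T T'"
proof -
  have one: "vdim (tspc S) = 1" if S: "triple_brick B E S" "\<not> nonzero (tmod S)" for S :: "('k, 'b, 'e) triple"
  proof -
    let ?N = "tmod S" and ?W = "tspc S"
    have t: "is_trip B E ?N ?W (tmap S)" "nonzero ?W" "scalar_endos B ?N ?W (tmap S)"
      using S by (auto simp: triple_brick_iff)
    note W = is_tripD(3)[OF t(1)] and N = is_tripD(2)[OF t(1)]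
    have N0: "car ?N = {0}" using S(2) by (simp add: nonzero_def)
    obtain w where w: "w \<in> car ?W" "w \<noteq> 0" using t(2) fd_car(1)[OF W] by (auto simp: nonzero_def)
    obtain g \<kappa> where g: "g \<in> lin ?W ?W" "\<And>x. x \<in> car ?W \<Longrightarrow> g x = smul ?W (\<kappa> x) w" "\<kappa> w \<noteq> 0"
      by (rule ex_rank_one_map[OF W w]) (rule that)
    have h0: "homothety ?N 0 x = 0" for x by (simp add: homothety_def fd_smul[OF N])
    have "tmap S v e = 0" for v e
    proof (cases "v \<in> car ?W")
      case True
      show ?thesis using lin_car[OF hom_lin[OF is_tripD(5)[OF t(1) True]] N, of e] N0 by simp
    next
      case False
      then show ?thesis using lin_off[OF is_tripD(4)[OF t(1)]] by simp
    qed
    then have "(homothety ?N 0, g) \<in> trip_hom B ?N ?W (tmap S) ?N ?W (tmap S)"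
      using g(1) homothety_hom[OF is_tripD(1)[OF t(1)]] h0 by (intro trip_homI) (auto simp: fun_eq_iff)
    then obtain r where r: "g = homothety ?W r" using t(3) by (auto simp: scalar_endos_def)
    have "smul ?W (\<kappa> w - r) w = 0"
      using fun_cong[OF r, of w] w(1) by (simp add: g(2) homothety_def fd_smul[OF W])
    then have rw: "r \<noteq> 0" using g(3) w(2) by (auto simp: fd_smul[OF W])
    have "basis_fam ?W {()} (\<lambda>_. w)"
      unfolding basis_fam_def
    proof (intro conjI ballI allI impI)
      show "\<exists>c. x = (\<Sum>i\<in>{()}. smul ?W (c i) w)" if x: "x \<in> car ?W" for x
      proof -
        have "smul ?W r x = smul ?W (\<kappa> x) w"
          using fun_cong[OF r, of x] x by (simp add: g(2) homothety_def)
        then have "smul ?W (inverse r) (smul ?W r x) = smul ?W (inverse r) (smul ?W (\<kappa> x) w)" by simp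
        then have "x = smul ?W (inverse r * \<kappa> x) w" using rw by (simp add: fd_smul[OF W])
        then show ?thesis by (intro exI[of _ "\<lambda>_. inverse r * \<kappa> x"]) simp
      qed
    qed (use w in \<open>auto simp: fd_smul[OF W]\<close>)
    from basis_fam_vdim(2)[OF fd_vs[OF W] fd_subspace[OF W] this] show ?thesis by simp
  qed
  have t: "is_trip B E (tmod T) (tspc T) (tmap T)" "is_trip B E (tmod T') (tspc T') (tmap T')"
    using T T' by (auto simp: triple_brick_iff)
  note W = is_tripD(3)[OF t(1)] is_tripD(3)[OF t(2)] and N = is_tripD(2)[OF t(1)] is_tripD(2)[OF t(2)]
  have N0: "car (tmod T) = {0}" "car (tmod T') = {0}" using T(2) T'(2) by (simp_all add: nonzero_def)
  obtain g where g: "g \<in> lin (tspc T) (tspc T')" "bij_betw g (car (tspc T)) (car (tspc T'))"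
    using ex_lin_bij[OF W] one[OF T] one[OF T'] by metis
  have f: "(\<lambda>_. 0) \<in> hom B (tmod T) (tmod T')"
    using N0 act_0[OF is_tripD(1)[OF t(2)]] by (auto simp: hom_def lin_def fd_smul[OF N(2)])
  have "tmap T' v e = 0" if "v \<in> car (tspc T')" for v e
    using lin_car[OF hom_lin[OF is_tripD(5)[OF t(2) that]] N(2), of e] N0(2) by simp
  then have "((\<lambda>_. 0), g) \<in> trip_hom B (tmod T) (tspc T) (tmap T) (tmod T') (tspc T') (tmap T')"
    using f g linear_onD(1)[OF lin_linear_on[OF g(1)]] by (intro trip_homI) (auto simp: fun_eq_iff)
  moreover have "bij_betw (\<lambda>_. 0) (car (tmod T)) (car (tmod T'))"
    unfolding N0 by (simp add: bij_betw_def)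
  ultimately show ?thesis using g(2) unfolding triple_iso_trip_iso trip_iso_def by blast
qed

lemma zero_lin: "fd_space W' \<Longrightarrow> 0 \<in> lin W W'"
  by (auto simp: lin_def fd_car fd_smul)

lemma base_triple_brick:
  assumes T: "triple_brick B E T" "\<not> nonzero (tspc T)"
  shows "brick B (tmod T)"
proof -
  let ?N = "tmod T" and ?W = "tspc T"
  have t: "is_trip B E ?N ?W (tmap T)" "nonzero ?N" "scalar_endos B ?N ?W (tmap T)"
    using T by (auto simp: triple_brick_iff)
  note W = is_tripD(3)[OF t(1)] and N = is_tripD(2)[OF t(1)] and mN = is_tripD(1)[OF t(1)]
  have W0: "car ?W = {0}" using T(2) by (simp add: nonzero_def)
  have \<eta>0: "tmap T 0 = 0" by (rule lin_0[OF is_tripD(4)[OF t(1)] W])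
  have "\<exists>r. f = homothety ?N r" if f: "f \<in> hom B ?N ?N" for f
  proof -
    have "f 0 = 0" by (rule lin_0[OF hom_lin[OF f] N])
    then have "f \<circ> 0 = (0 :: 'e \<Rightarrow> _)" by (intro ext) simp
    then have "(f, 0) \<in> trip_hom B ?N ?W (tmap T) ?N ?W (tmap T)"
      using W0 \<eta>0 by (intro trip_homI f zero_lin W) simp
    then show ?thesis using t(3) by (auto simp: scalar_endos_def)
  qed
  then have "hom B ?N ?N = range (homothety ?N)" using homothety_hom[OF mN] by blast
  then show ?thesis using mN t(2) by (simp add: brick_def)
qed

lemma base_triples_iso:
  assumes T: "triple_brick B E T" "\<not> nonzero (tspc T)" and T': "triple_brick B E T'" "\<not> nonzero (tspc T')"
    and iso: "iso B (tmod T) (tmod T')"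
  shows "triple_iso B T T'"
proof -
  have t: "is_trip B E (tmod T) (tspc T) (tmap T)" "is_trip B E (tmod T') (tspc T') (tmap T')"
    using T T' by (auto simp: triple_brick_iff)
  note W = is_tripD(3)[OF t(1)] is_tripD(3)[OF t(2)]
  have W0: "car (tspc T) = {0}" "car (tspc T') = {0}" using T(2) T'(2) by (simp_all add: nonzero_def)
  have \<eta>0: "tmap T 0 = 0" "tmap T' 0 = 0"
    using lin_0[OF is_tripD(4)[OF t(1)] W(1)] lin_0[OF is_tripD(4)[OF t(2)] W(2)] by simp_all
  obtain f where f: "f \<in> hom B (tmod T) (tmod T')" "bij_betw f (car (tmod T)) (car (tmod T'))"
    using iso by (auto simp: iso_def)
  have "f 0 = 0" by (rule lin_0[OF hom_lin[OF f(1)] is_tripD(2)[OF t(1)]])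
  then have "f \<circ> 0 = (0 :: 'e \<Rightarrow> _)" by (intro ext) simp
  then have "(f, 0) \<in> trip_hom B (tmod T) (tspc T) (tmap T) (tmod T') (tspc T') (tmap T')"
    using W0 \<eta>0 by (intro trip_homI f zero_lin W) simp
  moreover have "bij_betw (0 :: (nat \<Rightarrow> 'k) \<Rightarrow> nat \<Rightarrow> 'k) (car (tspc T)) (car (tspc T'))"
    unfolding W0 by (simp add: bij_betw_def)
  ultimately show ?thesis using f(2) unfolding triple_iso_trip_iso trip_iso_def by blast
qed

text \<open>A brick of the extension is labelled by the representative of its kind: \<open>None\<close> if \<open>N = 0\<close>, a brick
  of \<open>B\<close> if \<open>W = 0\<close>, and a mixed brick otherwise.\<close>

lemma brick_finite_ext:
  assumes mixed: "fin_many (mixed_brick B E) (triple_iso B)" and base: "brick_finite B"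
  shows "brick_finite Lam"
proof -
  obtain FM where FM: "finite FM" "\<And>T. T \<in> FM \<Longrightarrow> mixed_brick B E T"
    "\<And>T. mixed_brick B E T \<Longrightarrow> \<exists>T'\<in>FM. triple_iso B T T'"
    using fin_many_reps[OF mixed] triple_iso_equiv(1)[OF E] by (metis mixed_brick_def)
  have fdB: "fd_module B N" if "brick B N" for N :: "('k, 'b) cmodule" using that by (simp add: brick_def)
  obtain FB :: "('k, 'b) cmodule set" where FB: "finite FB" "\<And>N. N \<in> FB \<Longrightarrow> brick B N"
    "\<And>N :: ('k, 'b) cmodule. brick B N \<Longrightarrow> \<exists>N'\<in>FB. iso B N N'"
    by (rule fin_many_reps[OF base[unfolded brick_finite_def] iso_equiv(1)[OF fdB]], assumption)
      (rule that)
  define S where "S M y = (let T = triple_of B E M in case y of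
      None \<Rightarrow> \<not> nonzero (tmod T)
    | Some (Inl N) \<Rightarrow> \<not> nonzero (tspc T) \<and> iso B (tmod T) N
    | Some (Inr T') \<Rightarrow> triple_iso B T T')"
    for M :: "('k, 'b \<times> 'e \<times> 'k) cmodule" and y :: "(('k, 'b) cmodule + ('k, 'b, 'e) triple) option"
  have fd: "fd_module Lam M" if "brick Lam M" for M :: "('k, 'b \<times> 'e \<times> 'k) cmodule"
    using that by (simp add: brick_def)
  show ?thesis
    unfolding brick_finite_def
  proof (rule fin_manyI[where S = S and F = "insert None (Some ` (Inl ` FB \<union> Inr ` FM))"])
    show "finite (insert None (Some ` (Inl ` FB \<union> Inr ` FM)))" using FM(1) FB(1) by simp
  next
    fix M :: "('k, 'b \<times> 'e \<times> 'k) cmodule" assume "brick Lam M"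
    then have T: "triple_brick B E (triple_of B E M)" by (rule triple_of_brick)
    consider "\<not> nonzero (tmod (triple_of B E M))" | "\<not> nonzero (tspc (triple_of B E M))"
      | "mixed_brick B E (triple_of B E M)" using T by (auto simp: mixed_brick_def)
    then show "\<exists>y\<in>insert None (Some ` (Inl ` FB \<union> Inr ` FM)). S M y"
    proof cases
      case 1
      then show ?thesis by (intro bexI[of _ None]) (auto simp: S_def)
    next
      case 2
      obtain N where "N \<in> FB" "iso B (tmod (triple_of B E M)) N" using FB(3)[OF base_triple_brick[OF T 2]] by blast
      then show ?thesis using 2 by (intro bexI[of _ "Some (Inl N)"]) (auto simp: S_def Let_def)
    next
      case 3
      then obtain T' where "T' \<in> FM" "triple_iso B (triple_of B E M) T'" using FM(3) by blast
      then show ?thesis by (intro bexI[of _ "Some (Inr T')"]) (auto simp: S_def Let_def)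
    qed
  next
    fix M M' :: "('k, 'b \<times> 'e \<times> 'k) cmodule" and y
    assume b: "brick Lam M" "brick Lam M'" and y: "y \<in> insert None (Some ` (Inl ` FB \<union> Inr ` FM))"
      and S: "S M y" "S M' y"
    note T = triple_of_brick[OF b(1)] triple_of_brick[OF b(2)]
    consider "y = None" | N where "N \<in> FB" "y = Some (Inl N)" | T' where "T' \<in> FM" "y = Some (Inr T')"
      using y by auto
    then have "triple_iso B (triple_of B E M) (triple_of B E M')"
    proof cases
      case 1
      then show ?thesis using S simple_triples_iso[OF T(1) _ T(2)] by (simp add: S_def)
    next
      case 2
      have s: "\<not> nonzero (tspc (triple_of B E M))" "iso B (tmod (triple_of B E M)) N"
        "\<not> nonzero (tspc (triple_of B E M'))" "iso B (tmod (triple_of B E M')) N"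
        using S 2(2) by (simp_all add: S_def Let_def)
      have "iso B N (tmod (triple_of B E M'))"
        by (rule iso_equiv(2)[OF fdB[OF base_triple_brick[OF T(2) s(3)]] s(4)])
      then show ?thesis
        using base_triples_iso[OF T(1) s(1) T(2) s(3)] iso_equiv(3)[OF fdB[OF FB(2)[OF 2(1)]] s(2)] by blast
    next
      case 3
      have s: "triple_iso B (triple_of B E M) T'" "triple_iso B (triple_of B E M') T'"
        using S 3(2) by (simp_all add: S_def Let_def)
      have T': "triple_brick B E T'" using FM(2)[OF 3(1)] by (simp add: mixed_brick_def)
      show ?thesis
        by (rule triple_iso_equiv(3)[OF E T' s(1) triple_iso_equiv(2)[OF E T(2) T' s(2)]])
    qed
    then show "iso Lam M M'" by (rule triple_of_iso[OF fd[OF b(1)] fd[OF b(2)]])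
  next
    fix M M' M'' :: "('k, 'b \<times> 'e \<times> 'k) cmodule"
    assume b: "brick Lam M" "brick Lam M'"
    show "iso Lam M M' \<Longrightarrow> iso Lam M' M" by (rule iso_equiv(2)[OF fd[OF b(1)]])
    show "iso Lam M M' \<Longrightarrow> iso Lam M' M'' \<Longrightarrow> iso Lam M M''" by (rule iso_equiv(3)[OF fd[OF b(2)]])
  qed
qed

end

theorem theorem4:
  fixes B :: "('k::alg_closed_field, 'b::ab_group_add) algebra"
    and E :: "('k, 'b, 'e::ab_group_add) rmodule"
    and Xs :: "('k, 'b) cmodule list"
  assumes "fd_algebra B"
    and "fd_module B E"
    and "visible_finite B E"
    and "visible_reps B E Xs"
  shows "(fin_many (mixed_brick B E) (triple_iso B) \<longleftrightarrow>
            finite {p. admissible B E Xs p \<and> realized B E Xs p} \<and>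
            (\<forall>p. admissible B E Xs p \<and> realized B E Xs p \<longrightarrow> critical B E Xs p))
       \<and> (fin_many (mixed_brick B E) (triple_iso B) \<longrightarrow>
            (brick_finite (one_point_ext B E) \<longleftrightarrow> brick_finite B))"
proof -
  interpret one_point B E using assms(1,2) by unfold_locales
  show ?thesis
    using mixed_finite_if_critical[OF assms(2,4)] critical_if_mixed_finite[OF assms(2,4)]
      brick_finite_base brick_finite_ext by blast
qed

end
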